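(* Let $\Omega$ be an open set in $\mathbb R^{2n}$ and let $K$ be a compact subset of $\Omega$ such that $\Omega\setminus K$ is connected. Then for each $u\in\mathcal O(\Omega\setminus K)$ there exists $U\in\mathcal O(\Omega)$ such that $U=u$ on $\Omega\setminus K$.
   Context: Let $n$ be a positive integer and $m=\lfloor n/2\rfloor$. Let $W$ be a complex vector space with basis $f_1,\dots,f_m$; for $\alpha=\{\alpha_1<\dots<\alpha_h\}\subset\{1,\dots,m\}$ put $f_\alpha=f_{\alpha_1}\wedge\cdots\wedge f_{\alpha_h}$ ($f_\emptyset=1$), a basis of $\wedge^\bullet W$. Let $\varepsilon_j v=f_j\wedge v$, and let $\iota_j f_\alpha=0$ if $j\notin\alpha$, $\iota_j f_\alpha=(-1)^{t+1}f_{\alpha\setminus\{j\}}$ if $j=\alpha_t$. Put $\gamma_{2j-1}=\varepsilon_j-\iota_j$, $\gamma_{2j}=-\mathbf i(\varepsilon_j+\iota_j)$ for $1\le j\le m$ and, if $n=2m+1$, $\gamma_{n}f_\alpha=-\mathbf i(-1)^{\#\alpha}f_\alpha$. The spinor modules are $\mathbb S^+=\wedge^{\rm even}W$, $\mathbb S^-=\wedge^{\rm odd}W$ for $n$ even, and $\mathbb S^+=\mathbb S^-=\wedge^\bullet W$ for $n$ odd. Then $\gamma_j:\mathbb S^\pm\to\mathbb S^\mp$ and $\gamma_j\gamma_k+\gamma_k\gamma_j=-2\delta_{jk}\mathbf 1$. Write points of $\mathbb R^{2n}$ as $\mathbf x=(\mathbf x_0,\mathbf x_1)$ with $\mathbf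 x_A=(x_{A1},\dots,x_{An})$, $A=0,1$, let $\partial_{Aj}=\partial/\partial x_{Aj}$ and $\nabla_A=\sum_{j=1}^n\gamma_j\partial_{Aj}$. For $u$ with values in $\mathbb S^+$, $\mathscr D_0u=(\nabla_0u,\nabla_1u)^T$. A ($C^1$) function $u:\Omega\to\mathbb S^+$ on an open set $\Omega\subset\mathbb R^{2n}$ is called monogenic on $\Omega$ if $\mathscr D_0u(\mathbf x)=0$ for every $\mathbf x\in\Omega$; $\mathcal O(\Omega)$ denotes the space of monogenic functions on $\Omega$. *)

theory Defs
  imports "HOL-Analysis.Analysis"
begin

text \<open>
  Throughout \<open>n\<close> is the number of Clifford generators and \<open>m = n div 2 = dim W\<close>.
  An element of the exterior algebra of \<open>W\<close> is given by its coordinates with respect to the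
  basis \<open>f\<^sub>\<alpha>\<close>, \<open>\<alpha> \<subseteq> {1..m}\<close>; as \<open>m\<close> is a value and not a type, this
  is a function on sets of naturals that vanishes outside \<open>Pow {1..m}\<close>. All operators below
  are meant for arguments in this carrier and map it to itself.
\<close>

type_synonym ext = "nat set \<Rightarrow> complex"

definition ext_carrier :: "nat \<Rightarrow> ext set" where
  "ext_carrier m = {v. \<forall>\<alpha>. \<not> \<alpha> \<subseteq> {1..m} \<longrightarrow> v \<alpha> = 0}"

definition fb :: "nat set \<Rightarrow> ext" where
  "fb \<alpha> = (\<lambda>\<beta>. if \<beta> = \<alpha> then 1 else 0)"

definition lin_ext :: "nat \<Rightarrow> (nat set \<Rightarrow> ext) \<Rightarrow> ext \<Rightarrow> ext" where
  "lin_ext m T v = (\<lambda>\<beta>. \<Sum>\<alpha>\<in>Pow {1..m}. v \<alpha> * T \<alpha> \<beta>)"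

text \<open>
  Exterior product of basis elements: the sign is that of the permutation which sorts the
  increasing sequence of \<open>\<alpha>\<close> followed by the increasing sequence of \<open>\<beta>\<close>.
\<close>

definition wedge_basis :: "nat set \<Rightarrow> nat set \<Rightarrow> ext" where
  "wedge_basis \<alpha> \<beta> =
     (if \<alpha> \<inter> \<beta> = {}
      then (\<lambda>\<gamma>. (-1) ^ card {(a, b). a \<in> \<alpha> \<and> b \<in> \<beta> \<and> b < a} * fb (\<alpha> \<union> \<beta>) \<gamma>)
      else (\<lambda>\<gamma>. 0))"

definition wedge :: "nat \<Rightarrow> ext \<Rightarrow> ext \<Rightarrow> ext" where
  "wedge m v w = lin_ext m (\<lambda>\<alpha>. lin_ext m (wedge_basis \<alpha>) w) v"

definition eps :: "nat \<Rightarrow> nat \<Rightarrow> ext \<Rightarrow> ext" where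
  "eps m j v = wedge m (fb {j}) v"

text \<open>If \<open>j = \<alpha>\<^sub>t\<close> in the increasing enumeration of \<open>\<alpha>\<close>, then \<open>t = card {i \<in> \<alpha>. i \<le> j}\<close>.\<close>

definition iota :: "nat \<Rightarrow> nat \<Rightarrow> ext \<Rightarrow> ext" where
  "iota m j = lin_ext m (\<lambda>\<alpha>.
     if j \<in> \<alpha> then (\<lambda>\<beta>. (-1) ^ (card {i \<in> \<alpha>. i \<le> j} + 1) * fb (\<alpha> - {j}) \<beta>)
     else (\<lambda>\<beta>. 0))"

text \<open>Only the indices \<open>k \<in> {1..n}\<close> are meaningful.\<close>

definition gam :: "nat \<Rightarrow> nat \<Rightarrow> ext \<Rightarrow> ext" where
  "gam n k v =
     (let m = n div 2 in
      if odd n \<and> k = n then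
        lin_ext m (\<lambda>\<alpha> \<beta>. - \<i> * (-1) ^ card \<alpha> * fb \<alpha> \<beta>) v
      else if odd k then
        (let j = (k + 1) div 2 in (\<lambda>\<beta>. eps m j v \<beta> - iota m j v \<beta>))
      else
        (let j = k div 2 in (\<lambda>\<beta>. - \<i> * (eps m j v \<beta> + iota m j v \<beta>))))"

definition spinor_plus :: "nat \<Rightarrow> ext set" where
  "spinor_plus n =
     (if even n then {v \<in> ext_carrier (n div 2). \<forall>\<alpha>. odd (card \<alpha>) \<longrightarrow> v \<alpha> = 0}
      else ext_carrier (n div 2))"

text \<open>
  A point of \<open>\<real>\<^sup>2\<^sup>n\<close> is \<open>x :: real^'n^2\<close>, where the index type \<open>2\<close> has the
  elements \<open>0\<close> and \<open>1\<close>. Since the Clifford generators are numbered by \<open>{1..n}\<close>, so have to be the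
  coordinates: this is done by a bijection \<open>idx\<close> from \<open>{1..n}\<close> onto \<open>'n\<close>, and
  \<open>x\<^sub>A\<^sub>j = x $ A $ idx j\<close>.
\<close>

definition partial :: "(nat \<Rightarrow> 'n::finite) \<Rightarrow> 2 \<Rightarrow> nat \<Rightarrow> (real^'n^2 \<Rightarrow> complex) \<Rightarrow> real^'n^2 \<Rightarrow> complex" where
  "partial idx A j g x =
     vector_derivative (\<lambda>t. g (x + t *\<^sub>R axis A (axis (idx j) 1))) (at 0)"

definition nabla :: "nat \<Rightarrow> (nat \<Rightarrow> 'n::finite) \<Rightarrow> 2 \<Rightarrow> (real^'n^2 \<Rightarrow> ext) \<Rightarrow> real^'n^2 \<Rightarrow> ext" where
  "nabla n idx A u x =
     (\<lambda>\<beta>. \<Sum>j=1..n. gam n j (\<lambda>\<alpha>. partial idx A j (\<lambda>y. u y \<alpha>) x) \<beta>)"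

definition D0 :: "nat \<Rightarrow> (nat \<Rightarrow> 'n::finite) \<Rightarrow> (real^'n^2 \<Rightarrow> ext) \<Rightarrow> real^'n^2 \<Rightarrow> ext \<times> ext" where
  "D0 n idx u x = (nabla n idx 0 u x, nabla n idx 1 u x)"

text \<open>Continuous differentiability on an open set; continuity of \<open>g'\<close> is in the operator norm.\<close>

definition C1_on :: "'a::real_normed_vector set \<Rightarrow> ('a \<Rightarrow> 'b::real_normed_vector) \<Rightarrow> bool" where
  "C1_on S g \<longleftrightarrow>
     (\<exists>g' :: 'a \<Rightarrow> 'a \<Rightarrow>\<^sub>L 'b.
        (\<forall>x\<in>S. (g has_derivative blinfun_apply (g' x)) (at x)) \<and> continuous_on S g')"

definition monogenic :: "nat \<Rightarrow> (nat \<Rightarrow> 'n::finite) \<Rightarrow> (real^'n^2) set \<Rightarrow> (real^'n^2 \<Rightarrow> ext) set" where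
  "monogenic n idx \<Omega> =
     {u. (\<forall>x\<in>\<Omega>. u x \<in> spinor_plus n) \<and>
         (\<forall>\<alpha>. C1_on \<Omega> (\<lambda>x. u x \<alpha>)) \<and>
         (\<forall>x\<in>\<Omega>. D0 n idx u x = (\<lambda>\<beta>. 0, \<lambda>\<beta>. 0))}"

end

theory Submission
  imports Defs "HOL-Complex_Analysis.Conformal_Mappings"
begin

text \<open>
  The proof is the argument of Ehrenpreis for the Hartogs phenomenon. Cut \<open>u\<close> off near \<open>K\<close>: with a
  cut-off function \<open>h\<close> that is one near \<open>K\<close>, the function \<open>\<Phi> = (1 - h) u\<close> extends by zero
  across \<open>K\<close>, and \<open>f\<^sub>A = \<nabla>\<^sub>A \<Phi>\<close> has compact support for \<open>A = 0, 1\<close>. If \<open>v\<close> solves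
  \<open>\<nabla>\<^sub>A v = f\<^sub>A\<close> for both \<open>A\<close>, then \<open>\<Phi> - v\<close> is monogenic on \<open>\<Omega>\<close>, and it equals \<open>u\<close>
  wherever \<open>h\<close> and \<open>v\<close> vanish. So \<open>v\<close> has to vanish on some open set near the support of \<open>h\<close>;
  unique continuation on the connected set \<open>\<Omega> - K\<close> does the rest.

  By the Clifford relations \<open>\<nabla>\<^sub>A\<^sup>2 = - \<Delta>\<^sub>A\<close>, where \<open>\<Delta>\<^sub>A\<close> is the Laplacian in the variables
  \<open>x\<^sub>A\<close>. Hence each component of a monogenic function is harmonic in \<open>x\<^sub>0\<close> and in
  \<open>x\<^sub>1\<close> separately (\<open>dirac_null_partial_harmonic\<close>), and in particular harmonic on
  \<open>\<real>\<^bsup>2n\<^esup>\<close>. This has three uses.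

  \<^item> The system \<open>\<nabla>\<^sub>A v = f\<^sub>A\<close> is overdetermined, but it is solved by a single scalar formula: \<open>v\<close> is the
    Newton potential of \<open>\<Delta>\<Phi>\<close>, cut off to the support of \<open>h\<close>. Operators with constant
    coefficients commute with convolution and with each other, so \<open>\<nabla>\<^sub>A v\<close> is the Newton potential of
    \<open>\<Delta> f\<^sub>A\<close>, which is \<open>f\<^sub>A\<close> (\<open>extension_modulo_decaying\<close>).
  \<^item> The potential \<open>v\<close> decays at infinity. Let a half space be defined by one coordinate of \<open>x\<^sub>1\<close> and be
    disjoint from the support of \<open>h\<close>. There \<open>v\<close> is monogenic, and for fixed \<open>x\<^sub>1\<close> it is harmonic and
    decaying in \<open>x\<^sub>0 \<in> \<real>\<^sup>n\<close>; by the maximum principle it vanishes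
    (\<open>decaying_slice_harmonic_zero\<close>, \<open>decaying_dirac_null_halfspace\<close>). The largest such half space touches the support of
    \<open>h\<close>. It is here that two groups of variables are needed.
  \<^item> Harmonic functions satisfy unique continuation (\<open>harmonic_unique_continuation\<close>). They are locally Newton potentials of
    densities supported farther away, and since the dimension \<open>2n\<close> is even the Newton kernel
    \<open>|y|\<^bsup>2-2n\<^esup>\<close> is a rational function. Along a segment such a potential extends to a holomorphic function of
    one complex parameter, to which the identity theorem applies.

  Singular integrals do not occur. The Newton kernel is replaced by a \<open>C\<^sup>3\<close> function that equals it outside the
  ball of radius \<open>e\<close>, and whose Laplacian is a fixed multiple of a nonnegative bump of integral one supported
  in that ball. The formulas above then hold up to convolution with this bump, and that convolution leaves solutions
  unchanged: this is the mean value property (\<open>dirac_null_mvp\<close>). It is proved for \<open>C\<^sup>1\<close> solutions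
  by moving derivatives onto test functions, and it also yields their smoothness.

  For \<open>n = 1\<close> the kernel \<open>|y|\<^bsup>2-2n\<^esup>\<close> is constant and the argument breaks down; then monogenic functions are
  locally constant, and the theorem is immediate.
\<close>

section \<open>Partial derivatives and functions of class \<open>C\<^sup>m\<close>\<close>

text \<open>
  The derivative of \<open>f\<close> in the direction \<open>b\<close>. The vector derivative along a line is taken, and not
  the Frechet derivative, because the coordinate derivatives in the definition of monogenic functions
  have literally this form.
\<close>

definition pd :: "'a::real_normed_vector \<Rightarrow> ('a \<Rightarrow> complex) \<Rightarrow> 'a \<Rightarrow> complex" where
  "pd b f x = vector_derivative (\<lambda>t. f (x + t *\<^sub>R b)) (at 0)"

text \<open>
  Functions of class \<open>C\<^sup>m\<close> on an open set. Differentiability is part of the definition, so that the chain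
  rule applies at once; by recursion through the partial derivatives, closure properties follow by induction on
  \<open>m\<close>.
\<close>

primrec cdiff :: "nat \<Rightarrow> 'a::euclidean_space set \<Rightarrow> ('a \<Rightarrow> complex) \<Rightarrow> bool" where
  "cdiff 0 S f \<longleftrightarrow> continuous_on S f"
| "cdiff (Suc m) S f \<longleftrightarrow> (\<forall>x\<in>S. f differentiable at x) \<and> (\<forall>b\<in>Basis. cdiff m S (pd b f))"

lemma has_vector_derivative_line:
  assumes "(f has_derivative f') (at (x + t *\<^sub>R b))"
  shows "((\<lambda>t. f (x + t *\<^sub>R b)) has_vector_derivative f' b) (at t)"
proof -
  have "((\<lambda>t. x + t *\<^sub>R b) has_derivative (\<lambda>t. t *\<^sub>R b)) (at t)"
    by (auto intro!: derivative_eq_intros)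
  from has_derivative_compose[OF this assms]
  have "((\<lambda>t. f (x + t *\<^sub>R b)) has_derivative (\<lambda>t. f' (t *\<^sub>R b))) (at t)" .
  moreover have "f' (s *\<^sub>R b) = s *\<^sub>R f' b" for s
    using assms has_derivative_linear linear_cmul by blast
  ultimately show ?thesis by (simp add: has_vector_derivative_def)
qed

lemma pd_has_derivative:
  assumes "(f has_derivative f') (at x)" shows "pd b f x = f' b"
  unfolding pd_def
  using has_vector_derivative_line[of f f' x 0 b] assms by (simp add: vector_derivative_at)

lemma has_vector_derivative_pd:
  assumes "f differentiable at (x + t *\<^sub>R b)"
  shows "((\<lambda>t. f (x + t *\<^sub>R b)) has_vector_derivative pd b f (x + t *\<^sub>R b)) (at t)"
proof -
  obtain f' where f': "(f has_derivative f') (at (x + t *\<^sub>R b))"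
    using assms differentiable_def by blast
  show ?thesis using has_vector_derivative_line[OF f'] pd_has_derivative[OF f'] by simp
qed

lemma has_derivative_pd_sum:
  fixes f :: "'a::euclidean_space \<Rightarrow> complex"
  assumes "f differentiable at x"
  shows "(f has_derivative (\<lambda>h. \<Sum>b\<in>Basis. (h \<bullet> b) *\<^sub>R pd b f x)) (at x)"
proof -
  obtain f' where f': "(f has_derivative f') (at x)"
    using assms differentiable_def by blast
  interpret f': bounded_linear f' using f' by (rule has_derivative_bounded_linear)
  have "f' h = (\<Sum>b\<in>Basis. (h \<bullet> b) *\<^sub>R pd b f x)" for h
  proof -
    have "f' h = f' (\<Sum>b\<in>Basis. (h \<bullet> b) *\<^sub>R b)" by (simp add: euclidean_representation)
    also have "\<dots> = (\<Sum>b\<in>Basis. (h \<bullet> b) *\<^sub>R f' b)" by (simp add: f'.sum f'.scaleR)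
    finally show ?thesis using pd_has_derivative[OF f'] by simp
  qed
  then show ?thesis using f' by (metis (no_types, lifting) ext)
qed

lemma differentiable_cong_open:
  assumes "open S" "x \<in> S" "\<And>y. y \<in> S \<Longrightarrow> f y = g y" "f differentiable at x"
  shows "g differentiable at x"
  using assms has_derivative_transform_within_open unfolding differentiable_def by blast

lemma pd_cong_open:
  assumes "open S" "x \<in> S" "\<And>y. y \<in> S \<Longrightarrow> f y = g y"
  shows "pd b f x = pd b g x"
proof -
  have "\<forall>\<^sub>F t in nhds (0::real). x + t *\<^sub>R b \<in> S"
  proof -
    have "((\<lambda>t::real. x + t *\<^sub>R b) \<longlongrightarrow> x + 0 *\<^sub>R b) (nhds 0)"
      by (intro tendsto_intros filterlim_ident)
    then show ?thesis using assms(1,2) topological_tendstoD by fastforce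
  qed
  then show ?thesis unfolding pd_def
    by (intro vector_derivative_cong_eq) (auto elim!: eventually_mono simp: assms(3))
qed

lemma cdiff_cong:
  assumes "open S" "\<And>y. y \<in> S \<Longrightarrow> f y = g y"
  shows "cdiff m S f \<longleftrightarrow> cdiff m S g"
  using assms(2)
proof (induction m arbitrary: f g)
  case 0 then show ?case by (simp cong: continuous_on_cong)
next
  case (Suc m)
  have "cdiff m S (pd b f) \<longleftrightarrow> cdiff m S (pd b g)" for b
    by (rule Suc.IH, rule pd_cong_open[OF assms(1)]) (use Suc.prems in auto)
  moreover have "f differentiable at x \<longleftrightarrow> g differentiable at x" if "x \<in> S" for x
    using differentiable_cong_open[OF assms(1) that, of f g]
      differentiable_cong_open[OF assms(1) that, of g f] Suc.prems by auto
  ultimately show ?case by simp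
qed

lemma cdiff_subset: "cdiff m T f \<Longrightarrow> S \<subseteq> T \<Longrightarrow> cdiff m S f"
  by (induction m arbitrary: f) (auto intro: continuous_on_subset)

text \<open>
  Being \<open>C\<^sup>m\<close> is a pointwise condition on neighbourhoods. Most smooth functions below are glued
  from pieces on which they are visibly smooth, and this is the gluing principle.
\<close>

lemma cdiff_local:
  assumes "\<And>x. x \<in> S \<Longrightarrow> \<exists>T. open T \<and> x \<in> T \<and> cdiff m T f"
  shows "cdiff m S f"
  using assms
proof (induction m arbitrary: f)
  case 0
  have "continuous (at x) f" if "x \<in> S" for x
    using 0[OF that] by (auto simp: continuous_on_eq_continuous_at)
  then show ?case by (simp add: continuous_at_imp_continuous_on)
next
  case (Suc m)
  then show ?case by (simp) metis
qed

lemma cdiff_Un: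
  assumes "open S" "open T" "cdiff m S f" "cdiff m T f"
  shows "cdiff m (S \<union> T) f"
  by (rule cdiff_local) (use assms in blast)

lemma cdiff_continuous: "cdiff m S f \<Longrightarrow> continuous_on S f"
  by (cases m) (auto intro!: continuous_at_imp_continuous_on differentiable_imp_continuous_within)

lemma cdiff_Suc_imp: "cdiff (Suc m) S f \<Longrightarrow> cdiff m S f"
proof (induction m arbitrary: f)
  case 0 then show ?case using cdiff_continuous by fastforce
next
  case (Suc m) then show ?case by (metis cdiff.simps(2))
qed

lemma cdiff_le:
  assumes "cdiff n S f" "m \<le> n" shows "cdiff m S f"
  using assms(2,1)
proof (induction rule: dec_induct)
  case (step n)
  then show ?case using cdiff_Suc_imp[OF step.prems] by (simp del: cdiff.simps)
qed

lemma cdiff_differentiable: "cdiff m S f \<Longrightarrow> 0 < m \<Longrightarrow> x \<in> S \<Longrightarrow> f differentiable at x"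
  by (cases m) auto

lemma cdiff_pd: "cdiff (Suc m) S f \<Longrightarrow> b \<in> Basis \<Longrightarrow> cdiff m S (pd b f)"
  by simp

lemma pd_const [simp]: "pd b (\<lambda>x. c) = (\<lambda>x. 0)"
  by (rule ext) (simp add: pd_def)

lemma pd_zero_open:
  assumes "open S" "x \<in> S" "\<And>y. y \<in> S \<Longrightarrow> f y = 0"
  shows "pd b f x = 0"
  using pd_cong_open[OF assms(1,2), of f "\<lambda>_. 0" b] assms(3) by simp

lemma pd_add:
  assumes "f differentiable at x" "g differentiable at x"
  shows "pd b (\<lambda>x. f x + g x) x = pd b f x + pd b g x"
proof -
  obtain f' g' where "(f has_derivative f') (at x)" "(g has_derivative g') (at x)"
    using assms differentiable_def by blast
  then show ?thesis
    using pd_has_derivative[OF has_derivative_add[of f f' "at x" g g']] pd_has_derivative[of f f' x b] pd_has_derivative[of g g' x b]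
    by simp
qed

lemma pd_mult:
  assumes "f differentiable at x" "g differentiable at x"
  shows "pd b (\<lambda>x. f x * g x) x = f x * pd b g x + pd b f x * g x"
proof -
  obtain f' g' where "(f has_derivative f') (at x)" "(g has_derivative g') (at x)"
    using assms differentiable_def by blast
  then show ?thesis
    using pd_has_derivative[OF has_derivative_mult[of f f' x UNIV g g']] pd_has_derivative[of f f' x b] pd_has_derivative[of g g' x b]
    by simp
qed

lemma pd_cmult:
  assumes "f differentiable at x"
  shows "pd b (\<lambda>x. c * f x) x = c * pd b f x"
  using pd_mult[of "\<lambda>_. c" x f] assms by simp

lemma pd_diff:
  assumes "f differentiable at x" "g differentiable at x"
  shows "pd b (\<lambda>x. f x - g x) x = pd b f x - pd b g x"
  using pd_add[of f x "\<lambda>x. (-1) * g x" b] pd_cmult[of g x b "-1"] assms by simp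

lemma pd_sum:
  assumes "\<And>i. i \<in> I \<Longrightarrow> f i differentiable at x"
  shows "pd b (\<lambda>x. \<Sum>i\<in>I. f i x) x = (\<Sum>i\<in>I. pd b (f i) x)"
  using assms
proof (induction I rule: infinite_finite_induct)
  case (insert i I)
  then show ?case using pd_add[of "f i" x "\<lambda>x. \<Sum>i\<in>I. f i x" b] by simp
qed auto

lemma cdiff_const [simp]: "cdiff m S (\<lambda>x. c)"
  by (induction m arbitrary: c) auto

lemma cdiff_add:
  assumes "open S" "cdiff m S f" "cdiff m S g" shows "cdiff m S (\<lambda>x. f x + g x)"
  using assms(2,3)
proof (induction m arbitrary: f g)
  case 0 then show ?case by (simp add: continuous_on_add)
next
  case (Suc m)
  have "cdiff m S (pd b (\<lambda>x. f x + g x))" if "b \<in> Basis" for b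
  proof -
    have "cdiff m S (\<lambda>x. pd b f x + pd b g x)" using Suc that by simp
    moreover have "cdiff m S (pd b (\<lambda>x. f x + g x)) \<longleftrightarrow> cdiff m S (\<lambda>x. pd b f x + pd b g x)"
      by (rule cdiff_cong[OF assms(1)]) (use Suc.prems in \<open>simp add: pd_add\<close>)
    ultimately show ?thesis by simp
  qed
  then show ?case using Suc.prems by auto
qed

lemma cdiff_mult:
  assumes "open S" "cdiff m S f" "cdiff m S g" shows "cdiff m S (\<lambda>x. f x * g x)"
  using assms(2,3)
proof (induction m arbitrary: f g)
  case 0 then show ?case by (simp add: continuous_on_mult)
next
  case (Suc m)
  have "cdiff m S (pd b (\<lambda>x. f x * g x))" if "b \<in> Basis" for b
  proof -
    have 1: "cdiff m S (pd b f)" "cdiff m S (pd b g)" using Suc.prems that by simp_all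
    have 2: "cdiff m S f" by (rule cdiff_Suc_imp[OF Suc.prems(1)])
    have 3: "cdiff m S g" by (rule cdiff_Suc_imp[OF Suc.prems(2)])
    have "cdiff m S (\<lambda>x. f x * pd b g x + pd b f x * g x)"
      by (rule cdiff_add[OF assms(1) Suc.IH[OF 2 1(2)] Suc.IH[OF 1(1) 3]])
    moreover have "cdiff m S (pd b (\<lambda>x. f x * g x)) \<longleftrightarrow> cdiff m S (\<lambda>x. f x * pd b g x + pd b f x * g x)"
      by (rule cdiff_cong[OF assms(1)]) (use Suc.prems in \<open>simp add: pd_mult\<close>)
    ultimately show ?thesis by simp
  qed
  then show ?case using Suc.prems by auto
qed

lemma cdiff_cmult: "open S \<Longrightarrow> cdiff m S f \<Longrightarrow> cdiff m S (\<lambda>x. c * f x)"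
  by (rule cdiff_mult) (simp_all del: cdiff.simps)

lemma cdiff_diff: "open S \<Longrightarrow> cdiff m S f \<Longrightarrow> cdiff m S g \<Longrightarrow> cdiff m S (\<lambda>x. f x - g x)"
  using cdiff_add[of S m f "\<lambda>x. (-1) * g x", OF _ _ cdiff_cmult[of S m g "-1"]]
  by (simp del: cdiff.simps)

lemma cdiff_sum:
  assumes "open S" "\<And>i. i \<in> I \<Longrightarrow> cdiff m S (f i)"
  shows "cdiff m S (\<lambda>x. \<Sum>i\<in>I. f i x)"
  using assms(2)
proof (induction I rule: infinite_finite_induct)
  case (insert i I)
  have "cdiff m S (\<lambda>x. f i x + (\<Sum>j\<in>I. f j x))"
    by (rule cdiff_add[OF assms(1)]) (use insert in auto)
  then show ?case using insert.hyps by simp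
qed auto

lemma C1_on_iff_cdiff:
  fixes f :: "'a::euclidean_space \<Rightarrow> complex"
  shows "C1_on S f \<longleftrightarrow> cdiff 1 S f"
proof
  assume "C1_on S f"
  then obtain g' where g': "\<And>x. x \<in> S \<Longrightarrow> (f has_derivative blinfun_apply (g' x)) (at x)"
    and c: "continuous_on S g'" by (auto simp: C1_on_def)
  have "continuous_on S (pd b f)" for b
  proof -
    have "continuous_on S (\<lambda>x. blinfun_apply (g' x) b)" by (intro continuous_intros c)
    then show ?thesis by (rule continuous_on_eq) (use pd_has_derivative[OF g'] in auto)
  qed
  then show "cdiff 1 S f" using g' by (auto simp: differentiable_def)
next
  assume f: "cdiff 1 S f"
  define g' where "g' x = (\<Sum>b\<in>Basis. blinfun_scaleR_left (pd b f x) o\<^sub>L blinfun_inner_right b)" for x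
  have "continuous_on S g'" unfolding g'_def
    by (intro continuous_intros bounded_linear.continuous_on[OF bounded_linear_blinfun_scaleR_left])
       (use f in auto)
  moreover have "blinfun_apply (g' x) = (\<lambda>h. \<Sum>b\<in>Basis. (h \<bullet> b) *\<^sub>R pd b f x)" for x
    by (rule ext) (simp add: g'_def blinfun.sum_left inner_commute)
  ultimately show "C1_on S f" unfolding C1_on_def
    using has_derivative_pd_sum[OF cdiff_differentiable[OF f]] by (intro exI[of _ g']) simp
qed

text \<open>
  Symmetry of second derivatives. By the fundamental theorem of calculus in direction \<open>a\<close>, the function
  \<open>pd b f\<close> is, along a segment in direction \<open>a\<close>, a constant plus the integral of
  \<open>pd b (pd a f)\<close>, since differentiation in direction \<open>b\<close> may be carried out under the integral;
  now differentiate the integral with respect to its upper limit.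
\<close>

lemma pd_commute:
  fixes f :: "'a::euclidean_space \<Rightarrow> complex"
  assumes S: "open S" "x \<in> S" and f: "cdiff 2 S f" and ab: "a \<in> Basis" "b \<in> Basis"
  shows "pd a (pd b f) x = pd b (pd a f) x"
proof -
  obtain e where e: "0 < e" "ball x e \<subseteq> S" using S by (meson open_contains_ball)
  \<comment> \<open>The square of parameters at most \<open>d\<close> is mapped into the ball, as \<open>2 d < e\<close>.\<close>
  define d where "d = e / 3"
  have d: "0 < d" using e by (simp add: d_def)
  define p where "p s t = x + s *\<^sub>R a + t *\<^sub>R b" for s t
  have p0: "p 0 0 = x" by (simp add: p_def)
  have pS: "p s t \<in> S" if "s \<in> {-d..d}" "t \<in> {-d..d}" for s t
  proof -
    have "norm (s *\<^sub>R a + t *\<^sub>R b) \<le> \<bar>s\<bar> + \<bar>t\<bar>"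
      using norm_triangle_ineq[of "s *\<^sub>R a" "t *\<^sub>R b"] ab by simp
    also have "\<dots> < e" using that e by (auto simp: d_def)
    finally have "p s t \<in> ball x e"
      by (simp add: dist_norm p_def algebra_simps norm_minus_commute flip: minus_add_distrib)
    then show ?thesis using e by blast
  qed
  have f1: "cdiff 1 S (pd c f)" if "c \<in> Basis" for c
    using f that by (simp add: numeral_2_eq_2)
  have fd1: "f differentiable at y" if "y \<in> S" for y
    using cdiff_differentiable[OF f _ that] by simp
  have fd2: "pd c f differentiable at y" if "y \<in> S" "c \<in> Basis" for y c
    using cdiff_differentiable[OF f1[OF that(2)] _ that(1)] by simp
  have cont: "continuous_on S (pd a f)" "continuous_on S (pd b (pd a f))"
    using cdiff_continuous[OF f1[OF ab(1)]] f1[OF ab(1)] ab by auto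
  have da: "((\<lambda>s. g (p s t)) has_vector_derivative pd a g (p s t)) (at s)"
    if "g differentiable at (p s t)" for g s t
    using has_vector_derivative_pd[of g "x + t *\<^sub>R b" s a] that by (simp add: p_def algebra_simps)
  have db: "((\<lambda>t. g (p s t)) has_vector_derivative pd b g (p s t)) (at t)"
    if "g differentiable at (p s t)" for g s t
    using has_vector_derivative_pd[of g "x + s *\<^sub>R a" t b] that by (simp add: p_def algebra_simps)
  have cp: "continuous_on (U \<times> V) (\<lambda>(t, s). g (p s t))"
    if "continuous_on S g" "U \<subseteq> {-d..d}" "V \<subseteq> {-d..d}" for g :: "'a \<Rightarrow> complex" and U V
    unfolding split_beta
  proof (rule continuous_on_compose2[OF that(1), of _ "\<lambda>z. p (snd z) (fst z)"])
    show "continuous_on (U \<times> V) (\<lambda>z. p (snd z) (fst z))" unfolding p_def by (intro continuous_intros)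
    show "(\<lambda>z. p (snd z) (fst z)) ` (U \<times> V) \<subseteq> S"
    proof (clarsimp)
      fix t s assume "t \<in> U" "s \<in> V"
      then show "p s t \<in> S" using pS[of s t] that(2,3) by blast
    qed
  qed
  define h where "h s = pd b (pd a f) (p s 0)" for s
  have eq: "pd b f (p s 0) - pd b f (p (-d) 0) = integral {-d..s} h" if s: "s \<in> {-d..d}" for s
  proof -
    have FTC: "integral {-d..s} (\<lambda>r. pd a f (p r t)) = f (p s t) - f (p (-d) t)"
      if t: "t \<in> {-d..d}" for t
    proof (rule integral_unique, rule fundamental_theorem_of_calculus)
      fix r assume "r \<in> {-d..s}"
      then have "f differentiable at (p r t)" using fd1[OF pS[of r t]] t s by auto
      then show "((\<lambda>r. f (p r t)) has_vector_derivative pd a f (p r t)) (at r within {-d..s})"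
        by (rule has_vector_derivative_at_within[OF da])
    qed (use s in auto)
    have "((\<lambda>t. integral (cbox (-d) s) (\<lambda>r. pd a f (p r t))) has_vector_derivative
            integral (cbox (-d) s) (\<lambda>r. pd b (pd a f) (p r 0))) (at 0 within {-d..d})"
    proof (rule leibniz_rule_vector_derivative)
      show "((\<lambda>t. pd a f (p r t)) has_vector_derivative pd b (pd a f) (p r t)) (at t within {-d..d})"
        if "t \<in> {-d..d}" "r \<in> cbox (-d) s" for t r
      proof (rule has_vector_derivative_at_within, rule db)
        have "p r t \<in> S" using pS[of r t] that s by auto
        then show "pd a f differentiable at (p r t)" by (rule fd2[OF _ ab(1)])
      qed
      show "(\<lambda>r. pd a f (p r t)) integrable_on cbox (-d) s" if "t \<in> {-d..d}" for t
        by (rule integrable_continuous, rule continuous_on_compose2[OF cont(1)])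
           (use that s pS in \<open>auto simp: p_def intro!: continuous_intros\<close>)
      show "continuous_on ({-d..d} \<times> cbox (-d) s) (\<lambda>(t, r). pd b (pd a f) (p r t))"
        by (rule cp[OF cont(2)]) (use s in auto)
    qed (use d in auto)
    then have "((\<lambda>t. integral {-d..s} (\<lambda>r. pd a f (p r t))) has_vector_derivative
            integral {-d..s} h) (at 0 within {-d..d})" by (simp add: h_def[abs_def])
    then have "((\<lambda>t. integral {-d..s} (\<lambda>r. pd a f (p r t))) has_vector_derivative
            integral {-d..s} h) (at 0)" using d by (simp add: at_within_Icc_at)
    moreover have "((\<lambda>t. f (p s t) - f (p (-d) t)) has_vector_derivative
            pd b f (p s 0) - pd b f (p (-d) 0)) (at 0)"
      by (intro has_vector_derivative_diff db fd1 pS) (use s d in auto)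
    moreover have "((\<lambda>t. f (p s t) - f (p (-d) t)) has_vector_derivative
            integral {-d..s} h) (at 0)"
      using calculation(1)
      by (rule has_vector_derivative_transform_within_open[of _ _ _ "{-d<..<d}"]) (use FTC d in auto)
    ultimately show ?thesis using vector_derivative_unique_at by blast
  qed
  have ch: "continuous_on {-d..d} h" unfolding h_def
    by (rule continuous_on_compose2[OF cont(2)])
       (use pS[of _ 0] d in \<open>auto simp: p_def intro!: continuous_intros\<close>)
  have "((\<lambda>s. integral {-d..s} h) has_vector_derivative h 0) (at 0)"
    using integral_has_vector_derivative[OF ch, of 0] d by (simp add: at_within_Icc_at)
  then have "((\<lambda>s. pd b f (p s 0) - pd b f (p (-d) 0)) has_vector_derivative h 0) (at 0)"
    by (rule has_vector_derivative_transform_within_open[of _ _ _ "{-d<..<d}"]) (use eq d in auto)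
  moreover have "((\<lambda>s. pd b f (p s 0) - pd b f (p (-d) 0)) has_vector_derivative pd a (pd b f) (p 0 0) - 0) (at 0)"
    by (intro has_vector_derivative_diff has_vector_derivative_const da fd2 ab) (use S p0 in auto)
  ultimately show ?thesis
    using vector_derivative_unique_at p0 by (fastforce simp: h_def)
qed

section \<open>Convolution\<close>

definition conv :: "('a::euclidean_space \<Rightarrow> complex) \<Rightarrow> ('a \<Rightarrow> complex) \<Rightarrow> 'a \<Rightarrow> complex" where
  "conv k f x = integral UNIV (\<lambda>y. k y * f (x - y))"

text \<open>
  Convolutions with a compactly supported factor are integrals over such a cube, to which the theorems on
  integrals over boxes apply.
\<close>

definition std_cbox :: "real \<Rightarrow> 'a::euclidean_space set" where
  "std_cbox R = cbox (- (R *\<^sub>R One)) (R *\<^sub>R One)"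

lemma in_std_cbox: "norm y \<le> R \<Longrightarrow> y \<in> std_cbox R"
  unfolding std_cbox_def mem_box using Basis_le_norm[of _ y]
  by (auto simp: abs_le_iff inner_sum_left_Basis) (smt (verit, best))+

lemma integral_UNIV_superset:
  fixes f :: "'a::euclidean_space \<Rightarrow> complex"
  assumes "\<And>y. y \<notin> C \<Longrightarrow> f y = 0"
  shows "integral UNIV f = integral C f"
proof -
  have "(\<lambda>y. if y \<in> C then f y else 0) = f" using assms by auto
  then show ?thesis using Henstock_Kurzweil_Integration.integral_restrict_UNIV[of C f] by simp
qed

lemma integral_UNIV_cbox:
  fixes f :: "'a::euclidean_space \<Rightarrow> complex"
  assumes "\<And>y. R < norm y \<Longrightarrow> f y = 0"
  shows "integral UNIV f = integral (std_cbox R) f"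
proof (rule integral_UNIV_superset)
  show "f y = 0" if "y \<notin> std_cbox R" for y using that in_std_cbox[of y R] assms[of y] by force
qed

lemma conv_eq_cbox:
  fixes k f :: "'a::euclidean_space \<Rightarrow> complex"
  assumes "\<And>y. R < norm y \<Longrightarrow> k y = 0"
  shows "conv k f x = integral (std_cbox R) (\<lambda>y. k y * f (x - y))"
  unfolding conv_def using assms by (intro integral_UNIV_cbox) auto

lemma integral_reflect_translate:
  fixes f :: "'a::euclidean_space \<Rightarrow> complex"
  assumes "continuous_on UNIV f" "\<And>y. R < norm y \<Longrightarrow> f y = 0"
  shows "integral UNIV (\<lambda>y. f (x - y)) = integral UNIV f"
proof -
  define B where "B = (\<lambda>y. (1 / - 1) *\<^sub>R y + - ((1 / - 1) *\<^sub>R x)) ` std_cbox R"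
  have "f integrable_on std_cbox R" unfolding std_cbox_def
    by (intro integrable_continuous continuous_on_subset[OF assms(1)]) auto
  then have "(f has_integral integral UNIV f) (std_cbox R)"
    using integral_UNIV_cbox[of R f, OF assms(2)] by (simp add: has_integral_integral)
  from has_integral_affinity[OF this[unfolded std_cbox_def], of "-1" x]
  have "((\<lambda>y. f (x - y)) has_integral integral UNIV f) B" unfolding B_def std_cbox_def
    by (simp add: algebra_simps)
  moreover have "f (x - y) = 0" if "y \<notin> B" for y
  proof -
    have "x - y \<notin> std_cbox R"
    proof
      assume "x - y \<in> std_cbox R"
      then have "(1 / - 1) *\<^sub>R (x - y) + - ((1 / - 1) *\<^sub>R x) \<in> B" unfolding B_def by (rule imageI)
      then show False using that by simp
    qed
    then show ?thesis using in_std_cbox[of "x - y" R] assms(2)[of "x - y"] by force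
  qed
  ultimately have "((\<lambda>y. f (x - y)) has_integral integral UNIV f) UNIV"
    using has_integral_on_superset by blast
  then show ?thesis by (rule integral_unique)
qed

lemma conv_commute:
  fixes k f :: "'a::euclidean_space \<Rightarrow> complex"
  assumes "continuous_on UNIV k" "continuous_on UNIV f" "\<And>y. R < norm y \<Longrightarrow> k y = 0"
  shows "conv f k = conv k f"
proof
  fix x
  have "continuous_on UNIV (\<lambda>y. k y * f (x - y))"
    by (intro continuous_intros assms continuous_on_compose2[OF assms(2)]) auto
  then have "integral UNIV (\<lambda>y. k (x - y) * f (x - (x - y))) = conv k f x"
    unfolding conv_def
    using integral_reflect_translate[of "\<lambda>y. k y * f (x - y)" R x] assms(3) by simp
  then show "conv f k x = conv k f x" by (simp add: conv_def mult.commute)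
qed

text \<open>
  A kernel supported in the ball of radius \<open>R\<close> only sees the values of \<open>f\<close> on
  \<open>cball x R\<close>. Hence functions that are defined on an open set only may be convolved, at points far enough
  from its complement.
\<close>

lemma conv_cong:
  fixes k f :: "'a::euclidean_space \<Rightarrow> complex"
  assumes "\<And>y. R < norm y \<Longrightarrow> k y = 0" "\<And>z. z \<in> cball x R \<Longrightarrow> f z = g z"
  shows "conv k f x = conv k g x"
  unfolding conv_def
proof (rule arg_cong[where f = "integral UNIV"], rule ext)
  fix y show "k y * f (x - y) = k y * g (x - y)"
    using assms by (cases "R < norm y") (auto simp: dist_norm)
qed

lemma conv_zero:
  fixes k f :: "'a::euclidean_space \<Rightarrow> complex"
  assumes "\<And>y. R < norm y \<Longrightarrow> k y = 0" "\<And>z. z \<in> cball x R \<Longrightarrow> f z = 0"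
  shows "conv k f x = 0"
  using conv_cong[of R k x f "\<lambda>_. 0"] assms by (simp add: conv_def)

lemma conv_integrable:
  fixes k f :: "'a::euclidean_space \<Rightarrow> complex"
  assumes "continuous_on UNIV k" "continuous_on UNIV f"
  shows "(\<lambda>y. k y * f (x - y)) integrable_on std_cbox R"
  unfolding std_cbox_def
  by (rule integrable_continuous, intro continuous_intros continuous_on_compose2[OF assms(2)]
      continuous_on_subset[OF assms(1)]) auto

lemma continuous_conv:
  fixes k f :: "'a::euclidean_space \<Rightarrow> complex"
  assumes k: "continuous_on UNIV k" "\<And>y. R < norm y \<Longrightarrow> k y = 0" and f: "continuous_on UNIV f"
  shows "continuous_on UNIV (conv k f)"
proof -
  have "continuous_on UNIV (\<lambda>x. integral (std_cbox R) (\<lambda>y. k y * f (x - y)))"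
    unfolding std_cbox_def
    by (rule integral_continuous_on_param)
       (auto simp: split_beta intro!: continuous_intros continuous_on_compose2[OF f] continuous_on_compose2[OF k(1)])
  moreover have "conv k f = (\<lambda>x. integral (std_cbox R) (\<lambda>y. k y * f (x - y)))"
    by (rule ext, rule conv_eq_cbox[OF k(2)])
  ultimately show ?thesis by simp
qed

lemma has_derivative_conv:
  fixes f :: "'a::euclidean_space \<Rightarrow> complex"
  assumes k: "continuous_on UNIV k" "\<And>y. R < norm y \<Longrightarrow> k y = 0" and f: "cdiff 1 UNIV f"
  shows "conv k f differentiable at x" "pd b (conv k f) x = conv k (pd b f) x"
proof -
  obtain g' where g': "\<And>x. (f has_derivative blinfun_apply (g' x)) (at x)"
    and c: "continuous_on UNIV g'" using f unfolding C1_on_iff_cdiff[symmetric] C1_on_def by auto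
  define F where "F x y = blinfun_mult_right (k y) o\<^sub>L g' (x - y)" for x y
  have cF: "continuous_on (UNIV \<times> std_cbox R) (\<lambda>(x, y). F x y)" unfolding F_def split_beta
    by (intro continuous_intros continuous_on_compose2[OF c] continuous_on_compose2[OF k(1)]
       bounded_linear.continuous_on[OF bounded_linear_blinfun_mult_right]) auto
  have "((\<lambda>x. integral (cbox (- (R *\<^sub>R One)) (R *\<^sub>R One)) (\<lambda>y. k y * f (x - y))) has_derivative
     blinfun_apply (integral (cbox (- (R *\<^sub>R One)) (R *\<^sub>R One)) (F x))) (at x)"
  proof (rule leibniz_rule)
    fix z y :: 'a
    have "((\<lambda>x. x - y) has_derivative (\<lambda>h. h)) (at z)" by (auto intro!: derivative_eq_intros)
    from has_derivative_compose[OF this g']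
    have "((\<lambda>x. f (x - y)) has_derivative blinfun_apply (g' (z - y))) (at z)" .
    then show "((\<lambda>x. k y * f (x - y)) has_derivative blinfun_apply (F z y)) (at z)"
      by (auto simp: F_def intro!: derivative_eq_intros)
  next
    show "(\<lambda>y. k y * f (z - y)) integrable_on cbox (- (R *\<^sub>R One)) (R *\<^sub>R One)" for z
      using conv_integrable[OF k(1) cdiff_continuous[OF f]] by (simp add: std_cbox_def)
  qed (use cF in \<open>auto simp: std_cbox_def\<close>)
  moreover have eqc: "conv k f = (\<lambda>x. integral (std_cbox R) (\<lambda>y. k y * f (x - y)))"
    by (rule ext, rule conv_eq_cbox[of R k, OF k(2)])
  ultimately have D: "(conv k f has_derivative blinfun_apply (integral (std_cbox R) (F x))) (at x)"
    by (simp add: std_cbox_def)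
  then show "conv k f differentiable at x" by (auto simp: differentiable_def)
  have "F x integrable_on std_cbox R" unfolding std_cbox_def
    by (rule integrable_continuous, rule continuous_on_compose2[OF cF, of _ "\<lambda>y. (x, y)", simplified])
       (auto simp: std_cbox_def intro!: continuous_intros)
  then have "pd b (conv k f) x = integral (std_cbox R) (\<lambda>y. F x y b)"
    using pd_has_derivative[OF D] by (simp add: blinfun_apply_integral)
  also have "\<dots> = conv k (pd b f) x"
    using conv_eq_cbox[of R k, OF k(2)] pd_has_derivative[OF g'] by (simp add: F_def)
  finally show "pd b (conv k f) x = conv k (pd b f) x" .
qed

lemma cdiff_conv:
  fixes k f :: "'a::euclidean_space \<Rightarrow> complex"
  assumes k: "continuous_on UNIV k" "\<And>y. R < norm y \<Longrightarrow> k y = 0" and f: "cdiff m UNIV f"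
  shows "cdiff m UNIV (conv k f)"
  using f
proof (induction m arbitrary: f)
  case 0 then show ?case using continuous_conv[OF k] by simp
next
  case (Suc m)
  have "cdiff 1 UNIV f" using Suc.prems cdiff_le by (metis One_nat_def Suc_le_mono zero_le)
  note D = has_derivative_conv[OF k this]
  have "pd b (conv k f) = conv k (pd b f)" for b using D(2) by auto
  then show ?case using D(1) Suc by simp
qed

lemma pd_vanish:
  fixes f :: "'a::real_normed_vector \<Rightarrow> complex"
  assumes "\<And>y. R < norm y \<Longrightarrow> f y = 0" "R < norm y"
  shows "pd b f y = 0"
proof (rule pd_zero_open[of "- cball 0 R"])
qed (use assms in auto)

lemma conv_cutoff_left:
  fixes k :: "'a::euclidean_space \<Rightarrow> complex"
  assumes "continuous_on UNIV k"
  obtains k' where "continuous_on UNIV k'" "\<And>y. R + 1 < norm y \<Longrightarrow> k' y = 0" "\<And>y. norm y \<le> R \<Longrightarrow> k' y = k y"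
proof
  define t where "t y = complex_of_real (max 0 (min 1 (R + 1 - norm y)))" for y :: 'a
  show "continuous_on UNIV (\<lambda>y. t y * k y)" unfolding t_def by (intro continuous_intros assms)
qed (auto simp: min_def max_def)

lemma conv_compact_right:
  fixes k f :: "'a::euclidean_space \<Rightarrow> complex"
  assumes k: "continuous_on UNIV k" and f: "\<And>y. R < norm y \<Longrightarrow> f y = 0"
  obtains k' R' where "continuous_on UNIV k'" "\<And>y. R' < norm y \<Longrightarrow> k' y = 0"
    "\<And>x g. x \<in> ball x0 1 \<Longrightarrow> (\<And>y. R < norm y \<Longrightarrow> g y = 0) \<Longrightarrow> conv k g x = conv k' g x"
proof -
  define r where "r = norm x0 + 1 + R"
  obtain k' where k': "continuous_on UNIV k'" "\<And>y. r + 1 < norm y \<Longrightarrow> k' y = 0" "\<And>y. norm y \<le> r \<Longrightarrow> k' y = k y"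
    using conv_cutoff_left[OF k, of r] by blast
  show thesis
  proof (rule that[OF k'(1,2)])
    fix x :: 'a and g :: "'a \<Rightarrow> complex" assume x: "x \<in> ball x0 1" and g: "\<And>y. R < norm y \<Longrightarrow> g y = 0"
    show "conv k g x = conv k' g x" unfolding conv_def
    proof (rule arg_cong[where f = "integral UNIV"], rule ext)
      fix y
      have "norm x \<le> norm x0 + 1" using x norm_triangle_sub[of x x0] by (auto simp: dist_norm norm_minus_commute)
      moreover have "norm y \<le> norm x + norm (x - y)" using norm_triangle_sub[of y x] by (simp add: norm_minus_commute)
      ultimately show "k y * g (x - y) = k' y * g (x - y)"
        using k'(3)[of y] g[of "x - y"] by (cases "R < norm (x - y)") (auto simp: r_def)
    qed
  qed
qed

text \<open>
  The compact support may be that of the differentiated factor. Near a given point only a bounded part of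
  the kernel matters, so that the kernel can be cut off and the previous case applies.
\<close>

lemma cdiff_conv_compact_right:
  fixes k f :: "'a::euclidean_space \<Rightarrow> complex"
  assumes k: "continuous_on UNIV k" and f: "\<And>y. R < norm y \<Longrightarrow> f y = 0" "cdiff m UNIV f"
  shows "cdiff m UNIV (conv k f)" "0 < m \<Longrightarrow> pd b (conv k f) = conv k (pd b f)"
proof -
  have *: "cdiff m (ball x0 1) (conv k f) \<and> (0 < m \<longrightarrow> pd b (conv k f) x0 = conv k (pd b f) x0)" for x0
  proof -
    obtain k' R' where k': "continuous_on UNIV k'" "\<And>y. R' < norm y \<Longrightarrow> k' y = 0"
      and eq: "\<And>x g. x \<in> ball x0 1 \<Longrightarrow> (\<And>y. R < norm y \<Longrightarrow> g y = 0) \<Longrightarrow> conv k g x = conv k' g x"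
      using conv_compact_right[of k R f x0, OF k f(1)] by blast
    have "cdiff m (ball x0 1) (conv k' f)" using cdiff_subset[OF cdiff_conv[OF k' f(2)]] by auto
    then have 1: "cdiff m (ball x0 1) (conv k f)" using cdiff_cong[of "ball x0 1" "conv k f" "conv k' f" m] eq f(1) by auto
    have "pd b (conv k f) x0 = conv k (pd b f) x0" if "0 < m"
    proof -
      have "pd b (conv k f) x0 = pd b (conv k' f) x0"
        by (rule pd_cong_open[of "ball x0 1"]) (use eq f(1) in auto)
      also have "\<dots> = conv k' (pd b f) x0"
        using has_derivative_conv(2)[OF k' cdiff_le[OF f(2)]] that by simp
      also have "\<dots> = conv k (pd b f) x0"
        by (rule eq[symmetric]) (use pd_vanish[OF f(1)] in auto)
      finally show ?thesis .
    qed
    then show ?thesis using 1 by blast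
  qed
  show "cdiff m UNIV (conv k f)" by (rule cdiff_local) (use * in \<open>meson centre_in_ball open_ball zero_less_one\<close>)
  show "0 < m \<Longrightarrow> pd b (conv k f) = conv k (pd b f)" using * by auto
qed

text \<open>
  Integration by parts: by commutativity the derivative of a convolution may fall on either factor.
\<close>

lemma conv_pd_swap:
  fixes k f :: "'a::euclidean_space \<Rightarrow> complex"
  assumes k: "cdiff 1 UNIV k" "\<And>y. R < norm y \<Longrightarrow> k y = 0" and f: "cdiff 1 UNIV f" and b: "b \<in> Basis"
  shows "conv (pd b k) f = conv k (pd b f)"
proof -
  note ck = cdiff_continuous[OF k(1)] and cf = cdiff_continuous[OF f]
  have cb: "continuous_on UNIV (pd b k)" using k(1) b by simp
  have "conv k (pd b f) = pd b (conv k f)" using has_derivative_conv(2)[OF ck k(2) f] by auto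
  also have "\<dots> = pd b (conv f k)" using conv_commute[OF ck cf k(2)] by simp
  also have "\<dots> = conv f (pd b k)" by (rule cdiff_conv_compact_right[OF cf k(2,1)]) auto
  also have "\<dots> = conv (pd b k) f" by (rule conv_commute[OF cb cf pd_vanish[of R k, OF k(2)]])
  finally show ?thesis by simp
qed

text \<open>
  Convolution with a compactly supported \<open>C\<^sup>1\<close> kernel gains one derivative: the first one is put on
  the kernel, all others on \<open>f\<close>. Iterating this gives any finite order of smoothness from a kernel that is
  merely \<open>C\<^sup>1\<close>.
\<close>

lemma cdiff_conv_gain:
  fixes k f :: "'a::euclidean_space \<Rightarrow> complex"
  assumes k: "cdiff 1 UNIV k" "\<And>y. R < norm y \<Longrightarrow> k y = 0" and f: "cdiff m UNIV f"
  shows "cdiff (Suc m) UNIV (conv k f)"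
proof -
  note ck = cdiff_continuous[OF k(1)] and cf = cdiff_continuous[OF f]
  have eq: "conv k f = conv f k" using conv_commute[OF ck cf k(2)] by simp
  note D = cdiff_conv_compact_right[OF cf k(2,1)]
  have "cdiff m UNIV (pd b (conv k f))" if b: "b \<in> Basis" for b
  proof -
    have cb: "continuous_on UNIV (pd b k)" using k(1) b by simp
    have "pd b (conv k f) = conv f (pd b k)" using D(2) eq by simp
    also have "\<dots> = conv (pd b k) f" by (rule conv_commute[OF cb cf pd_vanish[of R k, OF k(2)]])
    finally show ?thesis using cdiff_conv[OF cb pd_vanish[OF k(2)] f] by simp
  qed
  then show ?thesis using D(1) eq by simp
qed

lemma conv_add_right:
  fixes k f :: "'a::euclidean_space \<Rightarrow> complex"
  assumes "continuous_on UNIV k" "\<And>y. R < norm y \<Longrightarrow> k y = 0" "continuous_on UNIV f" "continuous_on UNIV g"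
  shows "conv k (\<lambda>x. f x + g x) x = conv k f x + conv k g x"
proof -
  have "conv k (\<lambda>x. f x + g x) x
      = integral (std_cbox R) (\<lambda>y. k y * f (x - y) + k y * g (x - y))"
    using conv_eq_cbox[of R k "\<lambda>x. f x + g x" x] assms(2) by (simp add: algebra_simps)
  also have "\<dots> = conv k f x + conv k g x"
    using conv_eq_cbox[of R k f x] conv_eq_cbox[of R k g x] assms(2)
      Henstock_Kurzweil_Integration.integral_add[OF conv_integrable[OF assms(1,3)] conv_integrable[OF assms(1,4)]]
    by simp
  finally show ?thesis .
qed

lemma conv_cmult_right: "conv k (\<lambda>x. c * f x) x = c * conv k f x"
proof -
  have "(\<lambda>y. k y * (c * f (x - y))) = (\<lambda>y. c * (k y * f (x - y)))" by (auto simp: algebra_simps)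
  then show ?thesis unfolding conv_def by simp
qed

lemma conv_sum_right:
  fixes k :: "'a::euclidean_space \<Rightarrow> complex"
  assumes "continuous_on UNIV k" "\<And>y. R < norm y \<Longrightarrow> k y = 0" "\<And>i. i \<in> I \<Longrightarrow> continuous_on UNIV (f i)"
  shows "conv k (\<lambda>x. \<Sum>i\<in>I. f i x) x = (\<Sum>i\<in>I. conv k (f i) x)"
  using assms(3)
proof (induction I rule: infinite_finite_induct)
  case (insert i I)
  then show ?case using conv_add_right[of k R "f i" "\<lambda>x. \<Sum>i\<in>I. f i x" x, OF assms(1,2)]
    by (simp add: continuous_on_sum)
qed (auto simp: conv_def)

lemma conv_add_left:
  fixes k l f :: "'a::euclidean_space \<Rightarrow> complex"
  assumes "continuous_on UNIV k" "\<And>y. R < norm y \<Longrightarrow> k y = 0"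
    "continuous_on UNIV l" "\<And>y. R < norm y \<Longrightarrow> l y = 0" "continuous_on UNIV f"
  shows "conv (\<lambda>y. k y + l y) f x = conv k f x + conv l f x"
proof -
  have "conv (\<lambda>y. k y + l y) f x = integral (std_cbox R) (\<lambda>y. k y * f (x - y) + l y * f (x - y))"
    using conv_eq_cbox[of R "\<lambda>y. k y + l y" f x] assms by (simp add: algebra_simps)
  also have "\<dots> = conv k f x + conv l f x"
    using conv_eq_cbox[of R k f x] conv_eq_cbox[of R l f x] assms
      Henstock_Kurzweil_Integration.integral_add[OF conv_integrable[OF assms(1,5)] conv_integrable[OF assms(3,5)]]
    by simp
  finally show ?thesis .
qed

lemma conv_cmult_left: "conv (\<lambda>x. c * k x) f x = c * conv k f x"
proof -
  have "(\<lambda>y. c * k y * f (x - y)) = (\<lambda>y. c * (k y * f (x - y)))" by (auto simp: algebra_simps)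
  then show ?thesis unfolding conv_def by simp
qed

lemma conv_sum_left:
  fixes k :: "'i \<Rightarrow> 'a::euclidean_space \<Rightarrow> complex"
  assumes "\<And>i. i \<in> I \<Longrightarrow> continuous_on UNIV (k i)" "\<And>i y. i \<in> I \<Longrightarrow> R < norm y \<Longrightarrow> k i y = 0"
    "continuous_on UNIV f"
  shows "conv (\<lambda>y. \<Sum>i\<in>I. k i y) f x = (\<Sum>i\<in>I. conv (k i) f x)"
  using assms(1,2)
proof (induction I rule: infinite_finite_induct)
  case (insert i I)
  have "conv (\<lambda>y. k i y + (\<Sum>i\<in>I. k i y)) f x = conv (k i) f x + conv (\<lambda>y. \<Sum>i\<in>I. k i y) f x"
    by (rule conv_add_left[of _ R]) (use insert.prems assms(3) in \<open>auto intro!: continuous_on_sum sum.neutral\<close>)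
  then show ?case using insert by simp
qed (auto simp: conv_def)

lemma conv_sum_right_compact:
  fixes k :: "'a::euclidean_space \<Rightarrow> complex"
  assumes k: "continuous_on UNIV k" and f: "\<And>i. i \<in> I \<Longrightarrow> continuous_on UNIV (f i)"
    and v: "\<And>i y. i \<in> I \<Longrightarrow> R < norm y \<Longrightarrow> f i y = 0"
  shows "conv k (\<lambda>x. \<Sum>i\<in>I. f i x) x = (\<Sum>i\<in>I. conv k (f i) x)"
proof -
  have "conv k (\<lambda>x. \<Sum>i\<in>I. f i x) = conv (\<lambda>x. \<Sum>i\<in>I. f i x) k"
    by (rule conv_commute[of _ _ R]) (use k f v in \<open>auto intro!: continuous_on_sum sum.neutral\<close>)
  then have "conv k (\<lambda>x. \<Sum>i\<in>I. f i x) x = (\<Sum>i\<in>I. conv (f i) k x)"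
    using conv_sum_left[of I f R k x] f v k by simp
  also have "\<dots> = (\<Sum>i\<in>I. conv k (f i) x)"
  proof (rule sum.cong[OF refl])
    fix i assume i: "i \<in> I"
    have "conv k (f i) = conv (f i) k" by (rule conv_commute[OF f[OF i] k v[OF i]])
    then show "conv (f i) k x = conv k (f i) x" by simp
  qed
  finally show ?thesis .
qed

section \<open>The Laplacian and Green's identity\<close>

definition Lap :: "('a::euclidean_space \<Rightarrow> complex) \<Rightarrow> 'a \<Rightarrow> complex" where
  "Lap f x = (\<Sum>b\<in>Basis. pd b (pd b f) x)"

lemma Lap_cong_open:
  assumes "open S" "x \<in> S" "\<And>y. y \<in> S \<Longrightarrow> f y = g y"
  shows "Lap f x = Lap g x"
  unfolding Lap_def by (intro sum.cong refl pd_cong_open[OF assms(1,2)] pd_cong_open[OF assms(1)] assms(3))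

lemma cdiff_Lap: "open S \<Longrightarrow> cdiff (m + 2) S f \<Longrightarrow> cdiff m S (Lap f)"
  unfolding Lap_def[abs_def] by (intro cdiff_sum) (auto simp: numeral_2_eq_2)

lemma continuous_Lap: "open S \<Longrightarrow> cdiff 2 S f \<Longrightarrow> continuous_on S (Lap f)"
  using cdiff_Lap[of S 0 f] by (simp add: numeral_2_eq_2)

lemma Lap_vanish:
  fixes f :: "'a::euclidean_space \<Rightarrow> complex"
  assumes "\<And>y. R < norm y \<Longrightarrow> f y = 0" "R < norm y"
  shows "Lap f y = 0"
  unfolding Lap_def by (intro sum.neutral ballI pd_vanish[of R]) (use assms pd_vanish[of R f] in auto)

lemma Lap_const [simp]: "Lap (\<lambda>_. c) x = 0"
  by (simp add: Lap_def)

lemma Lap_diff: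
  fixes f g :: "'a::euclidean_space \<Rightarrow> complex"
  assumes "open S" "cdiff 2 S f" "cdiff 2 S g" "x \<in> S"
  shows "Lap (\<lambda>x. f x - g x) x = Lap f x - Lap g x"
proof -
  have "pd b (pd b (\<lambda>x. f x - g x)) x = pd b (pd b f) x - pd b (pd b g) x" if b: "b \<in> Basis" for b
  proof -
    have 1: "f differentiable at y" "g differentiable at y" "pd b f differentiable at y" "pd b g differentiable at y"
      if "y \<in> S" for y using assms(2,3) that b by (auto simp: numeral_2_eq_2)
    have "pd b (pd b (\<lambda>x. f x - g x)) x = pd b (\<lambda>x. pd b f x - pd b g x) x"
      by (rule pd_cong_open[OF assms(1,4)]) (rule pd_diff[OF 1(1,2)])
    also have "\<dots> = pd b (pd b f) x - pd b (pd b g) x" by (rule pd_diff[OF 1(3,4)[OF assms(4)]])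
    finally show ?thesis .
  qed
  then show ?thesis by (simp add: Lap_def sum_subtractf)
qed

lemma Lap_sum:
  fixes f :: "'i \<Rightarrow> 'a::euclidean_space \<Rightarrow> complex"
  assumes S: "open S" "x \<in> S" and f: "\<And>i. i \<in> I \<Longrightarrow> cdiff 2 S (f i)"
  shows "Lap (\<lambda>x. \<Sum>i\<in>I. c i * f i x) x = (\<Sum>i\<in>I. c i * Lap (f i) x)"
proof -
  have "pd b (pd b (\<lambda>x. \<Sum>i\<in>I. c i * f i x)) x = (\<Sum>i\<in>I. c i * pd b (pd b (f i)) x)" if b: "b \<in> Basis" for b
  proof -
    have d: "f i differentiable at y" "pd b (f i) differentiable at y" if "i \<in> I" "y \<in> S" for i y
      using f[OF that(1)] that(2) b by (auto simp: numeral_2_eq_2)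
    have "pd b (pd b (\<lambda>x. \<Sum>i\<in>I. c i * f i x)) x = pd b (\<lambda>x. \<Sum>i\<in>I. c i * pd b (f i) x) x"
    proof (rule pd_cong_open[OF S])
      fix y assume y: "y \<in> S"
      have "pd b (\<lambda>x. \<Sum>i\<in>I. c i * f i x) y = (\<Sum>i\<in>I. pd b (\<lambda>x. c i * f i x) y)"
        by (rule pd_sum) (use d y in auto)
      then show "pd b (\<lambda>x. \<Sum>i\<in>I. c i * f i x) y = (\<Sum>i\<in>I. c i * pd b (f i) y)"
        using d y by (simp add: pd_cmult)
    qed
    also have "\<dots> = (\<Sum>i\<in>I. pd b (\<lambda>x. c i * pd b (f i) x) x)"
      by (rule pd_sum) (use d S in auto)
    finally show ?thesis using d S by (simp add: pd_cmult)
  qed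
  then have "Lap (\<lambda>x. \<Sum>i\<in>I. c i * f i x) x = (\<Sum>b\<in>Basis. \<Sum>i\<in>I. c i * pd b (pd b (f i)) x)"
    by (simp add: Lap_def)
  also have "\<dots> = (\<Sum>i\<in>I. c i * Lap (f i) x)"
    by (subst sum.swap) (simp add: Lap_def sum_distrib_left)
  finally show ?thesis .
qed

lemma pd_Lap_commute:
  fixes f :: "'a::euclidean_space \<Rightarrow> complex"
  assumes S: "open S" "x \<in> S" and f: "cdiff 3 S f" and a: "a \<in> Basis"
  shows "pd a (Lap f) x = Lap (pd a f) x"
proof -
  have f2: "cdiff 2 S f" by (rule cdiff_le[OF f]) simp
  have fb: "cdiff 2 S (pd b f)" if "b \<in> Basis" for b
    using f that by (simp add: numeral_3_eq_3 numeral_2_eq_2)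
  have "pd a (Lap f) x = (\<Sum>b\<in>Basis. pd a (pd b (pd b f)) x)"
    unfolding Lap_def[abs_def]
    by (rule pd_sum) (use fb S(2) in \<open>simp add: numeral_2_eq_2\<close>)
  also have "\<dots> = (\<Sum>b\<in>Basis. pd b (pd b (pd a f)) x)"
  proof (rule sum.cong[OF refl])
    fix b :: 'a assume b: "b \<in> Basis"
    have "pd a (pd b (pd b f)) x = pd b (pd a (pd b f)) x" by (rule pd_commute[OF S fb[OF b] a b])
    also have "\<dots> = pd b (pd b (pd a f)) x"
      by (rule pd_cong_open[OF S]) (rule pd_commute[OF S(1) _ f2 a b])
    finally show "pd a (pd b (pd b f)) x = pd b (pd b (pd a f)) x" .
  qed
  finally show ?thesis by (simp add: Lap_def)
qed

text \<open>
  Integration by parts twice; the order of the factors is exchanged so that the compactly supported one is always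
  the kernel.
\<close>

lemma green_identity:
  fixes f N :: "'a::euclidean_space \<Rightarrow> complex"
  assumes f: "cdiff 2 UNIV f" "\<And>y. R < norm y \<Longrightarrow> f y = 0" and N: "cdiff 2 UNIV N"
  shows "conv N (Lap f) = conv (Lap N) f"
proof
  fix x
  have f1: "cdiff 1 UNIV f" by (rule cdiff_le[OF f(1)]) simp
  have N1: "cdiff 1 UNIV N" by (rule cdiff_le[OF N]) simp
  have fb: "cdiff 1 UNIV (pd b f)" "cdiff 1 UNIV (pd b N)" if "b \<in> Basis" for b
    using f(1) N that by (auto simp: numeral_2_eq_2)
  have fbb: "continuous_on UNIV (pd b (pd b f))" "continuous_on UNIV (pd b (pd b N))" if "b \<in> Basis" for b
    using fb[OF that] that by auto
  have L: "continuous_on UNIV (Lap f)" "continuous_on UNIV (Lap N)"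
    using continuous_Lap f(1) N by auto
  note v1 = pd_vanish[of R f, OF f(2)]
  note v2 = pd_vanish[of R "pd b f" for b, OF v1]
  have "conv N (Lap f) x = conv (Lap f) N x"
    using conv_commute[OF L(1) cdiff_continuous[OF N1] Lap_vanish[of R f, OF f(2)]] by simp
  also have "\<dots> = (\<Sum>b\<in>Basis. conv (pd b (pd b f)) N x)"
    unfolding Lap_def[abs_def]
    by (rule conv_sum_left[of _ _ R]) (use fbb v2 cdiff_continuous[OF N1] in auto)
  also have "\<dots> = (\<Sum>b\<in>Basis. conv f (pd b (pd b N)) x)"
  proof (rule sum.cong[OF refl])
    fix b :: 'a assume b: "b \<in> Basis"
    have "conv (pd b (pd b f)) N = conv (pd b f) (pd b N)"
      by (rule conv_pd_swap[OF fb(1)[OF b] v1 N1 b])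
    also have "\<dots> = conv f (pd b (pd b N))"
      by (rule conv_pd_swap[OF f1 f(2) fb(2)[OF b] b])
    finally show "conv (pd b (pd b f)) N x = conv f (pd b (pd b N)) x" by simp
  qed
  also have "\<dots> = conv f (Lap N) x"
    unfolding Lap_def[abs_def]
    by (rule conv_sum_right[symmetric, of f R]) (use fbb cdiff_continuous[OF f1] f(2) in auto)
  also have "\<dots> = conv (Lap N) f x"
    using conv_commute[OF cdiff_continuous[OF f1] L(2) f(2)] by simp
  finally show "conv N (Lap f) x = conv (Lap N) f x" .
qed

section \<open>Mollifiers, cut-off functions and the mean value property\<close>

lemma DERIV_piecewise:
  fixes f g f' g' :: "real \<Rightarrow> real"
  assumes f: "\<And>s. s \<le> c \<Longrightarrow> (f has_real_derivative f' s) (at s)"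
    and g: "\<And>s. c \<le> s \<Longrightarrow> (g has_real_derivative g' s) (at s)"
    and eq: "f c = g c" "f' c = g' c"
  shows "((\<lambda>s. if c \<le> s then g s else f s) has_real_derivative (if c \<le> s then g' s else f' s)) (at s)"
proof -
  consider "s < c" | "c < s" | "s = c" by linarith
  then show ?thesis
  proof cases
    case 1
    have "(f has_real_derivative f' s) (at s)" using f 1 by simp
    then have "((\<lambda>s. if c \<le> s then g s else f s) has_real_derivative f' s) (at s)"
      by (rule has_field_derivative_transform_within_open[of _ _ _ "{..<c}"]) (use 1 in auto)
    then show ?thesis using 1 by simp
  next
    case 2
    have "(g has_real_derivative g' s) (at s)" using g 2 by simp
    then have "((\<lambda>s. if c \<le> s then g s else f s) has_real_derivative g' s) (at s)"
      by (rule has_field_derivative_transform_within_open[of _ _ _ "{c<..}"]) (use 2 in auto)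
    then show ?thesis using 2 by simp
  next
    case 3
    let ?h = "\<lambda>s. if c \<le> s then g s else f s"
    have "((\<lambda>y. (?h y - ?h c) / (y - c)) \<longlongrightarrow> g' c) (at c)"
    proof (rule filterlim_split_at_real)
      have "((\<lambda>y. (f y - f c) / (y - c)) \<longlongrightarrow> g' c) (at_left c)"
        using f[of c] eq unfolding has_field_derivative_iff by (auto intro: filterlim_mono at_le)
      then show "((\<lambda>y. (?h y - ?h c) / (y - c)) \<longlongrightarrow> g' c) (at_left c)"
        by (rule Lim_transform_eventually) (auto simp: eventually_at_filter eq)
      have "((\<lambda>y. (g y - g c) / (y - c)) \<longlongrightarrow> g' c) (at_right c)"
        using g[of c] unfolding has_field_derivative_iff by (auto intro: filterlim_mono at_le)
      then show "((\<lambda>y. (?h y - ?h c) / (y - c)) \<longlongrightarrow> g' c) (at_right c)"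
        by (rule Lim_transform_eventually) (auto simp: eventually_at_filter)
    qed
    then show ?thesis using 3 by (simp add: has_field_derivative_iff)
  qed
qed

lemma pd_radial:
  fixes h h1 :: "real \<Rightarrow> real" and y :: "'a::euclidean_space"
  assumes "(h has_real_derivative h1 (y \<bullet> y)) (at (y \<bullet> y))"
  shows "(\<lambda>y. complex_of_real (h (y \<bullet> y))) differentiable at y"
    "pd b (\<lambda>y. complex_of_real (h (y \<bullet> y))) y = complex_of_real (2 * (y \<bullet> b) * h1 (y \<bullet> y))"
proof -
  have 1: "((\<lambda>y::'a. y \<bullet> y) has_derivative (\<lambda>v. 2 * (y \<bullet> v))) (at y)"
    by (auto intro!: derivative_eq_intros simp: inner_commute)
  have "((\<lambda>y. h (y \<bullet> y)) has_derivative (\<lambda>v. h1 (y \<bullet> y) * (2 * (y \<bullet> v)))) (at y)"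
    using has_derivative_compose[OF 1, of h "\<lambda>t. h1 (y \<bullet> y) * t"] assms
    by (simp add: has_field_derivative_def)
  then have D: "((\<lambda>y. complex_of_real (h (y \<bullet> y))) has_derivative
      (\<lambda>v. complex_of_real (h1 (y \<bullet> y) * (2 * (y \<bullet> v))))) (at y)"
    by (rule has_derivative_of_real)
  then show "(\<lambda>y. complex_of_real (h (y \<bullet> y))) differentiable at y" by (auto simp: differentiable_def)
  show "pd b (\<lambda>y. complex_of_real (h (y \<bullet> y))) y = complex_of_real (2 * (y \<bullet> b) * h1 (y \<bullet> y))"
    using pd_has_derivative[OF D, of b] by (simp add: algebra_simps)
qed

text \<open>
  The bump \<open>(1 - |y|\<^sup>2/e\<^sup>2)\<^sub>+\<^sup>2\<close> is chosen because it is, up to a constant, the Laplacian of the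
  regularized Newton kernel below.
\<close>

definition bump_profile :: "real \<Rightarrow> real \<Rightarrow> real" where
  "bump_profile e s = (if e\<^sup>2 \<le> s then 0 else (1 - s / e\<^sup>2)\<^sup>2)"

definition bump :: "real \<Rightarrow> 'a::euclidean_space \<Rightarrow> complex" where
  "bump e y = complex_of_real (bump_profile e (y \<bullet> y))"

definition mollifier :: "real \<Rightarrow> 'a::euclidean_space \<Rightarrow> complex" where
  "mollifier e y = bump e y / integral UNIV (bump e :: 'a \<Rightarrow> complex)"

lemma bump_profile_deriv:
  assumes "0 < e"
  shows "(bump_profile e has_real_derivative - 2 * max 0 (1 - s / e\<^sup>2) / e\<^sup>2) (at s)"
proof -
  have "((\<lambda>s. if e\<^sup>2 \<le> s then 0 else (1 - s / e\<^sup>2)\<^sup>2) has_real_derivative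
      (if e\<^sup>2 \<le> s then 0 else - 2 * (1 - s / e\<^sup>2) / e\<^sup>2)) (at s)"
    by (rule DERIV_piecewise) (use assms in \<open>auto intro!: derivative_eq_intros simp: power2_eq_square field_simps\<close>)
  moreover have "(if e\<^sup>2 \<le> s then 0 else - 2 * (1 - s / e\<^sup>2) / e\<^sup>2) = - 2 * max 0 (1 - s / e\<^sup>2) / e\<^sup>2"
    using assms by (auto simp: max_def field_simps)
  moreover have "(\<lambda>s. if e\<^sup>2 \<le> s then 0 else (1 - s / e\<^sup>2)\<^sup>2) = bump_profile e"
    by (auto simp: bump_profile_def)
  ultimately show ?thesis by simp
qed

lemma cdiff_bump:
  assumes "0 < e" shows "cdiff 1 UNIV (bump e :: 'a::euclidean_space \<Rightarrow> complex)"
proof -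
  note R = pd_radial[of "bump_profile e" "\<lambda>s. - 2 * max 0 (1 - s / e\<^sup>2) / e\<^sup>2", OF bump_profile_deriv[OF assms]]
  have eq: "bump e = (\<lambda>y::'a. complex_of_real (bump_profile e (y \<bullet> y)))" by (auto simp: bump_def)
  have "pd b (bump e) = (\<lambda>y::'a. complex_of_real (2 * (y \<bullet> b) * (- 2 * max 0 (1 - y \<bullet> y / e\<^sup>2) / e\<^sup>2)))" for b
    unfolding eq using R(2) by blast
  then have "continuous_on UNIV (pd b (bump e) :: 'a \<Rightarrow> complex)" for b
    using assms by (auto intro!: continuous_intros)
  moreover have "bump e differentiable at y" for y :: 'a unfolding eq by (rule R(1))
  ultimately show ?thesis by simp
qed

lemma bump_vanish: "0 < e \<Longrightarrow> e < norm y \<Longrightarrow> bump e y = 0"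
  by (auto simp: bump_def bump_profile_def dot_square_norm intro: power_mono)

lemma integral_bump_pos:
  assumes "0 < e"
  obtains I where "integral UNIV (bump e :: 'a::euclidean_space \<Rightarrow> complex) = complex_of_real I" "0 < I"
    "((\<lambda>y::'a. bump_profile e (y \<bullet> y)) has_integral I) (std_cbox e)"
proof -
  have c: "continuous_on UNIV (\<lambda>y::'a. bump_profile e (y \<bullet> y))"
  proof (rule continuous_on_compose2[of UNIV "bump_profile e"])
    show "continuous_on UNIV (bump_profile e)"
      using DERIV_isCont[OF bump_profile_deriv[OF assms]] by (simp add: continuous_at_imp_continuous_on)
  qed (auto intro!: continuous_intros)
  have nn: "0 \<le> bump_profile e s" for s by (auto simp: bump_profile_def)
  define I where "I = integral (std_cbox e) (\<lambda>y::'a. bump_profile e (y \<bullet> y))"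
  have i: "((\<lambda>y::'a. bump_profile e (y \<bullet> y)) has_integral I) (std_cbox e)" unfolding I_def std_cbox_def
    by (intro integrable_integral integrable_continuous continuous_on_subset[OF c]) auto
  have "bump_profile e ((0::'a) \<bullet> 0) \<noteq> 0" using assms by (auto simp: bump_profile_def)
  moreover have "(0::'a) \<in> std_cbox e" using in_std_cbox[of 0 e] assms by simp
  moreover have "interior (cbox (- (e *\<^sub>R One)) (e *\<^sub>R One) :: 'a set) \<noteq> {}"
    using assms by (auto simp: box_ne_empty inner_sum_left_Basis)
  ultimately have "I \<noteq> 0"
    using integral_cbox_eq_0_iff[of "- (e *\<^sub>R One)" "e *\<^sub>R One :: 'a" "\<lambda>y. bump_profile e (y \<bullet> y)"] continuous_on_subset[OF c] nn
    unfolding I_def std_cbox_def by (auto simp: box_ne_empty inner_sum_left_Basis assms)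
  moreover have "0 \<le> I" using i has_integral_nonneg nn by blast
  moreover have "integral UNIV (bump e :: 'a \<Rightarrow> complex) = complex_of_real I"
  proof -
    have "(bump e has_integral complex_of_real I) (std_cbox e :: 'a set)"
      using has_integral_of_real[OF i] by (simp add: bump_def[abs_def])
    then show ?thesis
      using integral_UNIV_cbox[of e "bump e :: 'a \<Rightarrow> complex"] bump_vanish[OF assms] integral_unique by metis
  qed
  ultimately show ?thesis using that i by force
qed

lemma cdiff_mollifier: "0 < e \<Longrightarrow> cdiff 1 UNIV (mollifier e :: 'a::euclidean_space \<Rightarrow> complex)"
  using cdiff_cmult[OF open_UNIV cdiff_bump[of e], of "1 / integral UNIV (bump e :: 'a \<Rightarrow> complex)"]
  by (simp add: mollifier_def[abs_def])

lemma continuous_mollifier: "0 < e \<Longrightarrow> continuous_on UNIV (mollifier e :: 'a::euclidean_space \<Rightarrow> complex)"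
  using cdiff_mollifier cdiff_continuous by blast

lemma mollifier_vanish: "0 < e \<Longrightarrow> e < norm y \<Longrightarrow> mollifier e y = 0"
  by (simp add: mollifier_def bump_vanish)

lemma mollifier_const:
  assumes "0 < e"
  shows "conv (mollifier e) (\<lambda>_. c) (x :: 'a::euclidean_space) = c"
proof -
  obtain I where "integral UNIV (bump e :: 'a \<Rightarrow> complex) = complex_of_real I" "0 < I"
    using integral_bump_pos[OF assms] by blast
  then show ?thesis by (simp add: conv_def mollifier_def)
qed

text \<open>
  The mollifier is nonnegative with integral one, so that a mollification is an average over
  \<open>cball x e\<close>.
\<close>

lemma mollifier_approx:
  fixes u :: "'a::euclidean_space \<Rightarrow> complex"
  assumes e: "0 < e" and u: "continuous_on UNIV u" and d: "\<And>z. z \<in> cball x e \<Longrightarrow> norm (u z - u x) \<le> d"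
  shows "norm (conv (mollifier e) u x - u x) \<le> d"
proof -
  obtain I where I: "integral UNIV (bump e :: 'a \<Rightarrow> complex) = complex_of_real I" "0 < I"
    "((\<lambda>y::'a. bump_profile e (y \<bullet> y)) has_integral I) (std_cbox e)"
    using integral_bump_pos[OF e] by blast
  note m = continuous_mollifier[OF e, where 'a='a] mollifier_vanish[OF e, where 'a='a]
  have cu: "continuous_on UNIV (\<lambda>z. u z - u x)" by (intro continuous_intros u)
  have "conv (mollifier e) u x - u x = conv (mollifier e) (\<lambda>z. u z - u x) x"
    using conv_add_right[of "mollifier e" e "\<lambda>z. u z - u x" "\<lambda>_. u x" x, OF m cu] mollifier_const[OF e] by simp
  also have "\<dots> = integral (std_cbox e) (\<lambda>y. mollifier e y * (u (x - y) - u x))"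
    by (rule conv_eq_cbox[of e, OF m(2)])
  also have "norm \<dots> \<le> integral (std_cbox e) (\<lambda>y::'a. d / I * bump_profile e (y \<bullet> y))"
  proof (rule integral_norm_bound_integral)
    show "(\<lambda>y. mollifier e y * (u (x - y) - u x)) integrable_on std_cbox e"
      by (rule conv_integrable[OF m(1) cu])
    show "(\<lambda>y::'a. d / I * bump_profile e (y \<bullet> y)) integrable_on std_cbox e"
      using has_integral_mult_right[OF I(3)] by blast
    fix y :: 'a
    have nm: "norm (mollifier e y) = bump_profile e (y \<bullet> y) / I"
      using I(2) by (simp add: mollifier_def I(1) norm_divide bump_def bump_profile_def)
    show "norm (mollifier e y * (u (x - y) - u x)) \<le> d / I * bump_profile e (y \<bullet> y)"
    proof (cases "e < norm y")
      case True
      then show ?thesis using bump_vanish[OF e True] mollifier_vanish[OF e True] by (simp add: bump_def)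
    next
      case False
      then have "norm (u (x - y) - u x) \<le> d" by (intro d) (simp add: dist_norm)
      then have "norm (mollifier e y) * norm (u (x - y) - u x) \<le> norm (mollifier e y) * d"
        by (rule mult_left_mono) simp
      then show ?thesis unfolding norm_mult nm by (simp add: mult.commute)
    qed
  qed
  also have "\<dots> = d" using integral_unique[OF has_integral_mult_right[OF I(3), of "d / I"]] I(2) by simp
  finally show ?thesis .
qed

lemma mollifier_tendsto:
  fixes u :: "'a::euclidean_space \<Rightarrow> complex"
  assumes u: "continuous_on UNIV u" and e: "0 < e"
    and const: "\<And>d. 0 < d \<Longrightarrow> d < e \<Longrightarrow> conv (mollifier d) u x = c"
  shows "u x = c"
proof -
  have "norm (c - u x) \<le> r" if r: "0 < r" for r
  proof -
    have "isCont u x" using u by (simp add: continuous_on_eq_continuous_at)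
    then obtain s where s: "0 < s" "\<And>z. dist z x < s \<Longrightarrow> dist (u z) (u x) < r"
      unfolding continuous_at_eps_delta using r by blast
    define d where "d = min s e / 2"
    have d: "0 < d" "d < e" "d < s" using s e by (auto simp: d_def min_def)
    have "norm (conv (mollifier d) u x - u x) \<le> r"
      by (rule mollifier_approx[OF d(1) u])
         (use s(2) d in \<open>force simp: dist_norm norm_minus_commute intro!: less_imp_le\<close>)
    then show ?thesis using const[OF d(1,2)] by simp
  qed
  then have "norm (c - u x) \<le> 0" using dense_ge by blast
  then show ?thesis by simp
qed

lemma cdiff_extend_zero:
  assumes "open S" "closed L" "L \<subseteq> S" "cdiff m S u" "cdiff m UNIV h" "\<And>x. x \<notin> L \<Longrightarrow> h x = 0"
  shows "cdiff m UNIV (\<lambda>x. if x \<in> S then h x * u x else 0)"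
proof -
  have "cdiff m S (\<lambda>x. h x * u x)"
    by (intro cdiff_mult assms cdiff_subset[OF assms(5)]) auto
  then have 1: "cdiff m S (\<lambda>x. if x \<in> S then h x * u x else 0)"
    using cdiff_cong[OF assms(1), of "\<lambda>x. h x * u x" "\<lambda>x. if x \<in> S then h x * u x else 0" m] by simp
  have 2: "cdiff m (- L) (\<lambda>x. if x \<in> S then h x * u x else 0)"
    using cdiff_cong[of "- L" "\<lambda>x. 0" "\<lambda>x. if x \<in> S then h x * u x else 0" m]
      cdiff_const assms(2,6) by (simp add: open_Compl del: cdiff.simps)
  have "S \<union> - L = UNIV" using assms(3) by blast
  then show ?thesis using cdiff_Un[OF assms(1) _ 1 2] assms(2) by auto
qed

text \<open>
  Cut-off functions of class \<open>C\<^sup>m\<close>, by induction on \<open>m\<close>: a continuous one is made from the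
  distance to \<open>K\<close>, and mollifying one of class \<open>C\<^sup>m\<close> for a slightly larger compact set gains a
  derivative. The function is one on a whole neighbourhood \<open>V\<close> of \<open>K\<close>, so that its derivatives
  vanish near \<open>K\<close>.
\<close>

lemma cutoff_exists:
  fixes K :: "'a::euclidean_space set"
  assumes "compact K" "open S" "K \<subseteq> S"
  obtains h V L where "cdiff m UNIV h" "open V" "K \<subseteq> V" "compact L" "L \<subseteq> S"
    "\<And>x. x \<in> V \<Longrightarrow> h x = 1" "\<And>x. x \<notin> L \<Longrightarrow> h x = 0"
proof -
  have "\<exists>h V L. cdiff m UNIV h \<and> open V \<and> K \<subseteq> V \<and> compact L \<and> L \<subseteq> S \<and>
      (\<forall>x\<in>V. h x = 1) \<and> (\<forall>x. x \<notin> L \<longrightarrow> h x = 0)"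
    using assms
  proof (induction m arbitrary: K S)
    case (0 K S)
    show ?case
    proof (cases "K = {}")
      case True then show ?thesis by (intro exI[of _ "\<lambda>_. 0"] exI[of _ "{}"]) auto
    next
      case False
      obtain e where e: "0 < e" "{x. infdist x K \<le> e} \<subseteq> S"
        using compact_in_open_separated[OF False 0] by blast
      define h where "h x = complex_of_real (max 0 (min 1 (2 - 2 * infdist x K / e)))" for x
      show ?thesis
      proof (intro exI conjI)
        show "cdiff 0 UNIV h" unfolding h_def using e by (auto intro!: continuous_intros)
        show "open {x. infdist x K < e / 2}" by (intro open_Collect_less continuous_intros)
        show "compact {x. infdist x K \<le> e}" by (rule compact_infdist_le[OF False 0(1) e(1)])
        show "{x. infdist x K \<le> e} \<subseteq> S" by (rule e)
        show "K \<subseteq> {x. infdist x K < e / 2}" using e by auto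
        show "\<forall>x\<in>{x. infdist x K < e / 2}. h x = 1" using e by (auto simp: h_def field_simps)
        show "\<forall>x. x \<notin> {x. infdist x K \<le> e} \<longrightarrow> h x = 0" using e by (auto simp: h_def field_simps)
      qed
    qed
  next
    case (Suc m K S)
    show ?case
    proof (cases "K = {}")
      case True then show ?thesis by (intro exI[of _ "\<lambda>_. 0"] exI[of _ "{}"]) auto
    next
      case False
      obtain e where e: "0 < e" "{x. infdist x K \<le> e} \<subseteq> S"
        using compact_in_open_separated[OF False Suc.prems] by blast
      \<comment> \<open>The mollification radius \<open>e/8\<close> keeps neighbourhoods of \<open>K\<close> inside \<open>K1\<close> and points outside
          the support away from \<open>S1\<close>.\<close>
      define K1 where "K1 = {x. infdist x K \<le> e / 4}"
      define S1 where "S1 = {x. infdist x K < e / 2}"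
      have "compact K1" unfolding K1_def using e by (intro compact_infdist_le[OF False Suc.prems(1)]) auto
      moreover have "open S1" unfolding S1_def by (intro open_Collect_less continuous_intros)
      moreover have "K1 \<subseteq> S1" unfolding K1_def S1_def using e by auto
      ultimately obtain h V L where h: "cdiff m UNIV h" "open V" "K1 \<subseteq> V" "compact L" "L \<subseteq> S1"
        "\<And>x. x \<in> V \<Longrightarrow> h x = 1" "\<And>x. x \<notin> L \<Longrightarrow> h x = 0" using Suc.IH[of K1 S1] by blast
      have e8: "0 < e / 8" using e by simp
      note m = continuous_mollifier[OF e8, where 'a='a] mollifier_vanish[OF e8, where 'a='a]
      have tri: "infdist y K \<le> infdist x K + e / 8" "infdist x K \<le> infdist y K + e / 8"
        if "y \<in> cball x (e / 8)" for x y
        using infdist_triangle[of y K x] infdist_triangle[of x K y] that by (auto simp: dist_commute)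
      show ?thesis
      proof (intro exI conjI)
        show "cdiff (Suc m) UNIV (conv (mollifier (e / 8)) h)"
          by (rule cdiff_conv_gain[OF cdiff_mollifier[OF e8] m(2) h(1)])
        show "open {x. infdist x K < e / 8}" by (intro open_Collect_less continuous_intros)
        show "compact {x. infdist x K \<le> e}" by (rule compact_infdist_le[OF False Suc.prems(1) e(1)])
        show "{x. infdist x K \<le> e} \<subseteq> S" by (rule e)
        show "K \<subseteq> {x. infdist x K < e / 8}" using e by auto
        show "\<forall>x\<in>{x. infdist x K < e / 8}. conv (mollifier (e / 8)) h x = 1"
        proof
          fix x assume x: "x \<in> {x. infdist x K < e / 8}"
          have "conv (mollifier (e / 8)) h x = conv (mollifier (e / 8)) (\<lambda>_. 1) x"
          proof (rule conv_cong[of "e / 8", OF m(2)])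
            fix z assume "z \<in> cball x (e / 8)"
            from tri(1)[OF this] x have "z \<in> K1" by (auto simp: K1_def)
            then show "h z = 1" using h by blast
          qed
          then show "conv (mollifier (e / 8)) h x = 1" using mollifier_const[OF e8] by simp
        qed
        show "\<forall>x. x \<notin> {x. infdist x K \<le> e} \<longrightarrow> conv (mollifier (e / 8)) h x = 0"
        proof (intro allI impI)
          fix x assume x: "x \<notin> {x. infdist x K \<le> e}"
          show "conv (mollifier (e / 8)) h x = 0"
          proof (rule conv_zero[of "e / 8", OF m(2)])
            fix z assume "z \<in> cball x (e / 8)"
            from tri(2)[OF this] x e have "z \<notin> S1" by (auto simp: S1_def)
            then show "h z = 0" using h by blast
          qed
        qed
      qed
    qed
  qed
  then show thesis using that by metis
qed

text \<open>
  The mean value property of harmonic functions, with respect to the bump instead of the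
  normalized volume of the ball.
\<close>

definition mvp :: "'a::euclidean_space set \<Rightarrow> ('a \<Rightarrow> complex) \<Rightarrow> bool" where
  "mvp S u \<longleftrightarrow> continuous_on S u \<and> (\<forall>x e. 0 < e \<longrightarrow> cball x e \<subseteq> S \<longrightarrow> conv (mollifier e) u x = u x)"

text \<open>
  Bootstrapping: a function with the mean value property locally equals its mollification, which has one
  derivative more. The cut-off function, of the order reached so far, makes the function global.
\<close>

lemma mvp_cdiff:
  assumes S: "open S" and u: "mvp S u"
  shows "cdiff m S u"
proof (induction m)
  case 0 then show ?case using u by (simp add: mvp_def)
next
  case (Suc m)
  show ?case
  proof (rule cdiff_local)
    fix x assume "x \<in> S"
    then obtain r where r: "0 < r" "cball x r \<subseteq> S" using S open_contains_cball by blast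
    obtain h V L where h: "cdiff m UNIV h" "open V" "cball x r \<subseteq> V" "compact L" "L \<subseteq> S"
      "\<And>x. x \<in> V \<Longrightarrow> h x = 1" "\<And>x. x \<notin> L \<Longrightarrow> h x = 0"
      using cutoff_exists[OF compact_cball S r(2)] by metis
    define v where "v x = (if x \<in> S then h x * u x else 0)" for x
    have r2: "0 < r / 2" using r by simp
    have "cdiff m UNIV v" unfolding v_def
      by (rule cdiff_extend_zero[OF S compact_imp_closed[OF h(4)] h(5) Suc h(1) h(7)])
    then have c: "cdiff (Suc m) UNIV (conv (mollifier (r / 2)) v)"
      by (intro cdiff_conv_gain[OF cdiff_mollifier[OF r2], of "r / 2"] mollifier_vanish[OF r2])
    have eq: "u y = conv (mollifier (r / 2)) v y" if y: "y \<in> ball x (r / 2)" for y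
    proof -
      have sub: "cball y (r / 2) \<subseteq> cball x r"
      proof
        fix z assume "z \<in> cball y (r / 2)"
        then show "z \<in> cball x r" using y dist_triangle[of x z y] by auto
      qed
      have "conv (mollifier (r / 2)) v y = conv (mollifier (r / 2)) u y"
      proof (rule conv_cong[of "r / 2", OF mollifier_vanish[OF r2]])
        fix z assume "z \<in> cball y (r / 2)"
        then have "z \<in> S" "z \<in> V" using sub r h by auto
        then show "v z = u z" using h by (simp add: v_def)
      qed
      also have "\<dots> = u y" using u r2 sub r(2) unfolding mvp_def by (meson order_trans)
      finally show ?thesis by simp
    qed
    have "cdiff (Suc m) (ball x (r / 2)) (conv (mollifier (r / 2)) v)" using cdiff_subset[OF c] by blast
    then have "cdiff (Suc m) (ball x (r / 2)) u"
      using cdiff_cong[of "ball x (r / 2)" u "conv (mollifier (r / 2)) v" "Suc m"] eq by blast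
    then show "\<exists>T. open T \<and> x \<in> T \<and> cdiff (Suc m) T u" using r2 by (meson centre_in_ball open_ball)
  qed
qed

section \<open>The regularized Newton kernel\<close>

text \<open>
  The Newton kernel of a space of dimension \<open>2k + 2\<close> is \<open>|y|\<^bsup>-2k\<^esup>\<close>. To avoid its
  singularity, the function \<open>s\<^bsup>-k\<^esup>\<close> of \<open>s = |y|\<^sup>2\<close> is replaced, for \<open>s < e\<^sup>2\<close>, by its
  Taylor polynomial of degree three at \<open>s = e\<^sup>2\<close>, written in powers of \<open>1 - s/e\<^sup>2\<close>. The result is
  of class \<open>C\<^sup>3\<close>; degree three makes its Laplacian of class \<open>C\<^sup>1\<close>, as a smoothing kernel has to be.
\<close>

definition newton_profile :: "nat \<Rightarrow> real \<Rightarrow> real \<Rightarrow> real" where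
  "newton_profile k e s = (if e\<^sup>2 \<le> s then 1 / s ^ k
     else (1 + real k * (1 - s / e\<^sup>2) + real k * (real k + 1) / 2 * (1 - s / e\<^sup>2)\<^sup>2
           + real k * (real k + 1) * (real k + 2) / 6 * (1 - s / e\<^sup>2) ^ 3) / (e\<^sup>2) ^ k)"

text \<open>
  The first and the second derivative of \<open>newton_profile\<close> with respect to \<open>s\<close>.
\<close>

definition newton_profile1 :: "nat \<Rightarrow> real \<Rightarrow> real \<Rightarrow> real" where
  "newton_profile1 k e s = (if e\<^sup>2 \<le> s then - (real k / s ^ (k + 1))
     else - (real k + real k * (real k + 1) * (1 - s / e\<^sup>2) + real k * (real k + 1) * (real k + 2) / 2 * (1 - s / e\<^sup>2)\<^sup>2) / (e\<^sup>2) ^ (k + 1))"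

definition newton_profile2 :: "nat \<Rightarrow> real \<Rightarrow> real \<Rightarrow> real" where
  "newton_profile2 k e s = (if e\<^sup>2 \<le> s then real k * (real k + 1) / s ^ (k + 2)
     else (real k * (real k + 1) + real k * (real k + 1) * (real k + 2) * (1 - s / e\<^sup>2)) / (e\<^sup>2) ^ (k + 2))"

definition newton :: "nat \<Rightarrow> real \<Rightarrow> 'a::euclidean_space \<Rightarrow> complex" where
  "newton k e y = complex_of_real (newton_profile k e (y \<bullet> y))"

lemma DERIV_inverse_power:
  fixes s :: real assumes "0 < s"
  shows "((\<lambda>s. c / s ^ m) has_real_derivative - (c * m / s ^ (m + 1))) (at s)"
proof -
  have "((\<lambda>s. c / s ^ m) has_real_derivative (0 * s ^ m - c * (real m * s ^ (m - 1))) / (s ^ m * s ^ m)) (at s)"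
    using assms by (auto intro!: derivative_eq_intros)
  moreover have "(0 * s ^ m - c * (real m * s ^ (m - 1))) / (s ^ m * s ^ m) = - (c * m / s ^ (m + 1))"
    using assms by (cases m) (auto simp: field_simps)
  ultimately show ?thesis by simp
qed

lemma newton_profile_deriv:
  assumes e: "0 < e"
  shows "(newton_profile k e has_real_derivative newton_profile1 k e s) (at s)"
    and "(newton_profile1 k e has_real_derivative newton_profile2 k e s) (at s)"
    and "isCont (newton_profile2 k e) s"
proof -
  have e2: "0 < e\<^sup>2" using e by simp
  have pos: "0 < s" if "e\<^sup>2 \<le> s" for s using e2 that by linarith
  show "(newton_profile k e has_real_derivative newton_profile1 k e s) (at s)"
    unfolding newton_profile_def[abs_def] newton_profile1_def
  proof (rule DERIV_piecewise)
    show "((\<lambda>s. 1 / s ^ k) has_real_derivative - (real k / s ^ (k + 1))) (at s)" if "e\<^sup>2 \<le> s" for s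
      using DERIV_inverse_power[OF pos[OF that], of 1 k] by simp
  qed (use e in \<open>auto intro!: derivative_eq_intros simp: field_simps power2_eq_square power3_eq_cube\<close>)
  show "(newton_profile1 k e has_real_derivative newton_profile2 k e s) (at s)"
    unfolding newton_profile1_def[abs_def] newton_profile2_def
  proof (rule DERIV_piecewise)
    show "((\<lambda>s. - (real k / s ^ (k + 1))) has_real_derivative real k * (real k + 1) / s ^ (k + 2)) (at s)" if "e\<^sup>2 \<le> s" for s
    proof -
      have "- (- real k * real (k + 1) / s ^ (k + 1 + 1)) = real k * (real k + 1) / s ^ (k + 2)"
        using pos[OF that] by (simp add: field_simps)
      then show ?thesis using DERIV_inverse_power[OF pos[OF that], of "- real k" "k + 1"] by (simp only: minus_divide_left[symmetric])
    qed
  qed (use e in \<open>auto intro!: derivative_eq_intros simp: field_simps power2_eq_square\<close>)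
  have "(newton_profile2 k e has_real_derivative (if e\<^sup>2 \<le> s then - (real k * (real k + 1) * (real k + 2) / s ^ Suc (k + 2))
      else - (real k * (real k + 1) * (real k + 2)) / (e\<^sup>2) ^ Suc (k + 2))) (at s)"
    unfolding newton_profile2_def[abs_def]
  proof (rule DERIV_piecewise)
    show "((\<lambda>s. real k * (real k + 1) / s ^ (k + 2)) has_real_derivative - (real k * (real k + 1) * (real k + 2) / s ^ Suc (k + 2))) (at s)" if "e\<^sup>2 \<le> s" for s
    proof -
      have "- ((real k * (real k + 1)) * real (k + 2) / s ^ (k + 2 + 1)) = - (real k * (real k + 1) * (real k + 2) / s ^ Suc (k + 2))"
        using pos[OF that] by (simp add: field_simps)
      then show ?thesis using DERIV_inverse_power[OF pos[OF that], of "(real k * (real k + 1))" "k + 2"] by (simp only:)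
    qed
  qed (use e in \<open>auto intro!: derivative_eq_intros simp: field_simps power2_eq_square\<close>)
  then show "isCont (newton_profile2 k e) s" by (rule DERIV_isCont)
qed

text \<open>
  In dimension \<open>d = 2k + 2\<close> the Laplacian of \<open>h(|y|\<^sup>2)\<close> is \<open>4 s h'' + 2 d h'\<close>. It vanishes for
  the power \<open>s\<^bsup>-k\<^esup>\<close>; for the Taylor polynomial the coefficients of the powers zero and one of
  \<open>1 - s/e\<^sup>2\<close> still cancel, and only a multiple of its square remains.
\<close>

lemma newton_profile_lap:
  assumes e: "0 < e"
  shows "4 * s * newton_profile2 k e s + 2 * (2 * real k + 2) * newton_profile1 k e s
    = - (2 * real k * (real k + 1) * (real k + 2) * (real k + 3) / (e\<^sup>2) ^ (k + 1)) * bump_profile e s"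
proof (cases "e\<^sup>2 \<le> s")
  case True
  then have "0 < s" using e by (meson less_le_trans zero_less_power)
  then show ?thesis using True
    by (simp add: newton_profile2_def newton_profile1_def bump_profile_def field_simps)
next
  case False
  define r where "r = 1 - s / e\<^sup>2"
  have s: "s = e\<^sup>2 * (1 - r)" using e by (simp add: r_def)
  have pw: "(e\<^sup>2) ^ (k + 2) = e\<^sup>2 * (e\<^sup>2) ^ (k + 1)" by simp
  define P where "P = (e\<^sup>2) ^ (k + 1)"
  define E where "E = e\<^sup>2"
  have PE: "0 < P" "0 < E" using e by (auto simp: P_def E_def)
  have "newton_profile2 k e s = (real k * (real k + 1) + real k * (real k + 1) * (real k + 2) * r) / (E * P)"
       "newton_profile1 k e s = - (real k + real k * (real k + 1) * r + real k * (real k + 1) * (real k + 2) / 2 * r\<^sup>2) / P"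
       "bump_profile e s = r\<^sup>2"
    using False by (simp_all only: newton_profile2_def newton_profile1_def bump_profile_def r_def pw if_False P_def E_def)
  moreover have "4 * (E * (1 - r)) * ((real k * (real k + 1) + real k * (real k + 1) * (real k + 2) * r) / (E * P))
     + 2 * (2 * real k + 2) * (- (real k + real k * (real k + 1) * r + real k * (real k + 1) * (real k + 2) / 2 * r\<^sup>2) / P)
     = - (2 * real k * (real k + 1) * (real k + 2) * (real k + 3) / P) * r\<^sup>2"
    using PE by (simp add: field_simps power2_eq_square)
  ultimately show ?thesis using s by (simp only: P_def E_def)
qed

lemma newton_pd:
  assumes e: "0 < e"
  shows "newton k e differentiable at y"
    "pd b (newton k e) = (\<lambda>y. complex_of_real (2 * (y \<bullet> b)) * complex_of_real (newton_profile1 k e (y \<bullet> y)))"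
proof -
  have eq: "newton k e = (\<lambda>y. complex_of_real (newton_profile k e (y \<bullet> y)))" by (auto simp: newton_def)
  note R = pd_radial[of "newton_profile k e" "newton_profile1 k e", OF newton_profile_deriv(1)[OF e]]
  show "newton k e differentiable at y" unfolding eq by (rule R(1))
  show "pd b (newton k e) = (\<lambda>y. complex_of_real (2 * (y \<bullet> b)) * complex_of_real (newton_profile1 k e (y \<bullet> y)))"
    unfolding eq using R(2) by auto
qed

lemma newton_pd_pd:
  fixes y :: "'a::euclidean_space"
  assumes e: "0 < e"
  shows "pd b (newton k e) differentiable at y"
    "pd a (pd b (newton k e)) y = complex_of_real (4 * (y \<bullet> a) * (y \<bullet> b) * newton_profile2 k e (y \<bullet> y)
       + 2 * (a \<bullet> b) * newton_profile1 k e (y \<bullet> y))"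
proof -
  note R = pd_radial[of "newton_profile1 k e" "newton_profile2 k e", OF newton_profile_deriv(2)[OF e]]
  have "((\<lambda>y. 2 * (y \<bullet> b)) has_derivative (\<lambda>h. 2 * (h \<bullet> b))) (at y)"
    by (auto intro!: derivative_eq_intros)
  then have D: "((\<lambda>y. complex_of_real (2 * (y \<bullet> b))) has_derivative (\<lambda>h. complex_of_real (2 * (h \<bullet> b)))) (at y)"
    by (rule has_derivative_of_real)
  then have D1: "(\<lambda>y. complex_of_real (2 * (y \<bullet> b))) differentiable at y" by (auto simp: differentiable_def)
  show "pd b (newton k e) differentiable at y" unfolding newton_pd(2)[OF e]
    by (rule differentiable_mult[OF D1 R(1)])
  show "pd a (pd b (newton k e)) y = complex_of_real (4 * (y \<bullet> a) * (y \<bullet> b) * newton_profile2 k e (y \<bullet> y)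
       + 2 * (a \<bullet> b) * newton_profile1 k e (y \<bullet> y))"
    unfolding newton_pd(2)[OF e] pd_mult[OF D1 R(1)] R(2) pd_has_derivative[OF D] by simp
qed

lemma cdiff_newton:
  assumes e: "0 < e" shows "cdiff 2 UNIV (newton k e :: 'a::euclidean_space \<Rightarrow> complex)"
proof -
  have c: "continuous_on UNIV (newton_profile1 k e)" "continuous_on UNIV (newton_profile2 k e)"
    using newton_profile_deriv(3)[OF e] DERIV_isCont[OF newton_profile_deriv(2)[OF e]]
    by (auto intro!: continuous_at_imp_continuous_on)
  have "continuous_on UNIV (pd a (pd b (newton k e)) :: 'a \<Rightarrow> complex)" for a b
    unfolding newton_pd_pd(2)[OF e, abs_def]
    by (intro continuous_intros continuous_on_compose2[OF c(1)] continuous_on_compose2[OF c(2)]) auto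
  then show ?thesis using newton_pd(1)[OF e, where 'a='a] newton_pd_pd(1)[OF e, where 'a='a] by (simp add: numeral_2_eq_2)
qed

lemma newton_eq:
  assumes "0 < e" "e \<le> norm y"
  shows "newton k e y = 1 / complex_of_real ((y \<bullet> y) ^ k)"
  using assms by (simp add: newton_def newton_profile_def dot_square_norm power_mono)

lemma Lap_newton_bump:
  fixes y :: "'a::euclidean_space"
  assumes e: "0 < e" and dim: "DIM('a) = 2 * k + 2"
  shows "Lap (newton k e) y = complex_of_real (- (2 * real k * (real k + 1) * (real k + 2) * (real k + 3) / (e\<^sup>2) ^ (k + 1))) * bump e y"
proof -
  have sq: "(\<Sum>b\<in>Basis. (y \<bullet> b) * (y \<bullet> b)) = y \<bullet> y" using euclidean_inner[of y y] by simp
  have "(\<Sum>b\<in>Basis. 4 * (y \<bullet> b) * (y \<bullet> b) * newton_profile2 k e (y \<bullet> y) + 2 * (b \<bullet> b) * newton_profile1 k e (y \<bullet> y))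
    = 4 * newton_profile2 k e (y \<bullet> y) * (\<Sum>b\<in>Basis. (y \<bullet> b) * (y \<bullet> b)) + 2 * DIM('a) * newton_profile1 k e (y \<bullet> y)"
    by (simp add: sum.distrib sum_distrib_left algebra_simps inner_same_Basis)
  also have "\<dots> = - (2 * real k * (real k + 1) * (real k + 2) * (real k + 3) / (e\<^sup>2) ^ (k + 1)) * bump_profile e (y \<bullet> y)"
    unfolding sq dim newton_profile_lap[OF e, of "y \<bullet> y" k, symmetric] by simp
  finally show ?thesis unfolding Lap_def newton_pd_pd(2)[OF e] bump_def of_real_sum[symmetric] of_real_mult[symmetric]
    by (rule arg_cong)
qed

lemma newton_diff:
  assumes "0 < d" "d < e"
  shows "cdiff 2 UNIV (\<lambda>y. newton k e y - newton k d y)" "e < norm y \<Longrightarrow> newton k e y - newton k d y = 0"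
proof -
  have "0 < e" using assms by simp
  then show "cdiff 2 UNIV (\<lambda>y. newton k e y - newton k d y)"
    by (intro cdiff_diff cdiff_newton assms) auto
  show "e < norm y \<Longrightarrow> newton k e y - newton k d y = 0" using assms by (simp add: newton_eq)
qed

text \<open>
  The Laplacian of the regularized kernel is a multiple \<open>T\<close> of the mollifier, with the same \<open>T\<close> for
  all radii: the difference of two of these kernels has compact support, so that its Laplacian has
  integral zero, by Green's identity against the constant function one.
\<close>

lemma Lap_newton:
  assumes k: "1 \<le> k" and dim: "DIM('a::euclidean_space) = 2 * k + 2"
  obtains T where "T \<noteq> 0" "\<And>e (y::'a). 0 < e \<Longrightarrow> Lap (newton k e) y = T * mollifier e y"
proof -
  define C where "C e = complex_of_real (- (2 * real k * (real k + 1) * (real k + 2) * (real k + 3) / (e\<^sup>2) ^ (k + 1)))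
     * integral UNIV (bump e :: 'a \<Rightarrow> complex)" for e
  have nz: "integral UNIV (bump e :: 'a \<Rightarrow> complex) \<noteq> 0" if "0 < e" for e
    using integral_bump_pos[OF that, where 'a='a] by force
  have L: "Lap (newton k e) y = C e * mollifier e y" if "0 < e" for e and y :: 'a
    using Lap_newton_bump[OF that dim, of y] nz[OF that] by (simp add: C_def mollifier_def)
  have less: "C e = C d" if "0 < d" "d < e" for d e
  proof -
    have e: "0 < e" using that by simp
    define M :: "'a \<Rightarrow> complex" where "M y = newton k e y - newton k d y" for y
    have M: "cdiff 2 UNIV M" "\<And>y. e < norm y \<Longrightarrow> M y = 0"
      unfolding M_def using newton_diff[OF that] by auto
    have LM: "Lap M y = C e * mollifier e y + (- C d) * mollifier d y" for y
      unfolding M_def using Lap_diff[OF open_UNIV cdiff_newton[OF e] cdiff_newton[OF that(1)], of y k k] L[of e y] L[of d y] e that by simp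
    have "0 = conv (Lap M) (\<lambda>_. 1) 0"
    proof -
      have "conv (\<lambda>_. 1) (Lap M) = conv (Lap (\<lambda>_. 1)) M" by (rule green_identity[OF M cdiff_const])
      moreover have "conv (\<lambda>_. 1) (Lap M) = conv (Lap M) (\<lambda>_. 1)"
        by (rule conv_commute[of _ _ e]) (use continuous_Lap M Lap_vanish[of e M] in auto)
      ultimately show ?thesis by (simp add: conv_def)
    qed
    also have "\<dots> = conv (\<lambda>y::'a. C e * mollifier e y + (- C d) * mollifier d y) (\<lambda>_. 1) 0"
      by (simp only: ext[of "Lap M", OF LM])
    also have "\<dots> = conv (\<lambda>y. C e * mollifier e y) (\<lambda>_. 1) (0::'a) + conv (\<lambda>y. (- C d) * mollifier d y) (\<lambda>_. 1) (0::'a)"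
      by (rule conv_add_left[of _ e]) (use that e in \<open>auto intro!: continuous_intros continuous_mollifier simp: mollifier_vanish\<close>)
    also have "\<dots> = C e - C d"
      unfolding conv_cmult_left mollifier_const[OF e] mollifier_const[OF that(1)] by simp
    finally show ?thesis by simp
  qed
  have C1: "C e = C 1" if "0 < e" for e
    using less[of e 1] less[of 1 e] that by (cases e "1::real" rule: linorder_cases) auto
  have "C 1 \<noteq> 0"
  proof -
    have "0 < 2 * real k * (real k + 1) * (real k + 2) * (real k + 3) / (1\<^sup>2) ^ (k + 1)" using k by simp
    then have "complex_of_real (- (2 * real k * (real k + 1) * (real k + 2) * (real k + 3) / (1\<^sup>2) ^ (k + 1))) \<noteq> 0"
      unfolding of_real_eq_0_iff by linarith
    then show ?thesis unfolding C_def using nz[OF zero_less_one] no_zero_divisors by blast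
  qed
  then show ?thesis
  proof (rule that)
    show "Lap (newton k e) y = C 1 * mollifier e y" if "0 < e" for e and y :: 'a
      using L[OF that] C1[OF that] by simp
  qed
qed

text \<open>
  The mean value property is tested with differences of two regularized Newton kernels only. These have
  compact support, and their Laplacians are differences of two mollifiers; so the averages over balls of
  all radii agree, and the small ones converge to \<open>u x\<close>.
\<close>

lemma mvp_of_newton:
  fixes u :: "'a::euclidean_space \<Rightarrow> complex"
  assumes k: "1 \<le> k" and dim: "DIM('a) = 2 * k + 2" and u: "continuous_on UNIV u" and e: "0 < e"
    and 0: "\<And>d. 0 < d \<Longrightarrow> d < e \<Longrightarrow> conv (Lap (\<lambda>y. newton k e y - newton k d y)) u x = 0"
  shows "conv (mollifier e) u x = u x"
proof -
  obtain T where T: "T \<noteq> 0" "\<And>e (y::'a). 0 < e \<Longrightarrow> Lap (newton k e) y = T * mollifier e y"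
    using Lap_newton[OF k dim] by blast
  have "u x = conv (mollifier e) u x"
  proof (rule mollifier_tendsto[OF u e])
    fix d assume d: "0 < d" "d < e"
    have LM: "Lap (\<lambda>y::'a. newton k e y - newton k d y) = (\<lambda>y. T * mollifier e y + (- T) * mollifier d y)"
    proof
      fix y :: 'a
      show "Lap (\<lambda>y::'a. newton k e y - newton k d y) y = T * mollifier e y + (- T) * mollifier d y"
        using Lap_diff[OF open_UNIV cdiff_newton[OF e] cdiff_newton[OF d(1)], of y k k]
          T(2)[OF e, of y] T(2)[OF d(1), of y] by simp
    qed
    have "0 = conv (\<lambda>y. T * mollifier e y + (- T) * mollifier d y) u x" using 0[OF d] LM by simp
    also have "\<dots> = conv (\<lambda>y. T * mollifier e y) u x + conv (\<lambda>y. (- T) * mollifier d y) u x"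
      by (rule conv_add_left[of _ e]) (use d e u in \<open>auto intro!: continuous_intros continuous_mollifier simp: mollifier_vanish\<close>)
    also have "\<dots> = T * (conv (mollifier e) u x - conv (mollifier d) u x)"
      unfolding conv_cmult_left by (simp add: algebra_simps)
    finally show "conv (mollifier d) u x = conv (mollifier e) u x" using T(1) by simp
  qed
  then show ?thesis by simp
qed

lemma conv_newton_Lap:
  fixes f :: "'a::euclidean_space \<Rightarrow> complex"
  assumes e: "0 < e" and T: "\<And>(y::'a). Lap (newton k e) y = T * mollifier e y"
    and f: "cdiff 2 UNIV f" "\<And>y. R < norm y \<Longrightarrow> f y = 0"
  shows "conv (newton k e) (Lap f) x = T * conv (mollifier e) f x"
proof -
  have "Lap (newton k e) = (\<lambda>y::'a. T * mollifier e y)" using T by auto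
  then show ?thesis using green_identity[OF f cdiff_newton[OF e]] by (simp add: conv_cmult_left)
qed

section \<open>Unique continuation of harmonic functions\<close>

text \<open>
  Locally a harmonic function is the Newton potential of \<open>\<Delta>(h u)\<close>, with a cut-off function \<open>h\<close> that
  is one near the ball. This density vanishes on the ball, hence only values of the kernel away from its
  singularity occur; there the regularized kernel is the true one.
\<close>

lemma harmonic_newton_representation:
  fixes u :: "'a::euclidean_space \<Rightarrow> complex"
  assumes k: "1 \<le> k" and dim: "DIM('a) = 2 * k + 2"
    and S: "open S" and u: "mvp S u" "\<And>x. x \<in> S \<Longrightarrow> Lap u x = 0" and r: "cball p r \<subseteq> S"
  obtains G R where "continuous_on UNIV G" "\<And>y. y \<in> cball p r \<Longrightarrow> G y = 0" "\<And>y. R < norm y \<Longrightarrow> G y = 0"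
    "\<And>x. x \<in> ball p r \<Longrightarrow> u x = integral UNIV (\<lambda>y. G y / complex_of_real (((x - y) \<bullet> (x - y)) ^ k))"
proof -
  obtain T where T: "T \<noteq> 0" "\<And>e (y::'a). 0 < e \<Longrightarrow> Lap (newton k e) y = T * mollifier e y"
    using Lap_newton[OF k dim] by blast
  obtain h V L where h: "cdiff 2 UNIV h" "open V" "cball p r \<subseteq> V" "compact L" "L \<subseteq> S"
    "\<And>x. x \<in> V \<Longrightarrow> h x = 1" "\<And>x. x \<notin> L \<Longrightarrow> h x = 0"
    using cutoff_exists[OF compact_cball S r] by metis
  define f where "f x = (if x \<in> S then h x * u x else 0)" for x
  have f2: "cdiff 2 UNIV f" unfolding f_def
    by (rule cdiff_extend_zero[OF S compact_imp_closed[OF h(4)] h(5) mvp_cdiff[OF S u(1)] h(1) h(7)])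
  obtain R where R: "\<And>x. x \<in> L \<Longrightarrow> norm x \<le> R" using compact_imp_bounded[OF h(4)] bounded_iff by metis
  have fR: "f y = 0" if "R < norm y" for y using h(7)[of y] R[of y] that by (force simp: f_def)
  have VL: "V \<subseteq> L" using h(6,7) by force
  have fV: "f y = u y" if "y \<in> V" for y using that VL h(5) h(6) by (auto simp: f_def)
  define G where "G y = Lap f y / T" for y
  have G0: "G y = 0" if "y \<in> V" for y
  proof -
    have "Lap f y = Lap u y" by (rule Lap_cong_open[OF h(2) that fV])
    then show ?thesis using u(2) that VL h(5) by (auto simp: G_def)
  qed
  have cG: "continuous_on UNIV G" unfolding G_def using T(1) continuous_Lap[OF open_UNIV f2]
    by (auto intro!: continuous_intros)
  have GR: "G y = 0" if "R < norm y" for y using Lap_vanish[of R f, OF fR that] by (simp add: G_def)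
  have rep: "u x = integral UNIV (\<lambda>y. G y / complex_of_real (((x - y) \<bullet> (x - y)) ^ k))" if x: "x \<in> ball p r" for x
  proof -
    obtain e where e: "0 < e" "cball x e \<subseteq> ball p r" using x open_contains_cball[of "ball p r"] open_ball by blast
    have eV: "cball x e \<subseteq> V" using e h(3) by (meson ball_subset_cball order_trans)
    have "cball x e \<subseteq> S" using e(2) ball_subset_cball r by blast
    then have "u x = conv (mollifier e) u x" using u(1) e(1) by (simp add: mvp_def)
    also have "\<dots> = conv (mollifier e) f x"
      by (rule conv_cong[of e]) (use mollifier_vanish[OF e(1)] fV eV in auto)
    also have "T * \<dots> = conv (newton k e) (Lap f) x"
      using conv_newton_Lap[OF e(1) T(2)[OF e(1)] f2 fR] by simp
    finally have "T * u x = conv (newton k e) (Lap f) x" .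
    also have "\<dots> = conv (Lap f) (newton k e) x"
      using conv_commute[OF continuous_Lap[OF open_UNIV f2] cdiff_continuous[OF cdiff_newton[OF e(1)]] Lap_vanish[of R f, OF fR]]
      by simp
    also have "\<dots> = conv (\<lambda>y. T * G y) (newton k e) x" using T(1) by (simp add: G_def)
    also have "\<dots> = T * conv G (newton k e) x" by (rule conv_cmult_left)
    finally have "u x = conv G (newton k e) x" using T(1) by simp
    also have "\<dots> = integral UNIV (\<lambda>y. G y / complex_of_real (((x - y) \<bullet> (x - y)) ^ k))"
      unfolding conv_def
    proof (rule arg_cong[where f = "integral UNIV"], rule ext)
      fix y
      show "G y * newton k e (x - y) = G y / complex_of_real (((x - y) \<bullet> (x - y)) ^ k)"
      proof (cases "G y = 0")
        case False
        then have "y \<notin> cball x e" using G0 eV by blast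
        then show ?thesis using newton_eq[OF e(1), of "x - y" k] by (simp add: dist_norm)
      qed simp
    qed
    finally show ?thesis .
  qed
  show thesis by (rule that[of G R]) (use cG G0 h(3) GR rep in auto)
qed

text \<open>
  The squared distance of \<open>y\<close> and \<open>a + t e\<close>, as a polynomial in a complex parameter \<open>t\<close>.
\<close>

definition cdist :: "'a::euclidean_space \<Rightarrow> 'a \<Rightarrow> complex \<Rightarrow> 'a \<Rightarrow> complex" where
  "cdist a e t y = complex_of_real ((a - y) \<bullet> (a - y)) + 2 * t * complex_of_real ((a - y) \<bullet> e)
     + t\<^sup>2 * complex_of_real (e \<bullet> e)"

lemma cdist_real: "cdist a e (complex_of_real t) y = complex_of_real ((a + t *\<^sub>R e - y) \<bullet> (a + t *\<^sub>R e - y))"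
proof -
  have "(a + t *\<^sub>R e - y) \<bullet> (a + t *\<^sub>R e - y) = (a - y) \<bullet> (a - y) + 2 * t * ((a - y) \<bullet> e) + t\<^sup>2 * (e \<bullet> e)"
    by (simp add: algebra_simps inner_diff inner_add inner_commute power2_eq_square)
  then show ?thesis by (simp add: cdist_def)
qed

lemma cdist_Re:
  "Re (cdist a e t y) = (norm (a + Re t *\<^sub>R e - y))\<^sup>2 - (Im t)\<^sup>2 * (norm e)\<^sup>2"
proof -
  have "Re (cdist a e t y) = (a - y) \<bullet> (a - y) + 2 * Re t * ((a - y) \<bullet> e) + ((Re t)\<^sup>2 - (Im t)\<^sup>2) * (e \<bullet> e)"
    by (simp add: cdist_def power2_eq_square)
  also have "\<dots> = (a + Re t *\<^sub>R e - y) \<bullet> (a + Re t *\<^sub>R e - y) - (Im t)\<^sup>2 * (e \<bullet> e)"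
    by (simp add: algebra_simps inner_diff inner_add inner_commute power2_eq_square)
  finally show ?thesis by (simp add: dot_square_norm)
qed

text \<open>
  If \<open>y\<close> is farther from \<open>p\<close> than the points of the line with parameter in \<open>(-1,2)\<close>, then the real part \<open>|a + (Re t) e - y|\<^sup>2 - (Im t)\<^sup>2 |e|\<^sup>2\<close> is positive
  for all \<open>t\<close> in a rectangle around \<open>[0,1]\<close>. The fractions of \<open>r\<close> are such that this works on a
  fixed rectangle.
\<close>

lemma cdist_nonzero:
  assumes a: "norm (a - p) < r / 8" and e: "norm e < r / 4" and y: "7 * r / 8 < norm (y - p)"
    and t: "-1 < Re t" "Re t < 2" "-1 < Im t" "Im t < 1"
  shows "cdist a e t y \<noteq> 0"
proof -
  have "\<bar>Re t\<bar> * norm e \<le> 2 * norm e" using t by (intro mult_right_mono) auto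
  then have 1: "norm (Re t *\<^sub>R e) < r / 2" using e by simp
  have "norm (y - p) = norm ((a - p) + Re t *\<^sub>R e - (a + Re t *\<^sub>R e - y))" by simp
  also have "\<dots> \<le> norm ((a - p) + Re t *\<^sub>R e) + norm (a + Re t *\<^sub>R e - y)" by (rule norm_triangle_ineq4)
  also have "\<dots> \<le> norm (a - p) + norm (Re t *\<^sub>R e) + norm (a + Re t *\<^sub>R e - y)"
    using norm_triangle_ineq[of "a - p" "Re t *\<^sub>R e"] by simp
  finally have "r / 4 < norm (a + Re t *\<^sub>R e - y)" using 1 a y by linarith
  then have "norm e < norm (a + Re t *\<^sub>R e - y)" using e by linarith
  then have "(norm e)\<^sup>2 < (norm (a + Re t *\<^sub>R e - y))\<^sup>2" by (intro power_strict_mono) auto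
  moreover have "(Im t)\<^sup>2 * (norm e)\<^sup>2 \<le> 1 * (norm e)\<^sup>2"
    using t by (intro mult_right_mono) (auto simp: abs_square_le_1 abs_le_iff)
  ultimately have "0 < Re (cdist a e t y)" by (simp add: cdist_Re)
  then show ?thesis by force
qed

text \<open>
  The dimension is even, so the Newton kernel is a rational function of the coordinates and no branch of a
  root has to be chosen: a Newton potential, restricted to a segment away from its density, extends to a
  holomorphic function of the parameter. Where \<open>G\<close> vanishes the denominator may vanish too, so continuity of
  the integrand is shown separately on two overlapping open sets of \<open>y\<close>.
\<close>

lemma newton_potential_segment:
  fixes G :: "'a::euclidean_space \<Rightarrow> complex"
  assumes G: "continuous_on UNIV G" "\<And>y. y \<in> cball p r \<Longrightarrow> G y = 0" "\<And>y. R < norm y \<Longrightarrow> G y = 0"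
    and r: "0 < r" and a: "norm (a - p) < r / 8" and e: "norm e < r / 4"
  shows "(\<lambda>t. integral UNIV (\<lambda>y. G y / (cdist a e t y) ^ k)) holomorphic_on (box (Complex (-1) (-1)) (Complex 2 1))"
proof -
  define U where "U = box (Complex (-1) (-1)) (Complex 2 1)"
  have U: "open U" "convex U" "\<And>t. t \<in> U \<longleftrightarrow> -1 < Re t \<and> Re t < 2 \<and> -1 < Im t \<and> Im t < 1"
    unfolding U_def by (auto simp: in_box_complex_iff)
  define q where "q t y = cdist a e t y" for t y
  define q' where "q' t y = 2 * complex_of_real ((a - y) \<bullet> e) + 2 * t * complex_of_real (e \<bullet> e)" for t y
  have nz: "q t y \<noteq> 0" if "t \<in> U" "7 * r / 8 < norm (y - p)" for t y
    using cdist_nonzero[OF a e that(2)] that(1) U by (auto simp: q_def)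
  have nz2: "q t y \<noteq> 0" if "t \<in> U" "G y \<noteq> 0" for t y
  proof (rule nz[OF that(1)])
    have "r < norm (y - p)" using G(2)[of y] that(2) by (force simp: dist_norm norm_minus_commute)
    then show "7 * r / 8 < norm (y - p)" using r by linarith
  qed
  have Dq: "((\<lambda>t. q t y) has_field_derivative q' t y) (at t)" for t y
    unfolding q_def cdist_def q'_def by (auto intro!: derivative_eq_intros)
  define f where "f t y = G y / q t y ^ k" for t y
  define fx where "fx t y = - (G y * of_nat k * q' t y / q t y ^ Suc k)" for t y
  have contq: "continuous_on A (\<lambda>(t, y). q t y)" "continuous_on A (\<lambda>(t, y). q' t y)" for A
    unfolding q_def cdist_def q'_def split_beta by (intro continuous_intros)+
  have cG: "continuous_on A (\<lambda>(t::complex, y). G y)" for A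
    unfolding split_beta by (intro continuous_on_compose2[OF G(1)] continuous_intros) auto
  have cont: "continuous_on (U \<times> UNIV) (\<lambda>(t, y). F t y / q t y ^ m)"
    if F: "continuous_on UNIV (\<lambda>(t, y). F t y)" and F0: "\<And>t y. G y = 0 \<Longrightarrow> F t y = 0" for m F
  proof -
    have eqU: "U \<times> (UNIV :: 'a set) = U \<times> ball p r \<union> U \<times> {y. 7 * r / 8 < norm (y - p)}"
      using r by (auto simp: dist_norm norm_minus_commute)
    have c1: "continuous_on (U \<times> ball p r) (\<lambda>(t, y). F t y / q t y ^ m)"
    proof (rule continuous_on_eq[of _ "\<lambda>_. 0"])
      show "0 = (case x of (t, y) \<Rightarrow> F t y / q t y ^ m)" if "x \<in> U \<times> ball p r" for x
        using that F0 G(2) by (auto split: prod.split)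
    qed simp
    have c2: "continuous_on (U \<times> {y. 7 * r / 8 < norm (y - p)}) (\<lambda>(t, y). F t y / q t y ^ m)"
      using contq(1) continuous_on_subset[OF F] nz unfolding split_beta
      by (auto intro!: continuous_intros)
    have o: "open (U \<times> ball p r)" "open (U \<times> {y. 7 * r / 8 < norm (y - p)})"
      by (auto intro!: open_Times U open_Collect_less continuous_intros)
    show ?thesis unfolding eqU by (rule continuous_on_open_Un[OF o c1 c2])
  qed
  have "(\<lambda>t. integral (cbox (- (R *\<^sub>R One)) (R *\<^sub>R One)) (f t)) holomorphic_on U"
  proof (rule leibniz_rule_holomorphic)
    fix t y assume t: "t \<in> U"
    show "((\<lambda>t. f t y) has_field_derivative fx t y) (at t within U)"
    proof (cases "G y = 0")
      case True then show ?thesis by (simp add: f_def fx_def)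
    next
      case False
      have "((\<lambda>t. G y / q t y ^ k) has_field_derivative
          (0 * q t y ^ k - G y * (of_nat k * q' t y * q t y ^ (k - 1))) / (q t y ^ k * q t y ^ k)) (at t)"
        using nz2[OF t False] by (auto intro!: derivative_eq_intros Dq)
      moreover have "(0 * q t y ^ k - G y * (of_nat k * q' t y * q t y ^ (k - 1))) / (q t y ^ k * q t y ^ k) = fx t y"
        using nz2[OF t False] by (cases k) (auto simp: fx_def field_simps)
      ultimately show ?thesis unfolding f_def using has_field_derivative_at_within by metis
    qed
  next
    fix t assume t: "t \<in> U"
    have "continuous_on (U \<times> UNIV) (\<lambda>(t, y). f t y)" unfolding f_def by (rule cont[OF cG]) simp
    then show "f t integrable_on cbox (- (R *\<^sub>R One)) (R *\<^sub>R One)"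
      by (intro integrable_continuous continuous_on_compose2[of _ "\<lambda>(t, y). f t y" _ "\<lambda>y. (t, y)", simplified])
         (use t in \<open>auto intro!: continuous_intros\<close>)
  next
    have "continuous_on (U \<times> UNIV) (\<lambda>(t, y). (- (G y * of_nat k * q' t y)) / q t y ^ Suc k)"
      by (rule cont) (use contq(2)[of UNIV] cG[of UNIV] in \<open>auto simp: split_beta intro!: continuous_intros\<close>)
    then have "continuous_on (U \<times> UNIV) (\<lambda>(t, y). fx t y)" by (simp add: fx_def)
    then show "continuous_on (U \<times> cbox (- (R *\<^sub>R One)) (R *\<^sub>R One)) (\<lambda>(t, y). fx t y)"
      by (rule continuous_on_subset) auto
  qed (rule U)
  moreover have "integral UNIV (\<lambda>y. G y / (cdist a e t y) ^ k) = integral (cbox (- (R *\<^sub>R One)) (R *\<^sub>R One)) (f t)" for t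
    using integral_UNIV_cbox[of R "f t"] G(3) unfolding std_cbox_def by (simp add: f_def[abs_def] q_def)
  ultimately show ?thesis unfolding U_def by simp
qed

text \<open>
  The identity theorem on the segment from \<open>a\<close> to \<open>b\<close>: the holomorphic extension vanishes for small
  real parameters, because \<open>u\<close> vanishes near \<open>a\<close>, hence also at the parameter one.
\<close>

lemma harmonic_zero_near:
  fixes u :: "'a::euclidean_space \<Rightarrow> complex"
  assumes k: "1 \<le> k" and dim: "DIM('a) = 2 * k + 2"
    and S: "open S" and u: "mvp S u" "\<And>x. x \<in> S \<Longrightarrow> Lap u x = 0"
    and r: "0 < r" "cball p r \<subseteq> S" and a: "norm (a - p) < r / 8" and d: "0 < d" "\<And>y. y \<in> ball a d \<Longrightarrow> u y = 0"
    and b: "norm (b - p) < r / 8"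
  shows "u b = 0"
proof -
  obtain G R where G: "continuous_on UNIV G" "\<And>y. y \<in> cball p r \<Longrightarrow> G y = 0" "\<And>y. R < norm y \<Longrightarrow> G y = 0"
    and rep: "\<And>x. x \<in> ball p r \<Longrightarrow> u x = integral UNIV (\<lambda>y. G y / complex_of_real (((x - y) \<bullet> (x - y)) ^ k))"
    using harmonic_newton_representation[OF k dim S u r(2)] by metis
  define e where "e = b - a"
  have e: "norm e < r / 4"
    using norm_triangle_ineq4[of "b - p" "a - p"] a b by (simp add: e_def)
  define F where "F t = integral UNIV (\<lambda>y. G y / (cdist a e t y) ^ k)" for t
  define U where "U = box (Complex (-1) (-1)) (Complex 2 1)"
  have U: "open U" "connected U" "\<And>t. t \<in> U \<longleftrightarrow> -1 < Re t \<and> Re t < 2 \<and> -1 < Im t \<and> Im t < 1"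
    unfolding U_def by (auto simp: in_box_complex_iff intro: convex_connected)
  have hol: "F holomorphic_on U" unfolding F_def U_def by (rule newton_potential_segment[OF G r(1) a e])
  have Fr: "F (complex_of_real t) = u (a + t *\<^sub>R e)" if t: "0 \<le> t" "t \<le> 1" for t
  proof -
    have "norm (a + t *\<^sub>R e - p) = norm ((1 - t) *\<^sub>R (a - p) + t *\<^sub>R (b - p))" by (simp add: e_def algebra_simps)
    also have "\<dots> \<le> (1 - t) * norm (a - p) + t * norm (b - p)"
      using norm_triangle_ineq[of "(1 - t) *\<^sub>R (a - p)" "t *\<^sub>R (b - p)"] t by simp
    also have "\<dots> \<le> (1 - t) * (r / 8) + t * (r / 8)"
      using a b t by (intro add_mono mult_left_mono) auto
    also have "\<dots> = r / 8" by (simp add: field_simps)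
    also have "\<dots> < r" using r by simp
    finally have "a + t *\<^sub>R e \<in> ball p r" by (simp add: dist_norm norm_minus_commute)
    from rep[OF this] show ?thesis unfolding F_def cdist_real by simp
  qed
  \<comment> \<open>For parameters below \<open>d'\<close> the point \<open>a + t e\<close> stays in \<open>ball a d\<close>.\<close>
  define d' where "d' = min 1 (d / (1 + norm e))"
  have d': "0 < d'" "d' \<le> 1" using d by (auto simp: d'_def add_pos_nonneg)
  have zero: "F (complex_of_real t) = 0" if t: "0 \<le> t" "t < d'" for t
  proof -
    have "t * norm e \<le> t * (1 + norm e)" using t by (intro mult_left_mono) auto
    also have "\<dots> < d / (1 + norm e) * (1 + norm e)"
      using t by (intro mult_strict_right_mono) (auto simp: d'_def add_pos_nonneg)
    also have "\<dots> = d"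
    proof -
      have "1 + norm e \<noteq> 0" using norm_ge_zero[of e] by linarith
      then show ?thesis by simp
    qed
    finally have "a + t *\<^sub>R e \<in> ball a d" using t by (simp add: dist_norm)
    then show ?thesis using Fr[of t] t d' d(2) by simp
  qed
  have "F 1 = 0"
  proof (rule analytic_continuation[OF hol U(1,2), of "complex_of_real ` {0..<d'}" 0 1])
    show "0 islimpt complex_of_real ` {0..<d'}"
      unfolding islimpt_approachable
    proof (intro allI impI)
      fix s :: real assume s: "0 < s"
      define t where "t = min s d' / 2"
      have "0 < t" "t < s" "t < d'" using s d' by (auto simp: t_def min_def)
      then show "\<exists>x'\<in>complex_of_real ` {0..<d'}. x' \<noteq> 0 \<and> dist x' 0 < s"
        by (intro bexI[of _ "complex_of_real t"]) (auto simp: dist_norm)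
    qed
  qed (use zero U d' in auto)
  then show ?thesis using Fr[of 1] by (simp add: e_def)
qed

text \<open>
  The interior of the zero set is open, nonempty and, by the previous lemma, relatively closed.
\<close>

lemma harmonic_unique_continuation:
  fixes u :: "'a::euclidean_space \<Rightarrow> complex"
  assumes k: "1 \<le> k" and dim: "DIM('a) = 2 * k + 2"
    and S: "open S" "connected S" and u: "mvp S u" "\<And>x. x \<in> S \<Longrightarrow> Lap u x = 0"
    and W: "open W" "W \<noteq> {}" "W \<subseteq> S" "\<And>x. x \<in> W \<Longrightarrow> u x = 0" and x: "x \<in> S"
  shows "u x = 0"
proof -
  define Z where "Z = interior {x \<in> S. u x = 0}"
  have Z: "open Z" "Z \<subseteq> S" "\<And>x. x \<in> Z \<Longrightarrow> u x = 0"
    unfolding Z_def using interior_subset by (auto simp: subset_iff)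
  have "W \<subseteq> Z" unfolding Z_def using W by (intro interior_maximal) auto
  then have ne: "Z \<noteq> {}" using W by auto
  have cl: "p \<in> Z" if p: "p \<in> S" "p \<in> closure Z" for p
  proof -
    obtain r where r: "0 < r" "cball p r \<subseteq> S" using S p open_contains_cball by blast
    then obtain a where a: "a \<in> Z" "dist a p < r / 8"
      using p(2) unfolding closure_approachable by (metis divide_pos_pos zero_less_numeral)
    obtain d where d: "0 < d" "ball a d \<subseteq> Z" using a Z(1) open_contains_ball by blast
    have "u b = 0" if "b \<in> ball p (r / 8)" for b
    proof (rule harmonic_zero_near[OF k dim S(1) u r _ d(1)])
      show "norm (a - p) < r / 8" "norm (b - p) < r / 8"
        using a(2) that by (auto simp: dist_norm norm_minus_commute)
      show "u y = 0" if "y \<in> ball a d" for y using Z(3) d(2) that by blast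
    qed
    moreover have "ball p (r / 8) \<subseteq> S" using r by force
    ultimately have "ball p (r / 8) \<subseteq> Z" unfolding Z_def by (intro interior_maximal) auto
    then show ?thesis using r by auto
  qed
  have "S \<inter> Z = Z" using Z by auto
  have "closedin (top_of_set S) Z"
    unfolding closedin_closed using cl Z(2) closure_subset[of Z]
    by (intro exI[of _ "closure Z"]) auto
  moreover have "openin (top_of_set S) Z" using Z(1,2) by (simp add: openin_open_eq S(1))
  ultimately have "Z = S" using S(2) ne connected_clopen by blast
  then show ?thesis using x Z by blast
qed

section \<open>Decaying functions that are harmonic on slices\<close>

lemma second_derivative_at_max:
  fixes f f' :: "real \<Rightarrow> real"
  assumes d: "0 < d" and D: "\<And>t. \<bar>t\<bar> < d \<Longrightarrow> (f has_real_derivative f' t) (at t)"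
    and D2: "(f' has_real_derivative D) (at 0)" and max: "\<And>t. \<bar>t\<bar> < d \<Longrightarrow> f t \<le> f 0"
  shows "D \<le> 0"
proof (rule ccontr)
  assume "\<not> D \<le> 0"
  then have pos: "0 < D" by simp
  have f0: "f' 0 = 0" by (rule DERIV_local_max[OF D[of 0] d]) (use d max in auto)
  obtain s where s: "0 < s" "\<And>h. 0 < h \<Longrightarrow> h < s \<Longrightarrow> f' 0 < f' (0 + h)"
    using DERIV_pos_inc_right[OF D2 pos] by blast
  define t where "t = min s d / 2"
  have t: "0 < t" "t < s" "t < d" using s d by (auto simp: t_def min_def)
  have "f 0 < f t"
  proof (rule DERIV_pos_imp_increasing_open[OF t(1)])
    fix x assume x: "0 < x" "x < t"
    then show "\<exists>y. (f has_real_derivative y) (at x) \<and> 0 < y"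
      using D[of x] s(2)[of x] f0 t by (intro exI[of _ "f' x"]) auto
  next
    show "continuous_on {0..t} f"
      by (intro continuous_at_imp_continuous_on ballI DERIV_isCont[OF D]) (use t in auto)
  qed
  then show False using max[of t] t by simp
qed

text \<open>
  Liouville's theorem on one affine slice, in the form of a maximum principle. Let \<open>v p \<noteq> 0\<close>. The
  function \<open>g = Re (cnj (v p) v)\<close> is harmonic along the slice, positive at \<open>p\<close> and at most half as large far out.
  For a small \<open>h > 0\<close> the maximum of \<open>g + h |x|\<^sup>2\<close> on a large ball of the slice lies inside the ball, where the
  second derivatives in the directions of the slice are not positive; but their sum is
  \<open>2 h (card B) > 0\<close>.
\<close>

lemma decaying_slice_harmonic_zero:
  fixes v :: "'a::euclidean_space \<Rightarrow> complex"
  assumes B: "B \<subseteq> Basis" "B \<noteq> {}" and S: "open S" and v: "cdiff 2 S v"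
    and A: "{x. \<forall>b\<in>Basis - B. x \<bullet> b = p \<bullet> b} \<subseteq> S"
    and harm: "\<And>x. x \<in> S \<Longrightarrow> (\<Sum>b\<in>B. pd b (pd b v) x) = 0"
    and decay: "\<And>e. 0 < e \<Longrightarrow> \<exists>R. \<forall>x. R < norm x \<longrightarrow> norm (v x) < e"
  shows "v p = 0"
proof (rule ccontr)
  assume nz: "v p \<noteq> 0"
  define A where "A = {x. \<forall>b\<in>Basis - B. x \<bullet> b = p \<bullet> b}"
  have AS: "A \<subseteq> S" using A by (simp add: A_def)
  define c where "c = cnj (v p)"
  define g where "g x = Re (c * v x)" for x
  define m where "m = (norm (v p))\<^sup>2"
  have g_at_p: "g p = m" unfolding g_def c_def m_def cmod_power2 by (simp add: power2_eq_square)
  have m0: "0 < m" using nz by (simp add: m_def)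
  have "0 < norm (v p) / 2" using nz by simp
  then obtain R0 where R0: "\<And>x. R0 < norm x \<Longrightarrow> norm (v x) < norm (v p) / 2" using decay by blast
  define R where "R = max (norm p) (max 0 R0)"
  have R: "0 \<le> R" "norm p \<le> R" "R0 \<le> R" by (auto simp: R_def)
  have gfar: "g x \<le> m / 2" if "R < norm x" for x
  proof -
    have "g x \<le> norm (c * v x)" unfolding g_def by (rule complex_Re_le_cmod)
    also have "\<dots> = norm (v p) * norm (v x)" by (simp add: c_def norm_mult)
    also have "\<dots> \<le> norm (v p) * (norm (v p) / 2)" using R0[of x] R that by (intro mult_left_mono) auto
    finally show ?thesis by (simp add: m_def power2_eq_square)
  qed
  \<comment> \<open>The quadratic term is at most \<open>m/4\<close> on the ball of radius \<open>R + 1\<close>, too small to compensate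
      for the drop of \<open>g\<close> from \<open>m\<close> to \<open>m/2\<close>.\<close>
  define h where "h = m / (4 * (R + 1)\<^sup>2)"
  have h: "0 < h" "h * (R + 1)\<^sup>2 = m / 4" using m0 R by (auto simp: h_def)
  define f where "f x = g x + h * (x \<bullet> x)" for x
  have cf: "continuous_on (A \<inter> cball 0 (R + 1)) f" unfolding f_def g_def
    using continuous_on_subset[OF cdiff_continuous[OF v], of "A \<inter> cball 0 (R + 1)"] AS
    by (auto intro!: continuous_intros)
  have "A = (\<Inter>b\<in>Basis - B. {x. x \<bullet> b = p \<bullet> b})" by (auto simp: A_def)
  moreover have "closed (\<Inter>b\<in>Basis - B. {x. x \<bullet> b = p \<bullet> b})"
    by (intro closed_INT ballI closed_Collect_eq continuous_intros)
  ultimately have "closed A" by simp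
  then have "compact (A \<inter> cball 0 (R + 1))" by (simp add: closed_Int_compact)
  moreover have "p \<in> A \<inter> cball 0 (R + 1)" using R by (auto simp: A_def)
  ultimately obtain q where q: "q \<in> A" "norm q \<le> R + 1"
    and max: "\<And>x. x \<in> A \<Longrightarrow> norm x \<le> R + 1 \<Longrightarrow> f x \<le> f q"
    using continuous_attains_sup[OF _ _ cf] by (metis IntD1 IntD2 IntI empty_iff mem_cball_0)
  have qR: "norm q \<le> R"
  proof (rule ccontr)
    assume far: "\<not> norm q \<le> R"
    have "h * (q \<bullet> q) \<le> h * (R + 1)\<^sup>2" using h q by (intro mult_left_mono) (auto simp: dot_square_norm power_mono)
    then have "f q \<le> m / 2 + m / 4" using gfar[of q] far h by (simp add: f_def)
    moreover have "m \<le> f p" using h g_at_p by (simp add: f_def)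
    moreover have "f p \<le> f q" using max[of p] R by (simp add: A_def)
    ultimately show False using m0 by simp
  qed
  have second: "Re (c * pd b (pd b v) q) + 2 * h \<le> 0" if b: "b \<in> B" for b
  proof (rule second_derivative_at_max[of 1 "\<lambda>t. f (q + t *\<^sub>R b)" "\<lambda>t. Re (c * pd b v (q + t *\<^sub>R b)) + 2 * h * ((q + t *\<^sub>R b) \<bullet> b)"])
    have bB: "b \<in> Basis" using b B by auto
    have inA: "q + t *\<^sub>R b \<in> A" for t
      using q(1) b bB by (auto simp: A_def inner_add_left inner_Basis)
    have lin: "bounded_linear (\<lambda>z. Re (c * z))"
      by (intro bounded_linear_compose[OF bounded_linear_Re] bounded_linear_mult_right)
    have dv: "v differentiable at (q + t *\<^sub>R b)" "pd b v differentiable at (q + t *\<^sub>R b)" for t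
      using v inA[of t] AS bB by (auto simp: numeral_2_eq_2)
    have der: "((\<lambda>t. Re (c * w (q + t *\<^sub>R b))) has_real_derivative Re (c * pd b w (q + t *\<^sub>R b))) (at t)"
      if "w differentiable at (q + t *\<^sub>R b)" for w t
      using bounded_linear.has_vector_derivative[OF lin has_vector_derivative_pd[OF that]]
      by (simp add: has_real_derivative_iff_has_vector_derivative)
    have sq: "((\<lambda>t. (q + t *\<^sub>R b) \<bullet> (q + t *\<^sub>R b)) has_real_derivative 2 * ((q + t *\<^sub>R b) \<bullet> b)) (at t)" for t
      unfolding has_field_derivative_def
      by (auto intro!: derivative_eq_intros simp: inner_commute algebra_simps)
    have li: "((\<lambda>t. (q + t *\<^sub>R b) \<bullet> b) has_real_derivative 1) (at t)" for t
      unfolding has_field_derivative_def using bB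
      by (auto intro!: derivative_eq_intros simp: inner_commute algebra_simps)
    show "((\<lambda>t. f (q + t *\<^sub>R b)) has_real_derivative Re (c * pd b v (q + t *\<^sub>R b)) + 2 * h * ((q + t *\<^sub>R b) \<bullet> b)) (at t)" for t
      unfolding f_def g_def using DERIV_add[OF der[OF dv(1)] DERIV_cmult[OF sq, of h t]]
      by (simp only: mult.assoc mult.left_commute[of h 2])
    show "((\<lambda>t. Re (c * pd b v (q + t *\<^sub>R b)) + 2 * h * ((q + t *\<^sub>R b) \<bullet> b)) has_real_derivative Re (c * pd b (pd b v) q) + 2 * h) (at 0)"
      using DERIV_add[OF der[OF dv(2), of 0] DERIV_cmult[OF li, of "2 * h" 0]] by simp
    show "f (q + t *\<^sub>R b) \<le> f (q + 0 *\<^sub>R b)" if "\<bar>t\<bar> < 1" for t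
    proof -
      have "norm (q + t *\<^sub>R b) \<le> R + 1" using norm_triangle_ineq[of q "t *\<^sub>R b"] qR that bB by simp
      then show ?thesis using max[OF inA] by simp
    qed
  qed simp
  have "finite B" using B finite_subset finite_Basis by blast
  have "(\<Sum>b\<in>B. Re (c * pd b (pd b v) q) + 2 * h) \<le> 0" using second by (intro sum_nonpos) auto
  moreover have "(\<Sum>b\<in>B. Re (c * pd b (pd b v) q)) = Re (c * (\<Sum>b\<in>B. pd b (pd b v) q))"
    by (simp only: sum_distrib_left Re_sum)
  moreover have "(\<Sum>b\<in>B. pd b (pd b v) q) = 0" using harm q(1) AS by blast
  ultimately have "card B * (2 * h) \<le> 0" by (simp add: sum.distrib)
  moreover have "0 < card B" using \<open>finite B\<close> B(2) by (simp add: card_gt_0_iff)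
  ultimately show False using h(1) by (simp add: mult_le_0_iff)
qed

text \<open>
  For \<open>1 \<le> k\<close> the Newton kernel tends to zero at infinity. For \<open>k = 0\<close>, the plane, it does not,
  which is why a single Clifford generator is treated separately at the end.
\<close>

lemma conv_newton_decay:
  fixes G :: "'a::euclidean_space \<Rightarrow> complex"
  assumes k: "1 \<le> k" and e: "0 < e" and G: "continuous_on UNIV G" "\<And>y. R < norm y \<Longrightarrow> G y = 0" and d: "0 < d"
  shows "\<exists>R'. \<forall>x. R' < norm x \<longrightarrow> norm (conv (newton k e) G x) < d"
proof -
  define I where "I = integral (std_cbox R) (\<lambda>y. norm (G y))"
  have int: "(\<lambda>y. norm (G y)) integrable_on std_cbox R" unfolding std_cbox_def
    by (intro integrable_continuous continuous_intros continuous_on_subset[OF G(1)]) auto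
  have I: "0 \<le> I" unfolding I_def using int by (intro integral_nonneg) auto
  define s where "s = d / (I + 1)"
  have s: "0 < s" using d I by (simp add: s_def)
  have "I * s < d"
  proof -
    have "I * s < (I + 1) * s" using s by (intro mult_strict_right_mono) auto
    also have "\<dots> = d" using I by (simp add: s_def)
    finally show ?thesis .
  qed
  define M where "M = e + 1 + 1 / s"
  have "norm (conv (newton k e) G x) < d" if x: "\<bar>R\<bar> + M < norm x" for x
  proof -
    have cN: "continuous_on UNIV (newton k e :: 'a \<Rightarrow> complex)" using cdiff_continuous[OF cdiff_newton[OF e]] .
    have "conv (newton k e) G x = conv G (newton k e) x" using conv_commute[OF G(1) cN G(2)] by simp
    also have "\<dots> = integral (std_cbox R) (\<lambda>y. G y * newton k e (x - y))" by (rule conv_eq_cbox[of R G, OF G(2)])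
    also have "norm \<dots> \<le> integral (std_cbox R) (\<lambda>y. norm (G y) * s)"
    proof (rule integral_norm_bound_integral)
      show "(\<lambda>y. G y * newton k e (x - y)) integrable_on std_cbox R" by (rule conv_integrable[OF G(1) cN])
      show "(\<lambda>y. norm (G y) * s) integrable_on std_cbox R" using integrable_on_mult_left[OF int] by blast
      fix y
      show "norm (G y * newton k e (x - y)) \<le> norm (G y) * s"
      proof (cases "R < norm y")
        case True then show ?thesis using G(2) by simp
      next
        case False
        have "norm x - norm y \<le> norm (x - y)" by (rule norm_triangle_ineq2)
        then have big: "M < norm (x - y)" using x False by linarith
        then have n: "e \<le> norm (x - y)" "1 \<le> norm (x - y)" "1 / s \<le> norm (x - y)"
          using e s by (auto simp: M_def add_pos_pos intro!: order_trans[OF _ less_imp_le[OF big]])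
        have "norm (x - y) ^ 1 \<le> norm (x - y) ^ (2 * k)" using n(2) k by (intro power_increasing) auto
        then have "1 / s \<le> norm (x - y) ^ (2 * k)" using n(3) by simp
        moreover have "0 < norm (x - y) ^ (2 * k)" using n(2) by (intro zero_less_power) linarith
        ultimately have "1 / norm (x - y) ^ (2 * k) \<le> s" using s
          by (simp add: divide_le_eq mult.commute)
        then have "norm (newton k e (x - y)) \<le> s"
          unfolding newton_eq[OF e n(1)] by (simp add: norm_divide dot_square_norm norm_power power_mult)
        then show ?thesis by (simp add: norm_mult mult_left_mono)
      qed
    qed
    also have "\<dots> = I * s" by (simp add: I_def)
    finally show ?thesis using \<open>I * s < d\<close> by simp
  qed
  then show ?thesis by blast
qed

section \<open>The Clifford generators in coordinates\<close>

definition toggle :: "nat \<Rightarrow> nat set \<Rightarrow> nat set" where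
  "toggle i \<beta> = (if i \<in> \<beta> then \<beta> - {i} else insert i \<beta>)"

text \<open>
  The sign of the permutation that moves \<open>i\<close> to its place in the increasing enumeration of
  \<open>\<beta>\<close>.
\<close>

definition sort_sign :: "nat \<Rightarrow> nat set \<Rightarrow> complex" where
  "sort_sign i \<beta> = (-1) ^ card {l \<in> \<beta>. l < i}"

text \<open>
  In the basis \<open>f\<^sub>\<beta>\<close> each generator is a monomial matrix:
  \<open>(\<gamma>\<^sub>j v)\<^sub>\<beta>\<close> is \<open>gam_coeff n j \<beta>\<close> times \<open>v\<close> at the index \<open>gam_index n j \<beta>\<close>. So the
  Clifford algebra turns into identities between signs, and the spinor-valued equations into scalar ones.
\<close>

definition gam_index :: "nat \<Rightarrow> nat \<Rightarrow> nat set \<Rightarrow> nat set" where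
  "gam_index n j \<beta> = (if odd n \<and> j = n then \<beta> else toggle ((j + 1) div 2) \<beta>)"

definition gam_coeff :: "nat \<Rightarrow> nat \<Rightarrow> nat set \<Rightarrow> complex" where
  "gam_coeff n j \<beta> = (if odd n \<and> j = n then - \<i> * (-1) ^ card \<beta>
     else if odd j then (if (j + 1) div 2 \<in> \<beta> then 1 else -1) * sort_sign ((j + 1) div 2) \<beta>
     else - \<i> * sort_sign ((j + 1) div 2) \<beta>)"

lemma eps_coord:
  assumes i: "i \<in> {1..m}"
  shows "eps m i v \<beta> = (if \<beta> \<subseteq> {1..m} \<and> i \<in> \<beta> then sort_sign i \<beta> * v (\<beta> - {i}) else 0)"
proof -
  have "eps m i v \<beta> = (\<Sum>\<alpha>\<in>Pow {1..m}. fb {i} \<alpha> * (\<Sum>\<alpha>'\<in>Pow {1..m}. v \<alpha>' * wedge_basis \<alpha> \<alpha>' \<beta>))"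
    by (simp add: eps_def wedge_def lin_ext_def)
  also have "\<dots> = (\<Sum>\<alpha>\<in>Pow {1..m}. if \<alpha> = {i} then (\<Sum>\<alpha>'\<in>Pow {1..m}. v \<alpha>' * wedge_basis {i} \<alpha>' \<beta>) else 0)"
    by (intro sum.cong) (auto simp: fb_def)
  also have "\<dots> = (\<Sum>\<alpha>'\<in>Pow {1..m}. v \<alpha>' * wedge_basis {i} \<alpha>' \<beta>)"
    using i by (subst sum.delta) auto
  also have "\<dots> = (\<Sum>\<alpha>'\<in>Pow {1..m}. if \<alpha>' = \<beta> - {i} then (if i \<in> \<beta> then sort_sign i \<beta> * v (\<beta> - {i}) else 0) else 0)"
  proof (rule sum.cong[OF refl])
    fix \<alpha>' assume "\<alpha>' \<in> Pow {1..m}"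
    have c: "card {(a, b). a = i \<and> b \<in> \<beta> \<and> b \<noteq> i \<and> b < a} = card {l \<in> \<beta>. l < i}"
    proof -
      have "{(a, b). a = i \<and> b \<in> \<beta> \<and> b \<noteq> i \<and> b < a} = Pair i ` {l \<in> \<beta>. l < i}" by auto
      then show ?thesis by (simp add: card_image inj_on_def)
    qed
    show "v \<alpha>' * wedge_basis {i} \<alpha>' \<beta> = (if \<alpha>' = \<beta> - {i} then (if i \<in> \<beta> then sort_sign i \<beta> * v (\<beta> - {i}) else 0) else 0)"
    proof (cases "\<alpha>' = \<beta> - {i} \<and> i \<in> \<beta>")
      case True
      then have "wedge_basis {i} \<alpha>' \<beta> = sort_sign i \<beta>"
        using c by (auto simp: wedge_basis_def fb_def sort_sign_def insert_absorb)
      then show ?thesis using True by simp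
    next
      case False
      then have 0: "wedge_basis {i} \<alpha>' \<beta> = 0" by (auto simp: wedge_basis_def fb_def)
      from False have "\<alpha>' \<noteq> \<beta> - {i} \<or> i \<notin> \<beta>" by blast
      then show ?thesis by (elim disjE) (simp_all add: 0)
    qed
  qed
  also have "\<dots> = (if \<beta> \<subseteq> {1..m} \<and> i \<in> \<beta> then sort_sign i \<beta> * v (\<beta> - {i}) else 0)"
    using i by (subst sum.delta) auto
  finally show ?thesis .
qed

lemma iota_coord:
  assumes i: "i \<in> {1..m}"
  shows "iota m i v \<beta> = (if \<beta> \<subseteq> {1..m} \<and> i \<notin> \<beta> then sort_sign i \<beta> * v (insert i \<beta>) else 0)"
proof (cases "\<beta> \<subseteq> {1..m}")
  case True
  then have fin: "finite \<beta>" using finite_subset by blast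
  have "iota m i v \<beta> = (\<Sum>\<alpha>\<in>Pow {1..m}. if \<alpha> = insert i \<beta> then (if i \<notin> \<beta> then sort_sign i \<beta> * v (insert i \<beta>) else 0) else 0)"
    unfolding iota_def lin_ext_def
  proof (rule sum.cong[OF refl])
    fix \<alpha> assume "\<alpha> \<in> Pow {1..m}"
    show "v \<alpha> * (if i \<in> \<alpha> then \<lambda>\<beta>. (-1) ^ (card {j \<in> \<alpha>. j \<le> i} + 1) * fb (\<alpha> - {i}) \<beta> else (\<lambda>\<beta>. 0)) \<beta>
      = (if \<alpha> = insert i \<beta> then (if i \<notin> \<beta> then sort_sign i \<beta> * v (insert i \<beta>) else 0) else 0)"
    proof (cases "\<alpha> = insert i \<beta> \<and> i \<notin> \<beta>")
      case True
      have "{j \<in> insert i \<beta>. j \<le> i} = insert i {l \<in> \<beta>. l < i}" using True by (auto simp: order_le_less)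
      then have "card {j \<in> \<alpha>. j \<le> i} = card {l \<in> \<beta>. l < i} + 1" using True fin by simp
      then show ?thesis using True by (simp add: fb_def sort_sign_def)
    next
      case False
      then show ?thesis by (auto simp: fb_def)
    qed
  qed
  also have "\<dots> = (if i \<notin> \<beta> then sort_sign i \<beta> * v (insert i \<beta>) else 0)"
    using i True by (subst sum.delta) auto
  finally show ?thesis using True by simp
next
  case False
  then show ?thesis unfolding iota_def lin_ext_def by (auto intro!: sum.neutral simp: fb_def)
qed

lemma gam_coord:
  assumes j: "j \<in> {1..n}"
  shows "gam n j v \<beta> = (if \<beta> \<subseteq> {1..n div 2} then gam_coeff n j \<beta> * v (gam_index n j \<beta>) else 0)"
proof (cases "odd n \<and> j = n")
  case True
  have "gam n j v \<beta> = (\<Sum>\<alpha>\<in>Pow {1..n div 2}. v \<alpha> * (- \<i> * (-1) ^ card \<alpha> * fb \<alpha> \<beta>))"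
    using True by (simp add: gam_def Let_def lin_ext_def)
  also have "\<dots> = (\<Sum>\<alpha>\<in>Pow {1..n div 2}. if \<alpha> = \<beta> then - \<i> * (-1) ^ card \<beta> * v \<beta> else 0)"
    by (rule sum.cong) (auto simp: fb_def)
  also have "\<dots> = (if \<beta> \<subseteq> {1..n div 2} then - \<i> * (-1) ^ card \<beta> * v \<beta> else 0)"
    by (subst sum.delta) auto
  finally show ?thesis using True by (simp add: gam_coeff_def gam_index_def)
next
  case False
  define i where "i = (j + 1) div 2"
  have i: "i \<in> {1..n div 2}" using j False by (auto simp: i_def elim!: oddE evenE)
  have coeff: "gam_coeff n j \<beta> = (if odd j then (if i \<in> \<beta> then 1 else -1) * sort_sign i \<beta> else - \<i> * sort_sign i \<beta>)"
    and index: "gam_index n j \<beta> = (if i \<in> \<beta> then \<beta> - {i} else insert i \<beta>)"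
    using False unfolding gam_coeff_def gam_index_def toggle_def i_def by (simp_all only: if_False)
  show ?thesis
  proof (cases "odd j")
    case True
    then have "gam n j v \<beta> = eps (n div 2) i v \<beta> - iota (n div 2) i v \<beta>"
      using False by (auto simp: gam_def Let_def i_def)
    then show ?thesis using True unfolding eps_coord[OF i] iota_coord[OF i] coeff index by simp
  next
    case ev: False
    then have "j div 2 = i" by (simp add: i_def)
    then have "gam n j v \<beta> = - \<i> * (eps (n div 2) i v \<beta> + iota (n div 2) i v \<beta>)"
      using False ev by (auto simp: gam_def Let_def)
    then show ?thesis using ev unfolding eps_coord[OF i] iota_coord[OF i] coeff index by simp
  qed
qed

lemma toggle_simps:
  "toggle i (toggle i \<beta>) = \<beta>" "toggle i (toggle j \<beta>) = toggle j (toggle i \<beta>)"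
  "i \<in> toggle j \<beta> \<longleftrightarrow> (if i = j then i \<notin> \<beta> else i \<in> \<beta>)"
  by (auto simp: toggle_def)

lemma sort_sign_toggle:
  assumes "finite \<beta>"
  shows "sort_sign i (toggle j \<beta>) = (if j < i then - sort_sign i \<beta> else sort_sign i \<beta>)"
proof (cases "j < i")
  case False
  then have "{l \<in> toggle j \<beta>. l < i} = {l \<in> \<beta>. l < i}" by (auto simp: toggle_def)
  then show ?thesis using False by (simp add: sort_sign_def)
next
  case True
  show ?thesis
  proof (cases "j \<in> \<beta>")
    case j: True
    have "{l \<in> \<beta>. l < i} = insert j {l \<in> toggle j \<beta>. l < i}" "j \<notin> {l \<in> toggle j \<beta>. l < i}"
      using j True by (auto simp: toggle_def)
    moreover have "finite {l \<in> toggle j \<beta>. l < i}" by simp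
    ultimately have "card {l \<in> \<beta>. l < i} = Suc (card {l \<in> toggle j \<beta>. l < i})" using card_insert_disjoint by metis
    then show ?thesis using True by (simp add: sort_sign_def)
  next
    case j: False
    have "{l \<in> toggle j \<beta>. l < i} = insert j {l \<in> \<beta>. l < i}" "j \<notin> {l \<in> \<beta>. l < i}"
      using j True by (auto simp: toggle_def)
    moreover have "finite {l \<in> \<beta>. l < i}" by simp
    ultimately have "card {l \<in> toggle j \<beta>. l < i} = Suc (card {l \<in> \<beta>. l < i})" using card_insert_disjoint by metis
    then show ?thesis using True by (simp add: sort_sign_def)
  qed
qed

lemma card_toggle:
  assumes "finite \<beta>"
  shows "(-1 :: complex) ^ card (toggle j \<beta>) = - ((-1) ^ card \<beta>)"
proof (cases "j \<in> \<beta>")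
  case True
  then have "card \<beta> = Suc (card (toggle j \<beta>))"
    using card_Suc_Diff1[OF assms True] by (simp add: toggle_def)
  then show ?thesis by simp
qed (use assms in \<open>simp add: toggle_def\<close>)

lemma sort_sign_sq: "sort_sign i \<beta> * sort_sign i \<beta> = 1"
  by (simp add: sort_sign_def flip: power_add mult_2)

lemma gam_index_Pow: "j \<in> {1..n} \<Longrightarrow> \<beta> \<subseteq> {1..n div 2} \<Longrightarrow> gam_index n j \<beta> \<subseteq> {1..n div 2}"
proof -
  assume j: "j \<in> {1..n}" and b: "\<beta> \<subseteq> {1..n div 2}"
  have "(j + 1) div 2 \<in> {1..n div 2}" if "\<not> (odd n \<and> j = n)"
    using j that by (auto elim!: oddE evenE)
  then show ?thesis using b by (auto simp: gam_index_def toggle_def)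
qed

lemma gam_index_commute: "gam_index n j (gam_index n k \<beta>) = gam_index n k (gam_index n j \<beta>)" and gam_index_involution: "gam_index n j (gam_index n j \<beta>) = \<beta>"
  by (auto simp: gam_index_def toggle_simps)

lemma clifford_relation:
  assumes "finite \<beta>"
  shows "gam_coeff n j \<beta> * gam_coeff n k (gam_index n j \<beta>) + gam_coeff n k \<beta> * gam_coeff n j (gam_index n k \<beta>) = (if j = k then -2 else 0)"
proof -
  have par: "(odd j \<and> even k) \<or> (even j \<and> odd k)" if "(j + 1) div 2 = (k + 1) div 2" "j \<noteq> k"
    using that by presburger
  consider "odd n" "j = n" "k = n" | "odd n" "j = n" "k \<noteq> n" | "odd n" "k = n" "j \<noteq> n"
    | "\<not> (odd n \<and> j = n)" "\<not> (odd n \<and> k = n)" by blast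
  then show ?thesis
  proof cases
    case 1
    then show ?thesis by (simp add: gam_coeff_def gam_index_def flip: power_add mult_2)
  next
    case 2
    then show ?thesis by (simp add: gam_coeff_def gam_index_def card_toggle[OF assms])
  next
    case 3
    then show ?thesis by (simp add: gam_coeff_def gam_index_def card_toggle[OF assms])
  next
    case 4
    define a b where "a = (j + 1) div 2" and "b = (k + 1) div 2"
    have gj: "gam_coeff n j \<gamma> = (if odd j then (if a \<in> \<gamma> then 1 else -1) else - \<i>) * sort_sign a \<gamma>"
      and gk: "gam_coeff n k \<gamma> = (if odd k then (if b \<in> \<gamma> then 1 else -1) else - \<i>) * sort_sign b \<gamma>"
      and pj: "gam_index n j \<gamma> = toggle a \<gamma>" and pk: "gam_index n k \<gamma> = toggle b \<gamma>" for \<gamma>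
      using 4 by (auto simp: gam_coeff_def gam_index_def a_def b_def)
    show ?thesis
    proof (cases "a = b")
      case True
      show ?thesis
      proof (cases "j = k")
        case True
        then have kj: "k = j" by simp
        show ?thesis using sort_sign_sq[of a \<beta>] unfolding kj gj pj
          by (auto simp: toggle_simps sort_sign_toggle[OF assms])
      next
        case False
        have "(odd j \<and> even k) \<or> (even j \<and> odd k)"
          by (rule par) (use True False in \<open>simp_all add: a_def b_def\<close>)
        then show ?thesis using False unfolding gj gk pj pk True
          by (auto simp: toggle_simps sort_sign_toggle[OF assms])
      qed
    next
      case False
      then have "j \<noteq> k" by (auto simp: a_def b_def)
      then show ?thesis using False unfolding gj gk pj pk
        by (auto simp: toggle_simps sort_sign_toggle[OF assms])
    qed
  qed
qed

text \<open>
  The identity \<open>(\<Sum>\<^sub>j \<gamma>\<^sub>j \<partial>\<^sub>j)\<^sup>2 = - \<Sum>\<^sub>j \<partial>\<^sub>j\<^sup>2\<close> with an arbitrary symmetric expression \<open>B j k\<close> in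
  place of \<open>\<partial>\<^sub>j \<partial>\<^sub>k\<close>. It serves both for second derivatives of smooth functions and for second
  derivatives that have been moved to a test function.
\<close>

lemma clifford_contraction:
  fixes B :: "nat \<Rightarrow> nat \<Rightarrow> nat set \<Rightarrow> complex"
  assumes fin: "finite \<beta>" and sym: "\<And>j k \<gamma>. j \<in> {1..n} \<Longrightarrow> k \<in> {1..n} \<Longrightarrow> B j k \<gamma> = B k j \<gamma>"
  shows "(\<Sum>j=1..n. \<Sum>k=1..n. gam_coeff n j \<beta> * (gam_coeff n k (gam_index n j \<beta>) * B j k (gam_index n k (gam_index n j \<beta>)))) = - (\<Sum>j=1..n. B j j \<beta>)"
proof -
  \<comment> \<open>Symmetrize the double sum and apply the Clifford relations to the pairs.\<close>
  define A where "A j k = gam_coeff n j \<beta> * (gam_coeff n k (gam_index n j \<beta>) * B j k (gam_index n k (gam_index n j \<beta>)))" for j k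
  have "2 * (\<Sum>j=1..n. \<Sum>k=1..n. A j k) = (\<Sum>j=1..n. \<Sum>k=1..n. A j k) + (\<Sum>k=1..n. \<Sum>j=1..n. A j k)"
    by (subst (3) sum.swap) simp
  also have "\<dots> = (\<Sum>j=1..n. \<Sum>k=1..n. A j k + A k j)" by (simp only: sum.distrib)
  also have "\<dots> = (\<Sum>j=1..n. \<Sum>k=1..n. if k = j then - 2 * B j j \<beta> else 0)"
  proof (intro sum.cong refl)
    fix j k assume jk: "j \<in> {1..n}" "k \<in> {1..n}"
    have "A j k + A k j = (gam_coeff n j \<beta> * gam_coeff n k (gam_index n j \<beta>) + gam_coeff n k \<beta> * gam_coeff n j (gam_index n k \<beta>)) * B j k (gam_index n k (gam_index n j \<beta>))"
      unfolding A_def sym[OF jk(2,1)] gam_index_commute[of n j k] by (simp add: algebra_simps)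
    also have "\<dots> = (if k = j then - 2 * B j j \<beta> else 0)"
      unfolding clifford_relation[OF fin] by (simp add: gam_index_involution)
    finally show "A j k + A k j = (if k = j then - 2 * B j j \<beta> else 0)" .
  qed
  also have "\<dots> = 2 * - (\<Sum>j=1..n. B j j \<beta>)"
    by (subst sum.delta) (auto simp: sum_negf sum_distrib_left)
  finally show ?thesis unfolding A_def by simp
qed

section \<open>Null solutions of the two Dirac operators\<close>

abbreviation dirvec :: "(nat \<Rightarrow> 'n::finite) \<Rightarrow> 2 \<Rightarrow> nat \<Rightarrow> real^'n^2" where
  "dirvec idx A j \<equiv> axis A (axis (idx j) 1)"

text \<open>
  One component of \<open>\<nabla>\<^sub>A\<close>, acting on the family of scalar components of a spinor-valued function.
\<close>

definition dirac :: "nat \<Rightarrow> (nat \<Rightarrow> 'n::finite) \<Rightarrow> 2 \<Rightarrow> (nat set \<Rightarrow> real^'n^2 \<Rightarrow> complex) \<Rightarrow> nat set \<Rightarrow> real^'n^2 \<Rightarrow> complex" where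
  "dirac n idx A W \<beta> x = (\<Sum>j=1..n. gam_coeff n j \<beta> * pd (dirvec idx A j) (W (gam_index n j \<beta>)) x)"

lemma nabla_eq_dirac:
  "nabla n idx A u x \<beta> = (if \<beta> \<subseteq> {1..n div 2} then dirac n idx A (\<lambda>\<alpha> y. u y \<alpha>) \<beta> x else 0)"
  by (auto simp: nabla_def dirac_def gam_coord partial_def pd_def intro!: sum.cong sum.neutral)

lemma dirvec_Basis: "dirvec idx A j \<in> Basis"
  by (auto simp: Basis_vec_def)

lemma sum_Basis_dirvec:
  fixes F :: "real^'n::finite^2 \<Rightarrow> complex"
  assumes idx: "bij_betw idx {1..n} (UNIV :: 'n set)"
  shows "(\<Sum>b\<in>Basis. F b) = (\<Sum>A\<in>UNIV. \<Sum>j=1..n. F (dirvec idx A j))"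
proof -
  have inj: "inj_on (\<lambda>(A, j). dirvec idx A j :: real^'n^2) (UNIV \<times> {1..n})"
  proof (rule inj_onI, clarify)
    fix A A' :: 2 and j j' assume j: "j \<in> {1..n}" "j' \<in> {1..n}"
      and eq: "(dirvec idx A j :: real^'n^2) = dirvec idx A' j'"
    have "A = A' \<and> (axis (idx j) 1 :: real^'n) = axis (idx j') 1"
      using eq by (simp add: axis_eq_axis)
    then show "A = A' \<and> j = j'"
      using j inj_onD[OF bij_betw_imp_inj_on[OF idx]] by (simp add: axis_eq_axis)
  qed
  have "(Basis :: (real^'n^2) set) = (\<lambda>(A, j). dirvec idx A j) ` (UNIV \<times> {1..n})"
  proof -
    have "(Basis :: (real^'n^2) set) = (\<Union>A. \<Union>i. {axis A (axis i 1)})"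
      by (auto simp: Basis_vec_def)
    also have "\<dots> = (\<Union>A. \<Union>i\<in>idx ` {1..n}. {axis A (axis i 1)})"
      using bij_betw_imp_surj_on[OF idx] by simp
    also have "\<dots> = (\<lambda>(A, j). dirvec idx A j) ` (UNIV \<times> {1..n})" by auto
    finally show ?thesis .
  qed
  then have "(\<Sum>b\<in>Basis. F b) = (\<Sum>(A, j)\<in>UNIV \<times> {1..n}. F (dirvec idx A j))"
    using sum.reindex[OF inj, of F] by (simp add: case_prod_unfold)
  then show ?thesis by (simp add: sum.cartesian_product)
qed

text \<open>
  The monogenic functions without the condition that the odd components vanish if \<open>n\<close> is even; that
  condition is linear and is carried along separately.
\<close>

definition dirac_null :: "nat \<Rightarrow> (nat \<Rightarrow> 'n::finite) \<Rightarrow> (real^'n^2) set \<Rightarrow> (nat set \<Rightarrow> real^'n^2 \<Rightarrow> complex) \<Rightarrow> bool" where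
  "dirac_null n idx S W \<longleftrightarrow> (\<forall>\<alpha>. \<alpha> \<subseteq> {1..n div 2} \<longrightarrow> cdiff 1 S (W \<alpha>)) \<and>
     (\<forall>A \<alpha> x. \<alpha> \<subseteq> {1..n div 2} \<longrightarrow> x \<in> S \<longrightarrow> dirac n idx A W \<alpha> x = 0)"

lemma dirac_cong_open:
  assumes "open S" "x \<in> S" "\<And>\<alpha> y. y \<in> S \<Longrightarrow> W \<alpha> y = W' \<alpha> y"
  shows "dirac n idx A W \<beta> x = dirac n idx A W' \<beta> x"
  unfolding dirac_def by (intro sum.cong refl arg_cong2[where f = "(*)"] pd_cong_open[OF assms(1,2)] assms(3))

lemma DIM_pairs:
  assumes "bij_betw idx {1..n} (UNIV :: 'n::finite set)"
  shows "DIM(real^'n^2) = 2 * n"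
  using bij_betw_same_card[OF assms] by simp

lemma conv_pd_dirac:
  assumes M: "cdiff 1 UNIV M" "\<And>y. R < norm y \<Longrightarrow> M y = 0"
    and W: "\<And>\<alpha>. \<alpha> \<subseteq> {1..n div 2} \<Longrightarrow> cdiff 1 UNIV (W \<alpha>)" and b: "\<beta> \<subseteq> {1..n div 2}"
  shows "conv M (dirac n idx A W \<beta>) x = (\<Sum>j=1..n. gam_coeff n j \<beta> * conv M (pd (dirvec idx A j) (W (gam_index n j \<beta>))) x)"
proof -
  have c: "continuous_on UNIV (pd (dirvec idx A j) (W (gam_index n j \<beta>)))" if "j \<in> {1..n}" for j
    using W[OF gam_index_Pow[OF that b]] dirvec_Basis[of A idx j] by simp
  have "conv M (dirac n idx A W \<beta>) x = (\<Sum>j=1..n. conv M (\<lambda>x. gam_coeff n j \<beta> * pd (dirvec idx A j) (W (gam_index n j \<beta>)) x) x)"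
    unfolding dirac_def[abs_def]
    by (rule conv_sum_right[of M R]) (use cdiff_continuous[OF M(1)] M(2) c in \<open>auto intro!: continuous_intros\<close>)
  then show ?thesis by (simp add: conv_cmult_right)
qed

text \<open>
  \<open>C\<^sup>1\<close> solutions are weakly harmonic. For a compactly supported test function \<open>M\<close>, one of the two
  derivatives in \<open>\<partial>\<^sub>j \<partial>\<^sub>k M\<close> is moved onto the solution, and the Clifford contraction gives
  \<open>\<Delta>\<^sub>A M * W = - \<Sum>\<^sub>j \<gamma>\<^sub>j (\<partial>\<^sub>j M * \<nabla>\<^sub>A W) = 0\<close>. Testing with differences of Newton kernels gives the
  mean value property, and with it smoothness.
\<close>

lemma dirac_null_mvp:
  fixes W :: "nat set \<Rightarrow> real^'n::finite^2 \<Rightarrow> complex"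
  assumes n: "2 \<le> n" and idx: "bij_betw idx {1..n} (UNIV :: 'n set)" and S: "open S"
    and W: "dirac_null n idx S W" and b: "\<beta> \<subseteq> {1..n div 2}"
  shows "mvp S (W \<beta>)"
  unfolding mvp_def
proof (intro conjI allI impI)
  have W1: "cdiff 1 S (W \<alpha>)" if "\<alpha> \<subseteq> {1..n div 2}" for \<alpha> using W that by (simp add: dirac_null_def)
  then show "continuous_on S (W \<beta>)" using cdiff_continuous b by blast
  fix x :: "real^'n^2" and e :: real assume e: "0 < e" "cball x e \<subseteq> S"
  define k where "k = n - 1"
  have k: "1 \<le> k" and dim: "DIM(real^'n^2) = 2 * k + 2" using n DIM_pairs[OF idx] by (auto simp: k_def)
  obtain h V L where h: "cdiff 1 UNIV h" "open V" "cball x e \<subseteq> V" "compact L" "L \<subseteq> S"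
    "\<And>x. x \<in> V \<Longrightarrow> h x = 1" "\<And>x. x \<notin> L \<Longrightarrow> h x = 0"
    using cutoff_exists[OF compact_cball S e(2), of 1] by metis
  define Y where "Y \<alpha> y = (if y \<in> S then h y * W \<alpha> y else 0)" for \<alpha> y
  have Y1: "cdiff 1 UNIV (Y \<alpha>)" if "\<alpha> \<subseteq> {1..n div 2}" for \<alpha> unfolding Y_def
    by (rule cdiff_extend_zero[OF S compact_imp_closed[OF h(4)] h(5) W1[OF that] h(1) h(7)])
  have YV: "Y \<alpha> y = W \<alpha> y" if "y \<in> V" for \<alpha> y
  proof -
    have "y \<in> L" using h(6)[OF that] h(7)[of y] by force
    then show ?thesis using h(5,6) that by (auto simp: Y_def)
  qed
  have DY: "dirac n idx A Y \<gamma> y = 0" if "y \<in> cball x e" "\<gamma> \<subseteq> {1..n div 2}" for A \<gamma> y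
  proof -
    have "dirac n idx A Y \<gamma> y = dirac n idx A W \<gamma> y"
      by (rule dirac_cong_open[OF h(2)]) (use YV that(1) h(3) in auto)
    moreover have "y \<in> S" using that(1) e(2) by blast
    ultimately show ?thesis using W that(2) by (simp add: dirac_null_def)
  qed
  have "conv (mollifier e) (W \<beta>) x = conv (mollifier e) (Y \<beta>) x"
    by (rule conv_cong[of e]) (use mollifier_vanish[OF e(1)] YV h(3) in auto)
  also have "\<dots> = Y \<beta> x"
  proof (rule mvp_of_newton[OF k dim cdiff_continuous[OF Y1[OF b]] e(1)])
    fix d :: real assume d: "0 < d" "d < e"
    define M :: "real^'n^2 \<Rightarrow> complex" where "M y = newton k e y - newton k d y" for y
    have M: "cdiff 2 UNIV M" "\<And>y. e < norm y \<Longrightarrow> M y = 0"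
      unfolding M_def using newton_diff[OF d] by auto
    have M1: "cdiff 1 UNIV M" by (rule cdiff_le[OF M(1)]) simp
    have Mp: "cdiff 1 UNIV (pd c M)" if "c \<in> Basis" for c using M(1) that by (simp add: numeral_2_eq_2)
    have Mpp: "continuous_on UNIV (pd c (pd c' M))" if "c \<in> Basis" "c' \<in> Basis" for c c'
      using Mp[OF that(2)] that by simp
    note v1 = pd_vanish[of e M, OF M(2)]
    note v2 = pd_vanish[of e "pd c M" for c, OF v1]
    have "conv (Lap M) (Y \<beta>) x = (\<Sum>c\<in>Basis. conv (pd c (pd c M)) (Y \<beta>) x)"
      unfolding Lap_def[abs_def]
      by (rule conv_sum_left[of _ _ e]) (use Mpp v2 cdiff_continuous[OF Y1[OF b]] in auto)
    also have "\<dots> = (\<Sum>A\<in>UNIV. \<Sum>j=1..n. conv (pd (dirvec idx A j) (pd (dirvec idx A j) M)) (Y \<beta>) x)"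
      by (rule sum_Basis_dirvec[OF idx])
    also have "\<dots> = (\<Sum>A\<in>(UNIV :: 2 set). 0)"
    proof (rule sum.cong[OF refl])
      fix A :: 2
      define B where "B j l \<gamma> = conv (pd (dirvec idx A l) (pd (dirvec idx A j) M)) (Y \<gamma>) x" for j l \<gamma>
      have sym: "B j l \<gamma> = B l j \<gamma>" for j l \<gamma>
      proof -
        have "pd (dirvec idx A l) (pd (dirvec idx A j) M) = pd (dirvec idx A j) (pd (dirvec idx A l) M)"
          by (rule ext, rule pd_commute[OF open_UNIV UNIV_I M(1) dirvec_Basis dirvec_Basis])
        then show ?thesis by (simp add: B_def)
      qed
      have fin: "finite \<beta>" using b finite_subset by blast
      have "- (\<Sum>j=1..n. B j j \<beta>) = (\<Sum>j=1..n. \<Sum>l=1..n. gam_coeff n j \<beta> * (gam_coeff n l (gam_index n j \<beta>) * B j l (gam_index n l (gam_index n j \<beta>))))"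
        by (rule clifford_contraction[OF fin sym, symmetric])
      also have "\<dots> = (\<Sum>j=1..n. gam_coeff n j \<beta> * conv (pd (dirvec idx A j) M) (dirac n idx A Y (gam_index n j \<beta>)) x)"
      proof (rule sum.cong[OF refl])
        fix j assume j: "j \<in> {1..n}"
        have gj: "gam_index n j \<beta> \<subseteq> {1..n div 2}" by (rule gam_index_Pow[OF j b])
        have "B j l (gam_index n l (gam_index n j \<beta>)) = conv (pd (dirvec idx A j) M) (pd (dirvec idx A l) (Y (gam_index n l (gam_index n j \<beta>)))) x"
          if "l \<in> {1..n}" for l
        proof -
          have "conv (pd (dirvec idx A l) (pd (dirvec idx A j) M)) (Y (gam_index n l (gam_index n j \<beta>)))
              = conv (pd (dirvec idx A j) M) (pd (dirvec idx A l) (Y (gam_index n l (gam_index n j \<beta>))))"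
            by (rule conv_pd_swap[of _ e]) (intro Mp dirvec_Basis v1 Y1 gam_index_Pow that gj; assumption)+
          then show ?thesis by (simp add: B_def)
        qed
        moreover have "conv (pd (dirvec idx A j) M) (dirac n idx A Y (gam_index n j \<beta>)) x
          = (\<Sum>l=1..n. gam_coeff n l (gam_index n j \<beta>) * conv (pd (dirvec idx A j) M) (pd (dirvec idx A l) (Y (gam_index n l (gam_index n j \<beta>)))) x)"
          by (rule conv_pd_dirac[of _ e, OF Mp[OF dirvec_Basis] v1 Y1 gj])
        ultimately show "(\<Sum>l=1..n. gam_coeff n j \<beta> * (gam_coeff n l (gam_index n j \<beta>) * B j l (gam_index n l (gam_index n j \<beta>))))
          = gam_coeff n j \<beta> * conv (pd (dirvec idx A j) M) (dirac n idx A Y (gam_index n j \<beta>)) x"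
          by (simp add: sum_distrib_left)
      qed
      also have "\<dots> = (\<Sum>j=1..n. 0)"
      proof (rule sum.cong[OF refl])
        fix j assume j: "j \<in> {1..n}"
        have "conv (pd (dirvec idx A j) M) (dirac n idx A Y (gam_index n j \<beta>)) x = 0"
          by (rule conv_zero[of e]) (use v1 DY gam_index_Pow[OF j b] in auto)
        then show "gam_coeff n j \<beta> * conv (pd (dirvec idx A j) M) (dirac n idx A Y (gam_index n j \<beta>)) x = 0" by simp
      qed
      finally have "(\<Sum>j=1..n. B j j \<beta>) = 0" by simp
      then show "(\<Sum>j=1..n. conv (pd (dirvec idx A j) (pd (dirvec idx A j) M)) (Y \<beta>) x) = 0" by (simp add: B_def)
    qed
    finally show "conv (Lap (\<lambda>y. newton k e y - newton k d y)) (Y \<beta>) x = 0" by (simp add: M_def[abs_def])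
  qed
  also have "Y \<beta> x = W \<beta> x"
  proof (rule YV)
    have "x \<in> cball x e" using e(1) by simp
    then show "x \<in> V" using h(3) by blast
  qed
  finally show "conv (mollifier e) (W \<beta>) x = W \<beta> x" .
qed

text \<open>
  Each of the two Dirac operators alone squares to minus the Laplacian in its own group of variables. This
  is what makes Liouville's theorem on slices applicable.
\<close>

lemma dirac_null_partial_harmonic:
  fixes W :: "nat set \<Rightarrow> real^'n::finite^2 \<Rightarrow> complex"
  assumes n: "2 \<le> n" and idx: "bij_betw idx {1..n} (UNIV :: 'n set)" and S: "open S"
    and W: "dirac_null n idx S W" and b: "\<beta> \<subseteq> {1..n div 2}" and x: "x \<in> S"
  shows "(\<Sum>j=1..n. pd (dirvec idx A j) (pd (dirvec idx A j) (W \<beta>)) x) = 0"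
proof -
  have W2: "cdiff 2 S (W \<alpha>)" if "\<alpha> \<subseteq> {1..n div 2}" for \<alpha>
    by (rule mvp_cdiff[OF S dirac_null_mvp[OF n idx S W that]])
  have fin: "finite \<beta>" using b finite_subset by blast
  define B where "B j l \<gamma> = (if \<gamma> \<subseteq> {1..n div 2} then pd (dirvec idx A j) (pd (dirvec idx A l) (W \<gamma>)) x else 0)" for j l \<gamma>
  have sym: "B j l \<gamma> = B l j \<gamma>" for j l \<gamma>
    using pd_commute[OF S x W2 dirvec_Basis dirvec_Basis] by (simp add: B_def)
  have "- (\<Sum>j=1..n. B j j \<beta>) = (\<Sum>j=1..n. \<Sum>l=1..n. gam_coeff n j \<beta> * (gam_coeff n l (gam_index n j \<beta>) * B j l (gam_index n l (gam_index n j \<beta>))))"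
    by (rule clifford_contraction[OF fin sym, symmetric])
  also have "\<dots> = (\<Sum>j=1..n. gam_coeff n j \<beta> * pd (dirvec idx A j) (dirac n idx A W (gam_index n j \<beta>)) x)"
  proof (rule sum.cong[OF refl])
    fix j assume j: "j \<in> {1..n}"
    have gj: "gam_index n j \<beta> \<subseteq> {1..n div 2}" by (rule gam_index_Pow[OF j b])
    have dif: "pd (dirvec idx A l) (W (gam_index n l (gam_index n j \<beta>))) differentiable at x" if "l \<in> {1..n}" for l
      using W2[OF gam_index_Pow[OF that gj]] x dirvec_Basis[of A idx l] by (simp add: numeral_2_eq_2)
    have "pd (dirvec idx A j) (dirac n idx A W (gam_index n j \<beta>)) x
      = (\<Sum>l=1..n. pd (dirvec idx A j) (\<lambda>x. gam_coeff n l (gam_index n j \<beta>) * pd (dirvec idx A l) (W (gam_index n l (gam_index n j \<beta>))) x) x)"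
      unfolding dirac_def[abs_def] by (rule pd_sum) (use dif in auto)
    also have "\<dots> = (\<Sum>l=1..n. gam_coeff n l (gam_index n j \<beta>) * B j l (gam_index n l (gam_index n j \<beta>)))"
      by (intro sum.cong refl) (use gam_index_Pow[OF _ gj] in \<open>simp add: B_def pd_cmult[OF dif]\<close>)
    finally show "(\<Sum>l=1..n. gam_coeff n j \<beta> * (gam_coeff n l (gam_index n j \<beta>) * B j l (gam_index n l (gam_index n j \<beta>))))
      = gam_coeff n j \<beta> * pd (dirvec idx A j) (dirac n idx A W (gam_index n j \<beta>)) x" by (simp add: sum_distrib_left)
  qed
  also have "\<dots> = (\<Sum>j=1..n. 0)"
  proof (rule sum.cong[OF refl])
    fix j assume j: "j \<in> {1..n}"
    have "pd (dirvec idx A j) (dirac n idx A W (gam_index n j \<beta>)) x = 0"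
      by (rule pd_zero_open[OF S x]) (use W gam_index_Pow[OF j b] in \<open>auto simp: dirac_null_def\<close>)
    then show "gam_coeff n j \<beta> * pd (dirvec idx A j) (dirac n idx A W (gam_index n j \<beta>)) x = 0" by simp
  qed
  finally show ?thesis using b by (simp add: B_def)
qed

lemma dirac_null_Lap:
  fixes W :: "nat set \<Rightarrow> real^'n::finite^2 \<Rightarrow> complex"
  assumes n: "2 \<le> n" and idx: "bij_betw idx {1..n} (UNIV :: 'n set)" and S: "open S"
    and W: "dirac_null n idx S W" and b: "\<beta> \<subseteq> {1..n div 2}" and x: "x \<in> S"
  shows "Lap (W \<beta>) x = 0"
  unfolding Lap_def sum_Basis_dirvec[OF idx] using dirac_null_partial_harmonic[OF assms] by simp

lemma dirac_conv:
  assumes k: "continuous_on UNIV k" and W: "\<And>\<alpha>. \<alpha> \<subseteq> {1..n div 2} \<Longrightarrow> cdiff 1 UNIV (W \<alpha>)"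
    and v: "\<And>\<alpha> y. \<alpha> \<subseteq> {1..n div 2} \<Longrightarrow> R < norm y \<Longrightarrow> W \<alpha> y = 0" and b: "\<beta> \<subseteq> {1..n div 2}"
  shows "dirac n idx A (\<lambda>\<alpha>. conv k (W \<alpha>)) \<beta> x = conv k (dirac n idx A W \<beta>) x"
proof -
  have c: "continuous_on UNIV (pd (dirvec idx A j) (W (gam_index n j \<beta>)))" if "j \<in> {1..n}" for j
    using W[OF gam_index_Pow[OF that b]] dirvec_Basis[of A idx j] by simp
  have v': "pd (dirvec idx A j) (W (gam_index n j \<beta>)) y = 0" if "j \<in> {1..n}" "R < norm y" for j y
    by (rule pd_vanish[OF v[OF gam_index_Pow[OF that(1) b]] that(2)])
  have "conv k (dirac n idx A W \<beta>) x = (\<Sum>j=1..n. conv k (\<lambda>x. gam_coeff n j \<beta> * pd (dirvec idx A j) (W (gam_index n j \<beta>)) x) x)"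
    unfolding dirac_def[abs_def]
    by (rule conv_sum_right_compact[OF k, of _ _ R]) (use c v' in \<open>auto intro!: continuous_intros\<close>)
  also have "\<dots> = (\<Sum>j=1..n. gam_coeff n j \<beta> * pd (dirvec idx A j) (conv k (W (gam_index n j \<beta>))) x)"
  proof (rule sum.cong[OF refl])
    fix j assume j: "j \<in> {1..n}"
    have "pd (dirvec idx A j) (conv k (W (gam_index n j \<beta>))) = conv k (pd (dirvec idx A j) (W (gam_index n j \<beta>)))"
      by (rule cdiff_conv_compact_right(2)[OF k v[OF gam_index_Pow[OF j b]] W[OF gam_index_Pow[OF j b]]]) auto
    then show "conv k (\<lambda>x. gam_coeff n j \<beta> * pd (dirvec idx A j) (W (gam_index n j \<beta>)) x) x
        = gam_coeff n j \<beta> * pd (dirvec idx A j) (conv k (W (gam_index n j \<beta>))) x" by (simp add: conv_cmult_right)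
  qed
  finally show ?thesis by (simp add: dirac_def)
qed

text \<open>
  Components with index outside \<open>Pow {1..n div 2}\<close> never enter the Dirac operators.
\<close>

lemma dirac_cong_carrier:
  assumes "open S" "x \<in> S" "\<beta> \<subseteq> {1..n div 2}" "\<And>\<alpha> y. \<alpha> \<subseteq> {1..n div 2} \<Longrightarrow> y \<in> S \<Longrightarrow> W \<alpha> y = W' \<alpha> y"
  shows "dirac n idx A W \<beta> x = dirac n idx A W' \<beta> x"
  unfolding dirac_def
  by (intro sum.cong refl arg_cong2[where f = "(*)"] pd_cong_open[OF assms(1,2)] assms(4) gam_index_Pow assms(3))

lemma cdiff_dirac:
  assumes "open S" "\<And>\<alpha>. \<alpha> \<subseteq> {1..n div 2} \<Longrightarrow> cdiff (Suc m) S (W \<alpha>)" "\<beta> \<subseteq> {1..n div 2}"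
  shows "cdiff m S (dirac n idx A W \<beta>)"
  unfolding dirac_def[abs_def]
  by (intro cdiff_sum cdiff_cmult assms(1) cdiff_pd[OF assms(2)] gam_index_Pow assms(3) dirvec_Basis)

lemma dirac_diff:
  assumes "\<And>\<alpha>. \<alpha> \<subseteq> {1..n div 2} \<Longrightarrow> V \<alpha> differentiable at x"
    "\<And>\<alpha>. \<alpha> \<subseteq> {1..n div 2} \<Longrightarrow> W \<alpha> differentiable at x" "\<beta> \<subseteq> {1..n div 2}"
  shows "dirac n idx A (\<lambda>\<alpha> x. V \<alpha> x - W \<alpha> x) \<beta> x = dirac n idx A V \<beta> x - dirac n idx A W \<beta> x"
proof -
  have "pd (dirvec idx A j) (\<lambda>x. V (gam_index n j \<beta>) x - W (gam_index n j \<beta>) x) x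
     = pd (dirvec idx A j) (V (gam_index n j \<beta>)) x - pd (dirvec idx A j) (W (gam_index n j \<beta>)) x" if "j \<in> {1..n}" for j
    by (rule pd_diff[OF assms(1,2)]) (use gam_index_Pow[OF that assms(3)] in auto)
  then show ?thesis by (simp add: dirac_def right_diff_distrib sum_subtractf)
qed

lemma dirac_cmult:
  assumes "\<And>\<alpha>. \<alpha> \<subseteq> {1..n div 2} \<Longrightarrow> W \<alpha> differentiable at x" "\<beta> \<subseteq> {1..n div 2}"
  shows "dirac n idx A (\<lambda>\<alpha> x. c * W \<alpha> x) \<beta> x = c * dirac n idx A W \<beta> x"
proof -
  have "pd (dirvec idx A j) (\<lambda>x. c * W (gam_index n j \<beta>) x) x = c * pd (dirvec idx A j) (W (gam_index n j \<beta>)) x"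
    if "j \<in> {1..n}" for j
    by (rule pd_cmult[OF assms(1)]) (use gam_index_Pow[OF that assms(2)] in auto)
  then show ?thesis by (simp add: dirac_def sum_distrib_left algebra_simps)
qed

lemma dirac_Lap_commute:
  assumes S: "open S" "x \<in> S" and W: "\<And>\<alpha>. \<alpha> \<subseteq> {1..n div 2} \<Longrightarrow> cdiff 3 S (W \<alpha>)" and b: "\<beta> \<subseteq> {1..n div 2}"
  shows "dirac n idx A (\<lambda>\<alpha>. Lap (W \<alpha>)) \<beta> x = Lap (dirac n idx A W \<beta>) x"
proof -
  have W': "cdiff 2 S (pd (dirvec idx A j) (W (gam_index n j \<beta>)))" if "j \<in> {1..n}" for j
    by (rule cdiff_pd[OF _ dirvec_Basis]) (use W[OF gam_index_Pow[OF that b]] in \<open>simp add: numeral_3_eq_3 numeral_2_eq_2\<close>)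
  have "Lap (dirac n idx A W \<beta>) x = (\<Sum>j=1..n. gam_coeff n j \<beta> * Lap (pd (dirvec idx A j) (W (gam_index n j \<beta>))) x)"
    unfolding dirac_def[abs_def] by (rule Lap_sum[OF S W'])
  then show ?thesis unfolding dirac_def
    using pd_Lap_commute[OF S W[OF gam_index_Pow[OF _ b]] dirvec_Basis] by simp
qed

lemma dirac_null_subset: "dirac_null n idx T W \<Longrightarrow> S \<subseteq> T \<Longrightarrow> dirac_null n idx S W"
  unfolding dirac_null_def by (meson cdiff_subset subsetD)

lemma dirac_null_diff:
  assumes S: "open S" and V: "dirac_null n idx S V" and W: "dirac_null n idx S W"
  shows "dirac_null n idx S (\<lambda>\<alpha> x. V \<alpha> x - W \<alpha> x)"
  unfolding dirac_null_def
proof (intro conjI allI impI)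
  have c: "cdiff 1 S (V \<alpha>)" "cdiff 1 S (W \<alpha>)" if "\<alpha> \<subseteq> {1..n div 2}" for \<alpha>
    using V W that by (auto simp: dirac_null_def)
  show "cdiff 1 S (\<lambda>x. V \<alpha> x - W \<alpha> x)" if "\<alpha> \<subseteq> {1..n div 2}" for \<alpha>
    by (rule cdiff_diff[OF S c[OF that]])
  show "dirac n idx A (\<lambda>\<alpha> x. V \<alpha> x - W \<alpha> x) \<alpha> x = 0" if "\<alpha> \<subseteq> {1..n div 2}" "x \<in> S" for A \<alpha> x
    by (subst dirac_diff)
       (use V W that cdiff_differentiable[OF c(1) _ that(2)] cdiff_differentiable[OF c(2) _ that(2)]
        in \<open>auto simp: dirac_null_def\<close>)
qed

section \<open>The extension\<close>

text \<open>
  The cut-off function solves the extension problem up to a correction \<open>v\<close> that decays at infinity. With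
  \<open>\<Phi> = (1 - h) W\<close> near \<open>K\<close>, extended by zero across \<open>K\<close>, the functions
  \<open>f\<^sub>A = \<nabla>\<^sub>A \<Phi>\<close> and \<open>g = \<Delta>\<Phi>\<close> have compact support, because \<open>W\<close> solves both equations wherever
  \<open>h\<close> vanishes. As differential operators with constant coefficients commute,
  \<open>\<nabla>\<^sub>A g = \<Delta> f\<^sub>A\<close>, and so the Newton potential \<open>v\<close> of \<open>g\<close> satisfies
  \<open>\<nabla>\<^sub>A v = f\<^sub>A\<close> for both \<open>A\<close> at once, although the system is overdetermined. With the regularized kernel the right-hand side is the mollification of
  \<open>f\<^sub>A\<close>, and therefore \<open>\<Phi>\<close> has to be mollified as well; away from the support of \<open>h\<close> the mean
  value property makes this invisible.
\<close>

lemma extension_modulo_decaying: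
  fixes W :: "nat set \<Rightarrow> real^'n::finite^2 \<Rightarrow> complex"
  assumes n: "2 \<le> n" and idx: "bij_betw idx {1..n} (UNIV :: 'n set)"
    and \<Omega>: "open \<Omega>" and K: "compact K" "K \<subseteq> \<Omega>" "K \<noteq> {}" and W: "dirac_null n idx (\<Omega> - K) W"
  obtains C U v where "compact C" "K \<subseteq> C" "C \<subseteq> \<Omega>" "dirac_null n idx \<Omega> U" "dirac_null n idx (- C) v"
    "\<And>\<alpha> x. \<alpha> \<subseteq> {1..n div 2} \<Longrightarrow> x \<in> \<Omega> - C \<Longrightarrow> U \<alpha> x = W \<alpha> x - v \<alpha> x"
    "\<And>\<alpha> e. \<alpha> \<subseteq> {1..n div 2} \<Longrightarrow> 0 < e \<Longrightarrow> \<exists>R. \<forall>x. R < norm x \<longrightarrow> norm (v \<alpha> x) < e"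
    "\<And>\<alpha>. (\<And>x. x \<in> \<Omega> - K \<Longrightarrow> W \<alpha> x = 0) \<Longrightarrow> (\<And>x. x \<in> \<Omega> \<Longrightarrow> U \<alpha> x = 0)"
proof -
  let ?Q = "{1..n div 2}"
  define S where "S = \<Omega> - K"
  have S: "open S" unfolding S_def using \<Omega> K(1) by (simp add: compact_imp_closed open_Diff)
  note WS = W[folded S_def]
  have Wm: "mvp S (W \<alpha>)" if "\<alpha> \<subseteq> ?Q" for \<alpha> by (rule dirac_null_mvp[OF n idx S WS that])
  have W3: "cdiff 3 S (W \<alpha>)" if "\<alpha> \<subseteq> ?Q" for \<alpha> by (rule mvp_cdiff[OF S Wm[OF that]])
  define k where "k = n - 1"
  have k: "1 \<le> k" and dim: "DIM(real^'n^2) = 2 * k + 2" using n DIM_pairs[OF idx] by (auto simp: k_def)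
  obtain T where T: "T \<noteq> 0" "\<And>e (y::real^'n^2). 0 < e \<Longrightarrow> Lap (newton k e) y = T * mollifier e y"
    using Lap_newton[OF k dim] by blast
  obtain h V L where h: "cdiff 3 UNIV h" "open V" "K \<subseteq> V" "compact L" "L \<subseteq> \<Omega>"
    "\<And>x. x \<in> V \<Longrightarrow> h x = 1" "\<And>x. x \<notin> L \<Longrightarrow> h x = 0"
    using cutoff_exists[OF K(1) \<Omega> K(2), of 3] by metis
  \<comment> \<open>The second cut-off function only makes \<open>\<Phi>\<close> compactly supported; all that counts happens in
      \<open>V'\<close>, where it is one.\<close>
  obtain h' V' L' where h': "cdiff 3 UNIV h'" "open V'" "L \<subseteq> V'" "compact L'" "L' \<subseteq> \<Omega>"
    "\<And>x. x \<in> V' \<Longrightarrow> h' x = 1" "\<And>x. x \<notin> L' \<Longrightarrow> h' x = 0"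
    using cutoff_exists[OF h(4) \<Omega> h(5), of 3] by metis
  have VL: "V \<subseteq> L" using h(6,7) by force
  have VL': "V' \<subseteq> L'" using h'(6,7) by force
  have KL: "K \<subseteq> L" "L \<noteq> {}" using h(3) VL K(3) by auto
  have cL: "closed L" and oL: "open (- L)" using h(4) compact_imp_closed by (auto simp: open_Compl)
  define \<Phi> where "\<Phi> \<alpha> x = (if x \<in> S then (1 - h x) * h' x * W \<alpha> x else 0)" for \<alpha> x
  have \<Phi>3: "cdiff 3 UNIV (\<Phi> \<alpha>)" if "\<alpha> \<subseteq> ?Q" for \<alpha> unfolding \<Phi>_def
  proof (rule cdiff_extend_zero[OF S _ _ W3[OF that]])
    show "closed (L' - V)" using h'(4) h(2) by (simp add: compact_imp_closed closed_Diff)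
    show "L' - V \<subseteq> S" using h'(5) h(3) by (auto simp: S_def)
    show "cdiff 3 UNIV (\<lambda>x. (1 - h x) * h' x)" by (intro cdiff_mult cdiff_diff cdiff_const open_UNIV h h')
    show "(1 - h x) * h' x = 0" if "x \<notin> L' - V" for x using that h(6) h'(7) by force
  qed
  have VS: "V' - L \<subseteq> S" using VL' h'(5) KL by (auto simp: S_def)
  have oVL: "open (V' - L)" using h'(2) cL by (rule open_Diff)
  have \<Phi>W: "\<Phi> \<alpha> y = W \<alpha> y" if "y \<in> V' - L" for \<alpha> y
    using that VS h(7) h'(6) by (auto simp: \<Phi>_def)
  obtain R where R: "\<And>x. x \<in> L' \<Longrightarrow> norm x \<le> R" using compact_imp_bounded[OF h'(4)] bounded_iff by metis
  have \<Phi>R: "\<Phi> \<alpha> y = 0" if "R < norm y" for \<alpha> y using h'(7)[of y] R[of y] that by (force simp: \<Phi>_def)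
  \<comment> \<open>On \<open>V' - L\<close> both \<open>\<Delta>\<Phi>\<close> and \<open>\<nabla>\<^sub>A \<Phi>\<close> vanish, since there \<open>\<Phi> = W\<close>; so their
      extensions by zero are smooth.\<close>
  define g where "g \<alpha> x = (if x \<in> V' then Lap (\<Phi> \<alpha>) x else 0)" for \<alpha> x
  define f where "f A \<beta> x = (if x \<in> V' then dirac n idx A \<Phi> \<beta> x else 0)" for A \<beta> x
  have gL: "g \<alpha> x = 0" if "x \<notin> L" "\<alpha> \<subseteq> ?Q" for \<alpha> x
  proof (cases "x \<in> V'")
    case True
    then have x: "x \<in> V' - L" using that by simp
    have "Lap (\<Phi> \<alpha>) x = Lap (W \<alpha>) x" by (rule Lap_cong_open[OF oVL x \<Phi>W])
    also have "\<dots> = 0" by (rule dirac_null_Lap[OF n idx S WS that(2)]) (use x VS in blast)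
    finally show ?thesis by (simp add: g_def)
  qed (simp add: g_def)
  have fL: "f A \<beta> x = 0" if "x \<notin> L" "\<beta> \<subseteq> ?Q" for A \<beta> x
  proof (cases "x \<in> V'")
    case True
    then have x: "x \<in> V' - L" using that by simp
    have "dirac n idx A \<Phi> \<beta> x = dirac n idx A W \<beta> x" by (rule dirac_cong_open[OF oVL x \<Phi>W])
    also have "\<dots> = 0" using WS that(2) x VS by (auto simp: dirac_null_def)
    finally show ?thesis by (simp add: f_def)
  qed (simp add: f_def)
  have cover: "V' \<union> - L = UNIV" using h'(3) by blast
  have g1: "cdiff 1 UNIV (g \<alpha>)" if "\<alpha> \<subseteq> ?Q" for \<alpha>
  proof -
    have "cdiff 1 V' (Lap (\<Phi> \<alpha>))"
      by (rule cdiff_subset[OF cdiff_Lap[OF open_UNIV]]) (use \<Phi>3[OF that] in \<open>auto simp: numeral_3_eq_3\<close>)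
    then have 1: "cdiff 1 V' (g \<alpha>)"
      by (rule cdiff_cong[OF h'(2), THEN iffD1, rotated]) (simp add: g_def)
    have 2: "cdiff 1 (- L) (g \<alpha>)"
      by (rule cdiff_cong[OF oL, THEN iffD2, OF _ cdiff_const[of _ _ 0]]) (use gL[OF _ that] in simp)
    show ?thesis using cdiff_Un[OF h'(2) oL 1 2] cover by simp
  qed
  have f2: "cdiff 2 UNIV (f A \<beta>)" if "\<beta> \<subseteq> ?Q" for A \<beta>
  proof -
    have "cdiff (Suc 2) UNIV (\<Phi> \<alpha>)" if "\<alpha> \<subseteq> ?Q" for \<alpha> using \<Phi>3[OF that] by (simp add: numeral_3_eq_3 numeral_2_eq_2)
    then have "cdiff 2 V' (dirac n idx A \<Phi> \<beta>)"
      by (intro cdiff_subset[OF cdiff_dirac[OF open_UNIV _ that]]) auto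
    then have 1: "cdiff 2 V' (f A \<beta>)"
      by (rule cdiff_cong[OF h'(2), THEN iffD1, rotated]) (simp add: f_def)
    have 2: "cdiff 2 (- L) (f A \<beta>)"
      by (rule cdiff_cong[OF oL, THEN iffD2, OF _ cdiff_const[of _ _ 0]]) (use fL[OF _ that] in simp)
    show ?thesis using cdiff_Un[OF h'(2) oL 1 2] cover by simp
  qed
  have gR: "g \<alpha> y = 0" if "R < norm y" "\<alpha> \<subseteq> ?Q" for \<alpha> y
    using gL[OF _ that(2)] h'(3) VL' R[of y] that by force
  have fR: "f A \<beta> y = 0" if "R < norm y" "\<beta> \<subseteq> ?Q" for A \<beta> y
    using fL[OF _ that(2)] h'(3) VL' R[of y] that by force
  have compat: "dirac n idx A g \<beta> x = Lap (f A \<beta>) x" if b: "\<beta> \<subseteq> ?Q" for A \<beta> x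
  proof (cases "x \<in> V'")
    case True
    have "dirac n idx A g \<beta> x = dirac n idx A (\<lambda>\<alpha>. Lap (\<Phi> \<alpha>)) \<beta> x"
      by (rule dirac_cong_open[OF h'(2) True]) (simp add: g_def)
    also have "\<dots> = Lap (dirac n idx A \<Phi> \<beta>) x" by (rule dirac_Lap_commute[OF open_UNIV UNIV_I \<Phi>3 b])
    also have "\<dots> = Lap (f A \<beta>) x" by (rule Lap_cong_open[OF h'(2) True]) (simp add: f_def)
    finally show ?thesis .
  next
    case False
    then have x: "x \<in> - L" using h'(3) by blast
    have "dirac n idx A g \<beta> x = 0"
      unfolding dirac_def
    proof (intro sum.neutral ballI)
      fix j assume "j \<in> {1..n}"
      then have "pd (dirvec idx A j) (g (gam_index n j \<beta>)) x = 0"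
        by (intro pd_zero_open[OF oL x] gL gam_index_Pow b) auto
      then show "gam_coeff n j \<beta> * pd (dirvec idx A j) (g (gam_index n j \<beta>)) x = 0" by simp
    qed
    moreover have "Lap (f A \<beta>) x = 0"
      using Lap_cong_open[OF oL x, of "f A \<beta>" "\<lambda>_. 0"] fL[OF _ b] by simp
    ultimately show ?thesis by simp
  qed
  obtain e' where e': "0 < e'" "{x. infdist x L \<le> e'} \<subseteq> V'"
    using compact_in_open_separated[OF KL(2) h(4) h'(2,3)] by blast
  \<comment> \<open>Balls of radius \<open>e\<close> around points at distance less than \<open>2 e\<close> from \<open>L\<close> lie in
      \<open>V'\<close>.\<close>
  define e where "e = e' / 3"
  have e: "0 < e" "\<And>x. infdist x L \<le> 3 * e \<Longrightarrow> x \<in> V'" using e' by (auto simp: e_def)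
  note m = continuous_mollifier[OF e(1), where 'a="real^'n^2"]
  note m0 = mollifier_vanish[OF e(1), where 'a="real^'n^2"]
  have cN: "continuous_on UNIV (newton k e :: real^'n^2 \<Rightarrow> complex)"
    using cdiff_continuous[OF cdiff_newton[OF e(1)]] .
  define v where "v \<alpha> x = (1 / T) * conv (newton k e) (g \<alpha>) x" for \<alpha> x
  have Ng: "cdiff 1 UNIV (conv (newton k e) (g \<alpha>))" if "\<alpha> \<subseteq> ?Q" for \<alpha>
    by (rule cdiff_conv_compact_right(1)[OF cN gR g1]) (use that in auto)
  have v1: "cdiff 1 UNIV (v \<alpha>)" if "\<alpha> \<subseteq> ?Q" for \<alpha>
    unfolding v_def by (rule cdiff_cmult[OF open_UNIV Ng[OF that]])
  have Dv: "dirac n idx A v \<beta> x = conv (mollifier e) (f A \<beta>) x" if b: "\<beta> \<subseteq> ?Q" for A \<beta> x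
  proof -
    have "dirac n idx A v \<beta> x = (1 / T) * dirac n idx A (\<lambda>\<alpha>. conv (newton k e) (g \<alpha>)) \<beta> x"
      unfolding v_def by (rule dirac_cmult[OF cdiff_differentiable[OF Ng] b]) auto
    also have "dirac n idx A (\<lambda>\<alpha>. conv (newton k e) (g \<alpha>)) \<beta> x = conv (newton k e) (dirac n idx A g \<beta>) x"
      by (rule dirac_conv[OF cN g1 gR b])
    also have "dirac n idx A g \<beta> = Lap (f A \<beta>)" using compat[OF b] by auto
    also have "conv (newton k e) (Lap (f A \<beta>)) x = T * conv (mollifier e) (f A \<beta>) x"
      by (rule conv_newton_Lap[OF e(1) T(2)[OF e(1)] f2[OF b] fR]) (use b in auto)
    finally show ?thesis using T(1) by simp
  qed
  have inf_ball: "infdist y L \<le> infdist x L + e" "infdist x L \<le> infdist y L + e" if "y \<in> cball x e" for x y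
    using infdist_triangle[of y L x] infdist_triangle[of x L y] that by (auto simp: dist_commute)
  define C where "C = {x. infdist x L \<le> e}"
  have C: "compact C" "L \<subseteq> C" "C \<subseteq> \<Omega>"
    unfolding C_def using compact_infdist_le[OF KL(2) h(4) e(1)] e VL' h'(5) by force+
  have oC: "open (- C)" using C(1) by (simp add: compact_imp_closed open_Compl)
  have fC: "conv (mollifier e) (f A \<beta>) x = 0" if "x \<notin> C" "\<beta> \<subseteq> ?Q" for A \<beta> x
  proof (rule conv_zero[of e, OF m0])
    fix z assume "z \<in> cball x e"
    then have "z \<notin> L" using inf_ball(2)[of z x] that(1) e(1) by (auto simp: C_def)
    then show "f A \<beta> z = 0" using fL that by blast
  qed
  define R1 where "R1 = {x. infdist x L < 2 * e}"
  define R2 where "R2 = \<Omega> - C"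
  have R12: "open R1" "open R2" "\<Omega> \<subseteq> R1 \<union> R2" "R2 \<subseteq> S"
    unfolding R1_def R2_def S_def using e(1) \<Omega> C KL(1)
    by (auto intro!: open_Collect_less continuous_intros open_Diff compact_imp_closed simp: C_def)
  have R1V: "cball x e \<subseteq> V'" if "x \<in> R1" for x
  proof
    fix z assume "z \<in> cball x e"
    then have "infdist z L \<le> 3 * e" using inf_ball(1)[of z x] that by (auto simp: R1_def)
    then show "z \<in> V'" by (rule e(2))
  qed
  \<comment> \<open>On the overlap of \<open>R1\<close> and \<open>R2\<close> the mollification of \<open>\<Phi>\<close> is that of \<open>W\<close>, that is
      \<open>W\<close> itself.\<close>
  define U where "U \<alpha> x = (if x \<in> R1 then conv (mollifier e) (\<Phi> \<alpha>) x else W \<alpha> x) - v \<alpha> x" for \<alpha> x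
  have U1: "U \<alpha> x = conv (mollifier e) (\<Phi> \<alpha>) x - v \<alpha> x" if "x \<in> R1" for \<alpha> x using that by (simp add: U_def)
  have U2: "U \<alpha> x = W \<alpha> x - v \<alpha> x" if "x \<in> R2" "\<alpha> \<subseteq> ?Q" for \<alpha> x
  proof (cases "x \<in> R1")
    case True
    have sub: "cball x e \<subseteq> V' - L"
    proof
      fix z assume z: "z \<in> cball x e"
      then have "z \<notin> L" using inf_ball(2)[of z x] that(1) e(1) by (auto simp: R2_def C_def)
      then show "z \<in> V' - L" using R1V[OF True] z by blast
    qed
    have "conv (mollifier e) (\<Phi> \<alpha>) x = conv (mollifier e) (W \<alpha>) x"
      by (rule conv_cong[of e, OF m0]) (use sub \<Phi>W in auto)
    also have "\<dots> = W \<alpha> x" using Wm[OF that(2)] e(1) sub VS unfolding mvp_def by (meson order_trans)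
    finally show ?thesis using True by (simp add: U_def)
  qed (simp add: U_def)
  have \<Phi>1: "cdiff 1 UNIV (\<Phi> \<alpha>)" if "\<alpha> \<subseteq> ?Q" for \<alpha> by (rule cdiff_le[OF \<Phi>3[OF that]]) simp
  have m\<Phi>: "cdiff 1 UNIV (conv (mollifier e) (\<Phi> \<alpha>))" if "\<alpha> \<subseteq> ?Q" for \<alpha>
    by (rule cdiff_conv[OF m m0 \<Phi>1[OF that]])
  have null_U: "dirac_null n idx \<Omega> U"
    unfolding dirac_null_def
  proof (intro conjI allI impI)
    fix \<alpha> assume a: "\<alpha> \<subseteq> ?Q"
    have "cdiff 1 R1 (\<lambda>x. conv (mollifier e) (\<Phi> \<alpha>) x - v \<alpha> x)"
      by (intro cdiff_diff R12 cdiff_subset[OF m\<Phi>[OF a]] cdiff_subset[OF v1[OF a]]) auto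
    then have 1: "cdiff 1 R1 (U \<alpha>)"
      by (rule cdiff_cong[OF R12(1), THEN iffD1, rotated]) (simp add: U1)
    have W1: "cdiff 1 S (W \<alpha>)" using WS a by (simp add: dirac_null_def)
    have "cdiff 1 R2 (\<lambda>x. W \<alpha> x - v \<alpha> x)"
      by (intro cdiff_diff R12 cdiff_subset[OF W1] cdiff_subset[OF v1[OF a]]) auto
    then have 2: "cdiff 1 R2 (U \<alpha>)"
      by (rule cdiff_cong[OF R12(2), THEN iffD1, rotated]) (simp only: U2[OF _ a])
    show "cdiff 1 \<Omega> (U \<alpha>)" by (rule cdiff_subset[OF cdiff_Un[OF R12(1,2) 1 2] R12(3)])
  next
    fix A \<beta> x assume b: "\<beta> \<subseteq> ?Q" and x: "x \<in> \<Omega>"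
    show "dirac n idx A U \<beta> x = 0"
    proof (cases "x \<in> R1")
      case True
      have "dirac n idx A U \<beta> x = dirac n idx A (\<lambda>\<alpha> x. conv (mollifier e) (\<Phi> \<alpha>) x - v \<alpha> x) \<beta> x"
        by (rule dirac_cong_open[OF R12(1) True U1])
      also have "\<dots> = dirac n idx A (\<lambda>\<alpha>. conv (mollifier e) (\<Phi> \<alpha>)) \<beta> x - dirac n idx A v \<beta> x"
        by (rule dirac_diff[OF cdiff_differentiable[OF m\<Phi>] cdiff_differentiable[OF v1] b]) auto
      also have "dirac n idx A (\<lambda>\<alpha>. conv (mollifier e) (\<Phi> \<alpha>)) \<beta> x = conv (mollifier e) (dirac n idx A \<Phi> \<beta>) x"
        by (rule dirac_conv[OF m \<Phi>1 \<Phi>R b])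
      also have "\<dots> = conv (mollifier e) (f A \<beta>) x"
        by (rule conv_cong[of e, OF m0]) (use R1V[OF True] in \<open>auto simp: f_def\<close>)
      also have "dirac n idx A v \<beta> x = conv (mollifier e) (f A \<beta>) x" by (rule Dv[OF b])
      finally show ?thesis by simp
    next
      case False
      then have x2: "x \<in> R2" using x R12(3) by blast
      have W1: "cdiff 1 S (W \<alpha>)" if "\<alpha> \<subseteq> ?Q" for \<alpha> using WS that by (simp add: dirac_null_def)
      have xS: "x \<in> S" using x2 R12 by blast
      have "dirac n idx A U \<beta> x = dirac n idx A (\<lambda>\<alpha> x. W \<alpha> x - v \<alpha> x) \<beta> x"
        by (rule dirac_cong_carrier[OF R12(2) x2 b U2])
      also have "\<dots> = dirac n idx A W \<beta> x - dirac n idx A v \<beta> x"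
        by (rule dirac_diff[OF cdiff_differentiable[OF W1] cdiff_differentiable[OF v1] b]) (use xS in auto)
      also have "\<dots> = 0" using WS b xS Dv[OF b] fC[OF _ b] x2 by (simp add: dirac_null_def R2_def)
      finally show ?thesis .
    qed
  qed
  show thesis
  proof (rule that[of C U v])
    show "compact C" "K \<subseteq> C" "C \<subseteq> \<Omega>" using C KL by auto
    show "dirac_null n idx \<Omega> U" by (rule null_U)
    show "dirac_null n idx (- C) v"
      using cdiff_subset[OF v1] Dv fC by (auto simp: dirac_null_def simp del: cdiff.simps One_nat_def)
    show "U \<alpha> x = W \<alpha> x - v \<alpha> x" if "\<alpha> \<subseteq> ?Q" "x \<in> \<Omega> - C" for \<alpha> x
      using U2 that by (simp add: R2_def)
    show "\<exists>R. \<forall>x. R < norm x \<longrightarrow> norm (v \<alpha> x) < d" if a: "\<alpha> \<subseteq> ?Q" and d: "0 < d" for \<alpha> d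
    proof -
      have "0 < d * norm T" using d T(1) by simp
      then obtain R' where R': "\<And>x. R' < norm x \<Longrightarrow> norm (conv (newton k e) (g \<alpha>) x) < d * norm T"
        using conv_newton_decay[OF k e(1) cdiff_continuous[OF g1[OF a]] gR[OF _ a]] by blast
      have "norm (v \<alpha> x) < d" if "R' < norm x" for x
        using R'[OF that] T(1) by (simp add: v_def norm_mult norm_divide divide_less_eq)
      then show ?thesis by blast
    qed
    show "U \<alpha> x = 0" if z: "\<And>x. x \<in> \<Omega> - K \<Longrightarrow> W \<alpha> x = 0" and x: "x \<in> \<Omega>" for \<alpha> x
    proof -
      have \<Phi>0: "\<Phi> \<alpha> = (\<lambda>_. 0)" using z by (auto simp: \<Phi>_def S_def)
      then have g0: "g \<alpha> = (\<lambda>_. 0)" by (auto simp: g_def)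
      have "v \<alpha> x = 0" by (simp add: v_def g0 conv_def)
      moreover have "conv (mollifier e) (\<Phi> \<alpha>) x = 0" by (simp add: \<Phi>0 conv_def)
      moreover have "W \<alpha> x = 0" if "x \<notin> R1"
        using z[of x] that x R12(3,4) by (auto simp: S_def)
      ultimately show ?thesis by (simp add: U_def)
    qed
  qed
qed

text \<open>
  Every slice on which \<open>x\<^sub>1\<close> is fixed and \<open>x\<^sub>0\<close> is free lies entirely in the half space if it
  meets it at all, since the half space is defined by a coordinate of \<open>x\<^sub>1\<close>. The restriction of
  \<open>v\<close> to the slice is harmonic in \<open>x\<^sub>0\<close> and decays.
\<close>

lemma decaying_dirac_null_halfspace:
  fixes v :: "nat set \<Rightarrow> real^'n::finite^2 \<Rightarrow> complex"
  assumes n: "2 \<le> n" and idx: "bij_betw idx {1..n} (UNIV :: 'n set)"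
    and v: "dirac_null n idx {x. M < x $ 1 $ i} v" and b: "\<beta> \<subseteq> {1..n div 2}"
    and decay: "\<And>e. 0 < e \<Longrightarrow> \<exists>R. \<forall>x. R < norm x \<longrightarrow> norm (v \<beta> x) < e" and p: "M < p $ 1 $ i"
  shows "v \<beta> p = 0"
proof -
  define H :: "(real^'n^2) set" where "H = {x. M < x $ 1 $ i}"
  have H: "open H" unfolding H_def by (intro open_Collect_less continuous_intros)
  note vH = v[folded H_def]
  define B where "B = (\<lambda>j. dirvec idx 0 j :: real^'n^2) ` {1..n}"
  have inj: "inj_on (\<lambda>j. dirvec idx 0 j :: real^'n^2) {1..n}"
    using inj_onD[OF bij_betw_imp_inj_on[OF idx]] by (intro inj_onI) (simp add: axis_eq_axis)
  have ax: "axis 1 (axis i 1) \<in> (Basis :: (real^'n^2) set) - B"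
    by (auto simp: B_def Basis_vec_def axis_eq_axis)
  show ?thesis
  proof (rule decaying_slice_harmonic_zero[OF _ _ H])
    show "B \<subseteq> Basis" using dirvec_Basis by (auto simp: B_def)
    show "B \<noteq> {}" using n by (simp add: B_def)
    show "cdiff 2 H (v \<beta>)" by (rule mvp_cdiff[OF H dirac_null_mvp[OF n idx H vH b]])
    show "{x. \<forall>b\<in>Basis - B. x \<bullet> b = p \<bullet> b} \<subseteq> H"
    proof
      fix x assume "x \<in> {x. \<forall>b\<in>Basis - B. x \<bullet> b = p \<bullet> b}"
      then have "x \<bullet> axis 1 (axis i 1) = p \<bullet> axis 1 (axis i 1)" using ax by blast
      then show "x \<in> H" using p by (simp add: H_def inner_axis)
    qed
    show "(\<Sum>b\<in>B. pd b (pd b (v \<beta>)) x) = 0" if "x \<in> H" for x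
      unfolding B_def sum.reindex[OF inj]
      using dirac_null_partial_harmonic[OF n idx H vH b that, of 0] by simp
  qed (rule decay)
qed

text \<open>
  Take a point \<open>q\<close> of the compact set \<open>C\<close> where a coordinate of \<open>x\<^sub>1\<close> is maximal. Beyond it the
  correction vanishes, so the extension agrees with \<open>W\<close> on a nonempty open part of
  \<open>\<Omega> - C\<close> near \<open>q\<close>, and hence on all of the connected set \<open>\<Omega> - K\<close>.
\<close>

lemma dirac_null_hartogs:
  fixes W :: "nat set \<Rightarrow> real^'n::finite^2 \<Rightarrow> complex"
  assumes n: "2 \<le> n" and idx: "bij_betw idx {1..n} (UNIV :: 'n set)"
    and \<Omega>: "open \<Omega>" and K: "compact K" "K \<subseteq> \<Omega>" "K \<noteq> {}" and conn: "connected (\<Omega> - K)"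
    and W: "dirac_null n idx (\<Omega> - K) W"
  obtains U where "dirac_null n idx \<Omega> U"
    "\<And>\<alpha> x. \<alpha> \<subseteq> {1..n div 2} \<Longrightarrow> x \<in> \<Omega> - K \<Longrightarrow> U \<alpha> x = W \<alpha> x"
    "\<And>\<alpha>. (\<And>x. x \<in> \<Omega> - K \<Longrightarrow> W \<alpha> x = 0) \<Longrightarrow> (\<And>x. x \<in> \<Omega> \<Longrightarrow> U \<alpha> x = 0)"
proof (rule extension_modulo_decaying[OF n idx \<Omega> K W])
  fix C U v
  assume C: "compact C" "K \<subseteq> C" "C \<subseteq> \<Omega>" and U: "dirac_null n idx \<Omega> U" and v: "dirac_null n idx (- C) v"
    and eq: "\<And>\<alpha> x. \<alpha> \<subseteq> {1..n div 2} \<Longrightarrow> x \<in> \<Omega> - C \<Longrightarrow> U \<alpha> x = W \<alpha> x - v \<alpha> x"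
    and decay: "\<And>\<alpha> e. \<alpha> \<subseteq> {1..n div 2} \<Longrightarrow> 0 < e \<Longrightarrow> \<exists>R. \<forall>x. R < norm x \<longrightarrow> norm (v \<alpha> x) < e"
    and zero: "\<And>\<alpha>. (\<And>x. x \<in> \<Omega> - K \<Longrightarrow> W \<alpha> x = 0) \<Longrightarrow> (\<And>x. x \<in> \<Omega> \<Longrightarrow> U \<alpha> x = 0)"
  define i :: 'n where "i = undefined"
  have cont: "continuous_on C (\<lambda>x. x $ 1 $ i)" by (intro continuous_intros)
  have "C \<noteq> {}" using C(2) K(3) by auto
  from continuous_attains_sup[OF C(1) this cont]
  obtain q where q: "q \<in> C" "\<And>x. x \<in> C \<Longrightarrow> x $ 1 $ i \<le> q $ 1 $ i" by auto
  define H :: "(real^'n^2) set" where "H = {x. q $ 1 $ i < x $ 1 $ i}"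
  have H: "open H" unfolding H_def by (intro open_Collect_less continuous_intros)
  have HC: "H \<subseteq> - C" using q(2) by (force simp: H_def)
  have vH: "v \<beta> x = 0" if "x \<in> H" "\<beta> \<subseteq> {1..n div 2}" for \<beta> x
  proof (rule decaying_dirac_null_halfspace[OF n idx _ that(2)])
    show "dirac_null n idx {x. q $ 1 $ i < x $ 1 $ i} v"
      using dirac_null_subset[OF v HC] by (simp add: H_def)
    show "q $ 1 $ i < x $ 1 $ i" using that(1) by (simp add: H_def)
  qed (rule decay[OF that(2)])
  define N where "N = \<Omega> \<inter> H"
  have N: "open N" "N \<subseteq> \<Omega> - C" unfolding N_def using \<Omega> H HC by auto
  have "N \<noteq> {}"
  proof -
    obtain r where r: "0 < r" "ball q r \<subseteq> \<Omega>" using \<Omega> q(1) C(3) open_contains_ball by blast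
    define x where "x = q + (r / 2) *\<^sub>R (axis 1 (axis i 1) :: real^'n^2)"
    have "x \<in> ball q r" using r by (simp add: x_def dist_norm)
    moreover have "x \<in> H" using r by (simp add: x_def H_def axis_def)
    ultimately show ?thesis using r by (auto simp: N_def)
  qed
  define S where "S = \<Omega> - K"
  have S: "open S" unfolding S_def using \<Omega> K(1) by (simp add: compact_imp_closed open_Diff)
  have NS: "N \<subseteq> S" using N(2) C(2) by (auto simp: S_def)
  define Y where "Y \<alpha> x = U \<alpha> x - W \<alpha> x" for \<alpha> x
  have Y: "dirac_null n idx S Y" unfolding Y_def S_def
    by (rule dirac_null_diff[OF S[unfolded S_def] dirac_null_subset[OF U] W]) auto
  define k where "k = n - 1"
  have k: "1 \<le> k" and dim: "DIM(real^'n^2) = 2 * k + 2" using n DIM_pairs[OF idx] by (auto simp: k_def)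
  have YN: "Y \<alpha> x = 0" if "\<alpha> \<subseteq> {1..n div 2}" "x \<in> N" for \<alpha> x
    using eq[OF that(1), of x] vH[OF _ that(1), of x] that(2) N(2) by (auto simp: Y_def N_def)
  have "Y \<alpha> x = 0" if "\<alpha> \<subseteq> {1..n div 2}" "x \<in> S" for \<alpha> x
    by (rule harmonic_unique_continuation[OF k dim S conn[folded S_def] dirac_null_mvp[OF n idx S Y that(1)]
          dirac_null_Lap[OF n idx S Y that(1)] N(1) \<open>N \<noteq> {}\<close> NS YN[OF that(1)] that(2)])
  then have "U \<alpha> x = W \<alpha> x" if "\<alpha> \<subseteq> {1..n div 2}" "x \<in> \<Omega> - K" for \<alpha> x
    using that unfolding Y_def S_def by simp
  then show thesis using that[OF U] zero by blast
qed

lemma monogenic_iff: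
  fixes u :: "real^'n::finite^2 \<Rightarrow> ext"
  shows "u \<in> monogenic n idx S \<longleftrightarrow> (\<forall>x\<in>S. u x \<in> spinor_plus n) \<and> (\<forall>\<alpha>. cdiff 1 S (\<lambda>x. u x \<alpha>)) \<and>
     (\<forall>A \<alpha> x. \<alpha> \<subseteq> {1..n div 2} \<longrightarrow> x \<in> S \<longrightarrow> dirac n idx A (\<lambda>\<alpha> x. u x \<alpha>) \<alpha> x = 0)"
proof -
  have two: "(\<forall>A::2. P A) \<longleftrightarrow> P 0 \<and> P 1" for P using exhaust_2 by (metis (full_types) numeral_2_eq_2 one_neq_zero)
  have "D0 n idx u x = (\<lambda>\<beta>. 0, \<lambda>\<beta>. 0) \<longleftrightarrow> (\<forall>A \<alpha>. \<alpha> \<subseteq> {1..n div 2} \<longrightarrow> dirac n idx A (\<lambda>\<alpha> x. u x \<alpha>) \<alpha> x = 0)" for x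
    unfolding two D0_def by (auto simp: fun_eq_iff nabla_eq_dirac)
  then show ?thesis unfolding monogenic_def C1_on_iff_cdiff by auto
qed

lemma spinor_plus_carrier: "s \<in> spinor_plus n \<Longrightarrow> \<not> \<alpha> \<subseteq> {1..n div 2} \<Longrightarrow> s \<alpha> = 0"
  by (auto simp: spinor_plus_def ext_carrier_def split: if_splits)

text \<open>
  The components that are required to vanish in the spinor module vanish for the extension too, because
  its construction treats each component linearly and separately.
\<close>

lemma hartogs_dim_ge_2:
  fixes idx :: "nat \<Rightarrow> 'n::finite" and u :: "real^'n^2 \<Rightarrow> ext"
  assumes n: "2 \<le> n" and idx: "bij_betw idx {1..n} UNIV"
    and \<Omega>: "open \<Omega>" and K: "compact K" "K \<subseteq> \<Omega>" "K \<noteq> {}" and conn: "connected (\<Omega> - K)"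
    and u: "u \<in> monogenic n idx (\<Omega> - K)"
  shows "\<exists>U \<in> monogenic n idx \<Omega>. \<forall>x \<in> \<Omega> - K. U x = u x"
proof -
  define W where "W \<alpha> x = u x \<alpha>" for \<alpha> x
  have sp: "u x \<in> spinor_plus n" if "x \<in> \<Omega> - K" for x using u that by (simp add: monogenic_iff)
  have W: "dirac_null n idx (\<Omega> - K) W" using u unfolding monogenic_iff dirac_null_def W_def by blast
  show ?thesis
  proof (rule dirac_null_hartogs[OF n idx \<Omega> K conn W])
    fix U
    assume U: "dirac_null n idx \<Omega> U" "\<And>\<alpha> x. \<alpha> \<subseteq> {1..n div 2} \<Longrightarrow> x \<in> \<Omega> - K \<Longrightarrow> U \<alpha> x = W \<alpha> x"
    and zero: "\<And>\<alpha>. (\<And>x. x \<in> \<Omega> - K \<Longrightarrow> W \<alpha> x = 0) \<Longrightarrow> (\<And>x. x \<in> \<Omega> \<Longrightarrow> U \<alpha> x = 0)"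

  have out: "U \<alpha> x = 0" if "x \<in> \<Omega>" "\<not> \<alpha> \<subseteq> {1..n div 2}" for \<alpha> x
    by (rule zero[OF _ that(1)]) (use spinor_plus_carrier[OF sp that(2)] in \<open>simp add: W_def\<close>)
  have oddz: "U \<alpha> x = 0" if "x \<in> \<Omega>" "even n" "odd (card \<alpha>)" for \<alpha> x
    by (rule zero[OF _ that(1)]) (use sp that in \<open>auto simp: W_def spinor_plus_def\<close>)
  show ?thesis
  proof (rule bexI[of _ "\<lambda>x \<alpha>. U \<alpha> x"])
    show "\<forall>x\<in>\<Omega> - K. (\<lambda>\<alpha>. U \<alpha> x) = u x"
    proof (intro ballI ext)
      fix x \<alpha> assume x: "x \<in> \<Omega> - K"
      show "U \<alpha> x = u x \<alpha>"
        using U(2)[OF _ x, of \<alpha>] out[of x \<alpha>] spinor_plus_carrier[OF sp[OF x], of \<alpha>] x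
        by (cases "\<alpha> \<subseteq> {1..n div 2}") (auto simp: W_def)
    qed
    have "cdiff 1 \<Omega> (U \<alpha>)" for \<alpha>
    proof (cases "\<alpha> \<subseteq> {1..n div 2}")
      case True then show ?thesis using U(1) by (simp add: dirac_null_def)
    next
      case False
      then show ?thesis
        by (intro cdiff_cong[OF \<Omega>, THEN iffD2, OF _ cdiff_const[of _ _ 0]]) (use out in simp)
    qed
    moreover have "(\<lambda>\<alpha>. U \<alpha> x) \<in> spinor_plus n" if "x \<in> \<Omega>" for x
      using out[OF that] oddz[OF that] by (auto simp: spinor_plus_def ext_carrier_def)
    ultimately show "(\<lambda>x \<alpha>. U \<alpha> x) \<in> monogenic n idx \<Omega>"
      using U(1) unfolding monogenic_iff dirac_null_def by blast
  qed
qed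
qed

text \<open>
  For a single generator \<open>\<nabla>\<^sub>A\<close> is a multiple of \<open>\<partial>\<^sub>A\<^sub>1\<close>, and monogenic functions are
  locally constant.
\<close>

lemma hartogs_dim_1:
  fixes idx :: "nat \<Rightarrow> 'n::finite" and u :: "real^'n^2 \<Rightarrow> ext"
  assumes idx: "bij_betw idx {1..1} UNIV"
    and \<Omega>: "open \<Omega>" and K: "compact K" and conn: "connected (\<Omega> - K)"
    and u: "u \<in> monogenic 1 idx (\<Omega> - K)"
  shows "\<exists>U \<in> monogenic 1 idx \<Omega>. \<forall>x \<in> \<Omega> - K. U x = u x"
proof -
  define S where "S = \<Omega> - K"
  have S: "open S" unfolding S_def using \<Omega> K by (simp add: compact_imp_closed open_Diff)
  have u': "\<And>x. x \<in> S \<Longrightarrow> u x \<in> spinor_plus 1" "\<And>\<alpha>. cdiff 1 S (\<lambda>x. u x \<alpha>)"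
    "\<And>A x. x \<in> S \<Longrightarrow> dirac 1 idx A (\<lambda>\<alpha> x. u x \<alpha>) {} x = 0"
    using u unfolding monogenic_iff S_def by auto
  have const: "(\<lambda>x. s) \<in> monogenic 1 idx \<Omega>" if "s \<in> spinor_plus 1" for s
    unfolding monogenic_iff using that cdiff_const by (auto simp: dirac_def simp del: cdiff.simps)
  have pd0: "pd (dirvec idx A 1) (\<lambda>x. u x {}) x = 0" if "x \<in> S" for A x
    using u'(3)[OF that, of A] by (simp add: dirac_def gam_coeff_def gam_index_def)
  have D: "((\<lambda>x. u x {}) has_derivative (\<lambda>_. 0)) (at x)" if x: "x \<in> S" for x
  proof -
    have d: "((\<lambda>x. u x {}) has_derivative (\<lambda>h. \<Sum>b\<in>Basis. (h \<bullet> b) *\<^sub>R pd b (\<lambda>x. u x {}) x)) (at x)"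
      by (rule has_derivative_pd_sum[OF cdiff_differentiable[OF u'(2) _ x]]) simp
    have "(\<lambda>h. \<Sum>b\<in>Basis. (h \<bullet> b) *\<^sub>R pd b (\<lambda>x. u x {}) x) = (\<lambda>_. 0)"
      using pd0[OF x] by (subst sum_Basis_dirvec[OF idx]) simp
    then show ?thesis using d by simp
  qed
  show ?thesis
  proof (cases "S = {}")
    case True
    have "(\<lambda>_. 0) \<in> spinor_plus 1" by (simp add: spinor_plus_def ext_carrier_def)
    from const[OF this] show ?thesis using True unfolding S_def by blast
  next
    case False
    then obtain x0 where x0: "x0 \<in> S" by blast
    have "u x = u x0" if x: "x \<in> S" for x
    proof
      fix \<alpha>
      show "u x \<alpha> = u x0 \<alpha>"
      proof (cases "\<alpha> = {}")
        case True
        then show ?thesis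
          using has_derivative_zero_unique_connected[OF S conn[folded S_def] D x x0] by simp
      next
        case False
        then have "\<not> \<alpha> \<subseteq> {1..1 div 2}" by auto
        then show ?thesis using spinor_plus_carrier u'(1) x x0 by metis
      qed
    qed
    then show ?thesis using const[OF u'(1)[OF x0]] unfolding S_def by metis
  qed
qed

theorem theorem1p2:
  fixes n :: nat and idx :: "nat \<Rightarrow> 'n::finite"
    and \<Omega> K :: "(real^'n^2) set" and u :: "real^'n^2 \<Rightarrow> ext"
  assumes "n \<ge> 1"
    and "bij_betw idx {1..n} UNIV"
    and "open \<Omega>"
    and "compact K"
    and "K \<subseteq> \<Omega>"
    and "connected (\<Omega> - K)"
    and "u \<in> monogenic n idx (\<Omega> - K)"
  shows "\<exists>U \<in> monogenic n idx \<Omega>. \<forall>x \<in> \<Omega> - K. U x = u x"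
proof (cases "K = {}")
  case True
  then show ?thesis using assms(7) by auto
next
  case False
  show ?thesis
  proof (cases "n = 1")
    case True
    show ?thesis using hartogs_dim_1[of idx \<Omega> K u] assms True by simp
  next
    case False
    then have "2 \<le> n" using assms(1) by simp
    then show ?thesis using hartogs_dim_ge_2 assms \<open>K \<noteq> {}\<close> by blast
  qed
qed

end
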